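(* Let $N\in\mathbb{N}$ with $N\le 9$ or $N\in\{11,15,17,23\}$. Let $\xi$ be a Dirichlet character modulo $N$, $k$ a positive integer with $\xi(-1)=(-1)^k$, and let $\{f_n\}_{n\ge1},\{g_n\}_{n\ge1}$ be sequences of complex numbers with $f_n,g_n=O(n^\sigma)$ for some $\sigma>0$. Suppose that for every $q\in\mathbb{N}$ with $(q,N)=1$, the functions $\Lambda_f(s,c_q)$ and $\Lambda_g(s,c_q)$ (defined in the context) continue to entire functions of finite order and satisfy $$\Lambda_f(s,c_q)=i^k\xi(q)(Nq^2)^{\frac12-s}\Lambda_g(1-s,c_q).$$ Then $f(z):=\sum_{n=1}^\infty f_n e(nz)$ belongs to $M_k(\Gamma_0(N),\xi)$.
   Context: $e(x):=e^{2\pi i x}$. For $q\in\mathbb{N}$, $c_q(n)=\sum_{a \bmod q,\,(a,q)=1}e(an/q)$ is the Ramanujan sum. $\Gamma_\mathbb{C}(s):=2(2\pi)^{-s}\Gamma(s)$. For $\Re(s)>\sigma+1-\frac{k-1}{2}$ define $\Lambda_f(s,c_q)=\Gamma_\mathbb{C}(s+\frac{k-1}2)\sum_{n\ge1}f_nc_q(n)n^{-s-\frac{k-1}2}$ and $\Lambda_g(s,c_q)=\Gamma_\mathbb{C}(s+\frac{k-1}2)\sum_{n\ge1}g_nc_q(n)n^{-s-\frac{k-1}2}$. $M_k(\Gamma_0(N),\xi)$ denotes the space of holomorphic modular forms of weight $k$, level $N$ and nebentypus $\xi$. *)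

theory Defs
  imports "HOL-Analysis.Analysis"
begin

definition e :: "complex \<Rightarrow> complex" where
  "e x = exp (2 * of_real pi * \<i> * x)"

definition ramanujan_sum :: "nat \<Rightarrow> nat \<Rightarrow> complex" where
  "ramanujan_sum q n = (\<Sum>a\<in>{a. a < q \<and> coprime a q}. e (of_nat (a * n) / of_nat q))"

definition Gamma_C :: "complex \<Rightarrow> complex" where
  "Gamma_C s = 2 * (of_real (2 * pi)) powr (- s) * Gamma s"

text \<open>Lambda_f(s, c_q) given by its Dirichlet series (meaningful for Re s > sigma + 1 - (k-1)/2)\<close>
definition Lambda_twist :: "nat \<Rightarrow> (nat \<Rightarrow> complex) \<Rightarrow> nat \<Rightarrow> complex \<Rightarrow> complex" where
  "Lambda_twist k a q s =
     Gamma_C (s + of_real ((real k - 1) / 2)) *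
     (\<Sum>m. a (Suc m) * ramanujan_sum q (Suc m) *
            of_nat (Suc m) powr (- s - of_real ((real k - 1) / 2)))"

definition entire_finite_order :: "(complex \<Rightarrow> complex) \<Rightarrow> bool" where
  "entire_finite_order F \<longleftrightarrow> F holomorphic_on UNIV \<and>
     (\<exists>\<rho> C. \<forall>z. norm (F z) \<le> C * exp (norm z powr \<rho>))"

definition dirichlet_character :: "nat \<Rightarrow> (int \<Rightarrow> complex) \<Rightarrow> bool" where
  "dirichlet_character N \<psi> \<longleftrightarrow> N > 0 \<and>
     (\<forall>n. \<psi> (n + int N) = \<psi> n) \<and>
     (\<forall>m n. \<psi> (m * n) = \<psi> m * \<psi> n) \<and>
     \<psi> 1 = 1 \<and>
     (\<forall>n. \<psi> n = 0 \<longleftrightarrow> \<not> coprime n (int N))"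

definition upper_half_plane :: "complex set" where
  "upper_half_plane = {z. Im z > 0}"

text \<open>M_k(Gamma_0(N), xi): holomorphic on the upper half plane, transformation law
  f(gamma z) = xi(d) (cz+d)^k f(z) for gamma in Gamma_0(N), and holomorphic at all cusps
  (for every gamma in SL_2(Z), (cz+d)^(-k) f(gamma z) is bounded on Im z >= 1).\<close>
definition modular_forms :: "nat \<Rightarrow> nat \<Rightarrow> (int \<Rightarrow> complex) \<Rightarrow> (complex \<Rightarrow> complex) set" where
  "modular_forms k N \<xi> = {f.
     f holomorphic_on upper_half_plane \<and>
     (\<forall>a b c d :: int. a * d - b * c = 1 \<and> int N dvd c \<longrightarrow>
        (\<forall>z\<in>upper_half_plane.
           f ((of_int a * z + of_int b) / (of_int c * z + of_int d)) =
             \<xi> d * (of_int c * z + of_int d) ^ k * f z)) \<and>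
     (\<forall>a b c d :: int. a * d - b * c = 1 \<longrightarrow>
        (\<exists>C. \<forall>z. Im z \<ge> 1 \<longrightarrow>
           norm (f ((of_int a * z + of_int b) / (of_int c * z + of_int d)))
             \<le> C * norm (of_int c * z + of_int d) ^ k))}"

end

(*
  For q coprime to N the sum f_q(z) = sum_n f_n c_q(n) e(nz) is the sum of f(z + a/q) over the reduced residues a.
  The functional equations say f_q(z) = const * z^(-k) g_q(-1/(N q^2 z)), and q = 1 expresses g through f, so
  for every q they amount to
     sum_a (f - xi(q) f | A_a) | (1, a/q; 0, 1) = 0,   A_a = (q, -a; -N b, (1 + N a b)/q) in Gamma_0(N),  N a b = -1 mod q.
  For q = 1 and q = 2 this is an invariance of f. For the other q that are used all but two of the defects
  f - xi(q) f | A_a vanish or can be eliminated, and the rest of them are translates of one function h by slash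
  operators. Thus h is an eigenfunction, with a root of unity as eigenvalue, of an elliptic matrix whose trace is rational
  but not integral. The matrix has infinite order, and comparing leading Taylor coefficients at its fixed point gives
  h = 0 (Weil). For the levels N in question the matrices obtained this way generate Gamma_0(N).
*)
theory Submission
  imports Defs "HOL-Complex_Analysis.Complex_Analysis" "HOL-Real_Asymp.Real_Asymp"
    "HOL-Number_Theory.Number_Theory"
begin

text \<open>A twist by c_q only sees the sum over all reduced residues modulo q; a single residue,
  which twists by characters would isolate, is out of reach. This shapes the choice of moduli: a
  relation is useful if q has at most two reduced residues (q = 2, 3, 4, 6) or if all but two of its
  terms are already known to vanish (q = 5 at level 6, q = 8 at level 15). It also limits the
  levels. For N \<le> 4 the translations, -1 and the matrix (1, 0; N, 1) suffice; levels 5, 7, 9 add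
  q = 2; levels 8, 11, 17 draw on the factorisations 9 = 3 * 3, 12 = 3 * 4, 18 = 3 * 6 of N + 1;
  levels 15 and 23 use 16 = 4 * 4 and 24 = 4 * 6 and, like level 6, one further relation. About the
  size of f in the half-plane only the growth of its coefficients is known. The resulting bound by a
  negative power of Im z has to serve twice: in the inversion of the Mellin transform, and at the
  cusps, where periodicity and a Phragmen-Lindeloef argument turn it into boundedness.\<close>

section \<open>Phragmen--Lindeloef and moments\<close>

text \<open>The maximum principle on the part of S inside a large disk: a frontier point lies on the
  frontier of S, where \<open>bd\<close> and \<open>le1\<close> apply, or on the circle, where the
  damping factor wins. Then \<epsilon> tends to 0 at a fixed z. The factor is kept abstract because
  a strip and a half-plane need different ones.\<close>

lemma phragmen_lindelof_damped:
  fixes R :: "complex \<Rightarrow> complex" and w :: "real \<Rightarrow> complex \<Rightarrow> complex"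
  assumes S: "closed S" and R: "continuous_on S R" "R holomorphic_on interior S"
    and w: "\<And>\<epsilon>. \<epsilon> > 0 \<Longrightarrow> continuous_on S (w \<epsilon>)" "\<And>\<epsilon>. \<epsilon> > 0 \<Longrightarrow> w \<epsilon> holomorphic_on interior S"
    and le1: "\<And>\<epsilon> z. \<epsilon> > 0 \<Longrightarrow> z \<in> S \<Longrightarrow> norm (w \<epsilon> z) \<le> 1"
    and lim: "\<And>z. z \<in> S \<Longrightarrow> ((\<lambda>\<epsilon>. w \<epsilon> z) \<longlongrightarrow> 1) (at_right 0)"
    and decay: "\<And>\<epsilon>. \<epsilon> > 0 \<Longrightarrow> \<exists>r. \<forall>z\<in>S. norm z \<ge> r \<longrightarrow> norm (R z * w \<epsilon> z) \<le> K"
    and bd: "\<And>z. z \<in> frontier S \<Longrightarrow> norm (R z) \<le> K" and z: "z \<in> S"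
  shows "norm (R z) \<le> K"
proof -
  have *: "norm (R z * w \<epsilon> z) \<le> K" if \<epsilon>: "\<epsilon> > 0" for \<epsilon>
  proof -
    obtain r where r: "\<And>z. z \<in> S \<Longrightarrow> norm z \<ge> r \<Longrightarrow> norm (R z * w \<epsilon> z) \<le> K"
      using decay[OF \<epsilon>] by blast
    define r' where "r' = max r (norm z) + 1"
    define T where "T = S \<inter> cball 0 r'"
    have r': "r' \<noteq> 0" "r' \<ge> r" "norm z \<le> r'"
      unfolding r'_def using norm_ge_zero[of z] by linarith+
    have cT: "closed T" unfolding T_def using S by auto
    have TS: "T \<subseteq> S" unfolding T_def by auto
    show ?thesis
    proof (rule maximum_modulus_frontier[of "\<lambda>z. R z * w \<epsilon> z" T])
      have "interior T \<subseteq> interior S" using TS by (rule interior_mono)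
      then show "(\<lambda>z. R z * w \<epsilon> z) holomorphic_on interior T"
        using R(2) w(2)[OF \<epsilon>] by (auto intro!: holomorphic_intros intro: holomorphic_on_subset)
      show "continuous_on (closure T) (\<lambda>z. R z * w \<epsilon> z)"
        using R(1) w(1)[OF \<epsilon>] TS cT by (auto intro!: continuous_intros intro: continuous_on_subset)
      show "bounded T" unfolding T_def by (auto simp: bounded_Int)
      show "z \<in> T" using z r' unfolding T_def by auto
      fix x assume x: "x \<in> frontier T"
      have xT: "x \<in> T" using x cT by (auto simp: frontier_def)
      have "x \<in> frontier S \<or> x \<in> frontier (cball 0 r')"
        using x frontier_Int_subset[of S "cball 0 r'"] unfolding T_def by blast
      then show "norm (R x * w \<epsilon> x) \<le> K"
      proof
        assume a: "x \<in> frontier S"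
        have "norm (R x * w \<epsilon> x) \<le> norm (R x) * 1"
          unfolding norm_mult using le1[OF \<epsilon>, of x] xT TS by (intro mult_left_mono) auto
        with bd[OF a] show ?thesis by simp
      next
        assume "x \<in> frontier (cball 0 r')"
        then have "norm x = r'" using r'(1) by (simp add: frontier_cball)
        then show ?thesis using r[of x] xT TS r' by auto
      qed
    qed
  qed
  have "((\<lambda>\<epsilon>. norm (R z * w \<epsilon> z)) \<longlongrightarrow> norm (R z * 1)) (at_right 0)"
    by (intro tendsto_intros lim z)
  then show ?thesis
    using tendsto_upperbound[of "\<lambda>\<epsilon>. norm (R z * w \<epsilon> z)" "norm (R z)" "at_right 0" K] *
    by (auto simp: eventually_at_right_less intro: eventually_mono[OF eventually_at_right_less])
qed

text \<open>With B and m from the growth of a function of finite order, this is why a doubly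
  exponential damping factor is strong enough in a strip.\<close>

lemma power_minus_exp_at_bot:
  fixes B c \<delta> :: real
  assumes "c > 0" "\<delta> > 0"
  shows "filterlim (\<lambda>u. (u + B) ^ m - \<delta> * exp (u / c)) at_bot at_top"
proof -
  define A where "A = (2 * c) ^ m"
  have A: "A > 0" unfolding A_def using assms by simp
  have f1: "filterlim (\<lambda>u. u / c) at_top at_top"
    using assms by real_asymp
  have "((\<lambda>u. (u / c) ^ m / exp (u / c)) \<longlongrightarrow> 0) at_top"
    using filterlim_compose[OF tendsto_power_div_exp_0 f1] .
  then have "eventually (\<lambda>u. (u / c) ^ m / exp (u / c) < \<delta> / (2 * A)) at_top"
    by (rule order_tendstoD) (use A assms in auto)
  moreover have "eventually (\<lambda>u. u \<ge> max \<bar>B\<bar> 0) at_top" by (rule eventually_ge_at_top)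
  ultimately have ev: "eventually (\<lambda>u. (u + B) ^ m - \<delta> * exp (u / c) \<le> - (\<delta> / 2) * exp (u / c)) at_top"
  proof eventually_elim
    case (elim u)
    have "(u + B) ^ m \<le> (2 * u) ^ m" by (intro power_mono) (use elim in auto)
    also have "\<dots> = A * (u / c) ^ m" unfolding A_def using assms by (simp add: power_mult_distrib power_divide)
    also have "\<dots> \<le> A * (\<delta> / (2 * A) * exp (u / c))"
      using elim(1) A by (intro mult_left_mono) (auto simp: divide_less_eq)
    also have "\<dots> = \<delta> / 2 * exp (u / c)" using A by simp
    finally show ?case by simp
  qed
  have "filterlim (\<lambda>u. - (\<delta> / 2) * exp (u / c)) at_bot at_top"
    using assms by real_asymp
  then show ?thesis using ev by (rule filterlim_at_bot_mono)
qed

text \<open>The damping factor is exp(-\<epsilon> cos(z / c)). In the strip Re(z / c) lies in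
  [-1, 1], where the cosine is at least cos 1 > 0, and Re cos(x + iy) = cos x cosh y; hence the
  factor decays doubly exponentially in |Im z|.\<close>

lemma phragmen_lindelof_strip:
  fixes R :: "complex \<Rightarrow> complex"
  assumes R: "R holomorphic_on UNIV" and c: "c > 0" and K: "K > 0"
    and growth: "\<And>z. \<bar>Re z\<bar> \<le> c \<Longrightarrow> norm (R z) \<le> C * exp ((norm z + B) ^ m)"
    and edge: "\<And>z. \<bar>Re z\<bar> = c \<Longrightarrow> norm (R z) \<le> K"
    and z: "\<bar>Re z\<bar> \<le> c"
  shows "norm (R z) \<le> K"
proof -
  define S where "S = {z. \<bar>Re z\<bar> \<le> c}"
  have S_eq: "S = {z. Re z \<le> c} \<inter> {z. Re z \<ge> -c}" unfolding S_def by auto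
  have clS: "closed S" unfolding S_eq by (intro closed_Int closed_halfspace_Re_le closed_halfspace_Re_ge)
  have op: "open {z. \<bar>Re z\<bar> < c}" by (intro open_Collect_less continuous_intros)
  have c1: "cos (1::real) > 0" using cos_gt_zero_pi[of 1] pi_gt3 by auto
  have re: "cos 1 * (exp (\<bar>Im z\<bar> / c) / 2) \<le> Re (cos (z / of_real c))" if "\<bar>Re z\<bar> \<le> c" for z
  proof -
    have "cos 1 \<le> cos (\<bar>Re z / c\<bar>)"
      by (rule cos_monotone_0_pi_le) (use that c pi_gt3 in \<open>auto simp: abs_le_iff field_simps\<close>)
    then have "cos 1 \<le> cos (Re z / c)" by (simp only: cos_abs_real)
    moreover have "exp (\<bar>Im z\<bar> / c) \<le> exp (Im z / c) + exp (- (Im z / c))"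
      by (cases "Im z \<ge> 0") (use less_imp_le[OF exp_gt_zero] in \<open>auto simp: add_increasing add_increasing2\<close>)
    ultimately have "cos 1 * (exp (\<bar>Im z\<bar> / c) / 2) \<le> cos (Re z / c) * ((exp (Im z / c) + exp (- (Im z / c))) / 2)"
      using c1 by (intro mult_mono) auto
    then show ?thesis by (simp add: Re_cos)
  qed
  show ?thesis
  proof (rule phragmen_lindelof_damped[of S R "\<lambda>\<epsilon> z. exp (- of_real \<epsilon> * cos (z / of_real c))"])
    show "closed S" by (fact clS)
    show "continuous_on S R" using R holomorphic_on_imp_continuous_on holomorphic_on_subset by blast
    show "R holomorphic_on interior S" using R by (rule holomorphic_on_subset) auto
    show "z \<in> S" using z unfolding S_def by auto
    show "continuous_on S (\<lambda>z. exp (- of_real \<epsilon> * cos (z / of_real c)))" if "\<epsilon> > 0" for \<epsilon>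
      by (intro holomorphic_on_imp_continuous_on holomorphic_intros) (use c in auto)
    show "(\<lambda>z. exp (- of_real \<epsilon> * cos (z / of_real c))) holomorphic_on interior S" if "\<epsilon> > 0" for \<epsilon>
      by (intro holomorphic_intros) (use c in auto)
    show "norm (exp (- of_real \<epsilon> * cos (z / of_real c))) \<le> 1" if "\<epsilon> > 0" "z \<in> S" for \<epsilon> z
    proof -
      have "0 \<le> cos 1 * (exp (\<bar>Im z\<bar> / c) / 2)" using c1 by simp
      also note re[of z]
      finally have "0 \<le> \<epsilon> * Re (cos (z / of_real c))" using that unfolding S_def by auto
      then show ?thesis by (simp add: norm_exp)
    qed
    show "((\<lambda>\<epsilon>. exp (- complex_of_real \<epsilon> * cos (z / of_real c))) \<longlongrightarrow> 1) (at_right 0)" for z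
    proof -
      have "((\<lambda>\<epsilon>. exp (- complex_of_real \<epsilon> * cos (z / of_real c))) \<longlongrightarrow> exp (- of_real 0 * cos (z / of_real c))) (at_right 0)"
        by (intro tendsto_intros)
      then show ?thesis by simp
    qed
    show "norm (R z) \<le> K" if "z \<in> frontier S" for z
    proof -
      have "z \<in> S" using that clS frontier_subset_closed by blast
      moreover have "z \<notin> interior S" using that by (auto simp: frontier_def)
      moreover have "{z. \<bar>Re z\<bar> < c} \<subseteq> interior S" by (intro interior_maximal op) (auto simp: S_def)
      ultimately have "\<bar>Re z\<bar> = c" unfolding S_def by force
      then show ?thesis by (rule edge)
    qed
    show "\<exists>r. \<forall>z\<in>S. norm z \<ge> r \<longrightarrow> norm (R z * exp (- of_real \<epsilon> * cos (z / of_real c))) \<le> K" if e: "\<epsilon> > 0" for \<epsilon>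
    proof -
      \<comment> \<open>The factor exp(-1) pays for replacing |Im z| by its lower bound |z| - c in
        the exponent.\<close>
      define \<delta> where "\<delta> = \<epsilon> * cos 1 * exp (-1) / 2"
      have d: "\<delta> > 0" unfolding \<delta>_def using e c1 by simp
      have "((\<lambda>u. \<bar>C\<bar> * exp ((u + B) ^ m - \<delta> * exp (u / c))) \<longlongrightarrow> \<bar>C\<bar> * 0) at_top"
        by (intro tendsto_intros filterlim_compose[OF exp_at_bot power_minus_exp_at_bot] c d)
      then have "eventually (\<lambda>u. \<bar>C\<bar> * exp ((u + B) ^ m - \<delta> * exp (u / c)) < K) at_top"
        by (rule order_tendstoD) (use K in auto)
      then obtain r where r: "\<And>u. u \<ge> r \<Longrightarrow> \<bar>C\<bar> * exp ((u + B) ^ m - \<delta> * exp (u / c)) < K"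
        by (auto simp: eventually_at_top_linorder)
      have "norm (R z * exp (- of_real \<epsilon> * cos (z / of_real c))) \<le> K" if "z \<in> S" "norm z \<ge> r" for z
      proof -
        have zc: "\<bar>Re z\<bar> \<le> c" using that by (auto simp: S_def)
        have "norm z - c \<le> \<bar>Im z\<bar>" using cmod_le[of z] zc by linarith
        then have "norm z / c - 1 \<le> \<bar>Im z\<bar> / c"
          using c divide_right_mono[of "norm z - c" "\<bar>Im z\<bar>" c] by (simp add: diff_divide_distrib)
        then have "exp (norm z / c - 1) \<le> exp (\<bar>Im z\<bar> / c)" by simp
        then have "\<delta> * exp (norm z / c) \<le> \<epsilon> * (cos 1 * (exp (\<bar>Im z\<bar> / c) / 2))"
          unfolding \<delta>_def using e c1 by (simp add: exp_diff exp_minus field_simps)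
        also have "\<dots> \<le> \<epsilon> * Re (cos (z / of_real c))" using re[OF zc] e by (intro mult_left_mono) auto
        finally have 1: "- \<epsilon> * Re (cos (z / of_real c)) \<le> - \<delta> * exp (norm z / c)" by simp
        have "norm (R z * exp (- of_real \<epsilon> * cos (z / of_real c))) = norm (R z) * exp (- \<epsilon> * Re (cos (z / of_real c)))"
          by (simp add: norm_mult norm_exp)
        also have "\<dots> \<le> (\<bar>C\<bar> * exp ((norm z + B) ^ m)) * exp (- \<delta> * exp (norm z / c))"
        proof (intro mult_mono)
          show "norm (R z) \<le> \<bar>C\<bar> * exp ((norm z + B) ^ m)"
            by (rule order.trans[OF growth[OF zc] mult_right_mono[OF abs_ge_self]]) simp
        qed (use 1 in auto)
        also have "\<dots> = \<bar>C\<bar> * exp ((norm z + B) ^ m - \<delta> * exp (norm z / c))"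
          by (simp add: exp_diff exp_minus field_simps)
        also have "\<dots> < K" using r that by blast
        finally show ?thesis by simp
      qed
      then show ?thesis by blast
    qed
  qed
qed

text \<open>For a polynomial g that is \<epsilon>-close to u, the integral of u^2 equals that of u
  (u - g), hence is at most \<epsilon> times the integral of |u|.\<close>

lemma zero_moments_imp_zero_real:
  fixes u :: "real \<Rightarrow> real"
  assumes u: "continuous_on {0..1} u" and mom: "\<And>n. integral {0..1} (\<lambda>t. u t * t ^ n) = 0"
    and t: "t \<in> {0..1}"
  shows "u t = 0"
proof -
  have int: "f integrable_on {0..1}" if "continuous_on {0..1} f" for f :: "real \<Rightarrow> real"
    using that by (rule integrable_continuous_interval)
  have poly: "integral {0..1} (\<lambda>t. u t * (\<Sum>i\<le>n. a i * t ^ i)) = 0" for n :: nat and a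
  proof -
    have "integral {0..1} (\<lambda>t. u t * (\<Sum>i\<le>n. a i * t ^ i)) = integral {0..1} (\<lambda>t. \<Sum>i\<le>n. a i * (u t * t ^ i))"
      by (simp add: sum_distrib_left mult_ac)
    also have "\<dots> = (\<Sum>i\<le>n. integral {0..1} (\<lambda>t. a i * (u t * t ^ i)))"
      by (intro integral_sum int continuous_intros u) auto
    also have "\<dots> = 0" using mom by simp
    finally show ?thesis .
  qed
  define I where "I = integral {0..1} (\<lambda>t. \<bar>u t\<bar>)"
  have I0: "I \<ge> 0" unfolding I_def by (intro integral_nonneg int continuous_intros u) auto
  define J where "J = integral {0..1} (\<lambda>t. u t * u t)"
  have J: "J \<le> \<epsilon> * I" if "\<epsilon> > 0" for \<epsilon>
  proof -
    obtain g where g: "polynomial_function g" "\<And>x. x \<in> {0..1} \<Longrightarrow> norm (u x - g x) < \<epsilon>"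
      using Stone_Weierstrass_polynomial_function[OF _ u \<open>\<epsilon> > 0\<close>] by auto
    then have "real_polynomial_function g" by (simp add: real_polynomial_function_eq)
    then obtain a n where a: "g = (\<lambda>x. \<Sum>i\<le>n. a i * x ^ i)"
      by (auto simp: real_polynomial_function_iff_sum)
    have cg: "continuous_on {0..1} g" unfolding a by (intro continuous_intros)
    have "J = integral {0..1} (\<lambda>t. u t * u t) - integral {0..1} (\<lambda>t. u t * g t)"
      using poly[where n=n and a=a] by (simp add: J_def a)
    also have "\<dots> = integral {0..1} (\<lambda>t. u t * u t - u t * g t)"
      by (intro integral_diff[symmetric] int continuous_intros u cg)
    also have "\<dots> \<le> integral {0..1} (\<lambda>t. \<epsilon> * \<bar>u t\<bar>)"
    proof (intro integral_le int continuous_intros u cg)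
      fix x :: real assume x: "x \<in> {0..1}"
      have "u x * u x - u x * g x = u x * (u x - g x)" by (simp add: algebra_simps)
      also have "\<dots> \<le> \<bar>u x\<bar> * \<bar>u x - g x\<bar>" by (metis abs_ge_self abs_mult)
      also have "\<dots> \<le> \<bar>u x\<bar> * \<epsilon>" using g(2)[OF x] by (intro mult_left_mono) auto
      finally show "u x * u x - u x * g x \<le> \<epsilon> * \<bar>u x\<bar>" by (simp add: mult.commute)
    qed
    also have "\<dots> = \<epsilon> * I" by (simp add: I_def)
    finally show ?thesis .
  qed
  have "J \<le> 0"
  proof (rule ccontr)
    assume "\<not> J \<le> 0"
    \<comment> \<open>The tolerance brings the bound below J / 2; the summand 1 covers the case I =
      0.\<close>
    then have "J \<le> J / (2 * (I + 1)) * I" by (intro J) (use I0 in auto)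
    also have "\<dots> \<le> J / 2" using I0 \<open>\<not> J \<le> 0\<close> by (simp add: field_simps)
    finally show False using \<open>\<not> J \<le> 0\<close> by simp
  qed
  moreover have "J \<ge> 0" unfolding J_def by (intro integral_nonneg int continuous_intros u) auto
  ultimately have "integral (cbox 0 1) (\<lambda>t. u t * u t) = 0" by (simp add: J_def)
  then have "u t * u t = 0"
    using has_integral_0_cbox_imp_0[of 0 1 "\<lambda>t. u t * u t" t] t u
    by (auto intro!: continuous_intros simp: has_integral_iff int)
  then show ?thesis by simp
qed

lemma zero_moments_imp_zero:
  fixes u :: "real \<Rightarrow> complex"
  assumes u: "continuous_on {0..1} u" and mom: "\<And>n. integral {0..1} (\<lambda>t. u t * of_real t ^ n) = 0"
    and t: "t \<in> {0..1}"
  shows "u t = 0"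
proof -
  have int: "(\<lambda>t. u t * of_real t ^ n) integrable_on {0..1}" for n
    by (intro integrable_continuous_interval continuous_intros u)
  have Re: "integral {0..1} (\<lambda>t. Re (u t) * t ^ n) = 0" and Im: "integral {0..1} (\<lambda>t. Im (u t) * t ^ n) = 0" for n
    using integral_linear[OF int bounded_linear_Re, of n] integral_linear[OF int bounded_linear_Im, of n] mom[of n]
    by (auto simp: o_def simp flip: of_real_power)
  have "Re (u t) = 0" by (rule zero_moments_imp_zero_real[OF _ Re t]) (intro continuous_intros u)
  moreover have "Im (u t) = 0" by (rule zero_moments_imp_zero_real[OF _ Im t]) (intro continuous_intros u)
  ultimately show ?thesis by (simp add: complex_eq_iff)
qed

section \<open>Power series and their Mellin transforms\<close>

text \<open>The coefficient \<open>a m\<close> belongs to the index m + 1: the series has no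
  constant term, and therefore decays as Im z tends to infinity.\<close>

definition fser :: "(nat \<Rightarrow> complex) \<Rightarrow> complex \<Rightarrow> complex" where
  "fser a z = (\<Sum>m. a m * e (of_nat (Suc m) * z))"

lemma norm_e: "norm (e z) = exp (- 2 * pi * Im z)"
  by (simp add: e_def norm_exp)

lemma e_add: "e (x + y) = e x * e y"
  by (simp add: e_def ring_distribs exp_add)

lemma e_of_int [simp]: "e (of_int n) = 1"
  using exp_integer_2pi[of "of_int n"] by (simp add: e_def mult_ac)

lemma exp_minus_le_power:
  assumes "x > (0::real)"
  shows "exp (- x) \<le> fact p / x ^ p"
proof -
  have "x ^ p / fact p \<le> exp x"
    using sum_le_suminf[OF summable_exp_generic[of x], of "{p}"] assms
    by (simp add: exp_def scaleR_conv_of_real field_simps)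
  then show ?thesis using assms by (simp add: exp_minus field_simps)
qed

lemma summable_Suc_powr: "r < -1 \<Longrightarrow> summable (\<lambda>m. real (Suc m) powr r)"
  using summable_real_powr_iff[of r] summable_Suc_iff[of "\<lambda>m. real m powr r"] by simp

context
  fixes a :: "nat \<Rightarrow> complex" and C \<sigma> :: real
  assumes a: "\<And>m. norm (a m) \<le> C * real (Suc m) powr \<sigma>"
begin

lemma C_nonneg: "C \<ge> 0"
  using a[of 0] norm_ge_zero[of "a 0"] by (simp del: norm_ge_zero)

text \<open>The exponential decay is traded for p powers of 1 / (n Im z); at least \<sigma> + 2 of
  them are spent on the convergence of the sum over n.\<close>

lemma fser_term_le:
  assumes p: "real p \<ge> \<sigma> + 2" and z: "Im z > 0"
  shows "norm (a m * e (of_nat (Suc m) * z)) \<le> C * fact p / Im z ^ p * real (Suc m) powr (-2)"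
proof -
  define n where "n = real (Suc m)"
  have n: "n \<ge> 1" unfolding n_def by simp
  have "norm (e (of_nat (Suc m) * z)) = exp (- (2 * pi * (n * Im z)))"
    by (simp add: norm_e n_def)
  also have "\<dots> \<le> exp (- (n * Im z))"
    using mult_right_mono[of 1 "2 * pi" "n * Im z"] pi_gt3 n z by simp
  also have "\<dots> \<le> fact p / (n * Im z) ^ p"
    by (rule exp_minus_le_power) (use n z in auto)
  also have "\<dots> = fact p / Im z ^ p * n powr (- real p)"
    using n by (simp add: power_mult_distrib powr_minus powr_realpow divide_inverse)
  finally have "norm (a m * e (of_nat (Suc m) * z)) \<le> (C * n powr \<sigma>) * (fact p / Im z ^ p * n powr (- real p))"
    unfolding norm_mult using a[of m] C_nonneg by (intro mult_mono) (auto simp: n_def)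
  also have "\<dots> = C * fact p / Im z ^ p * n powr (\<sigma> - real p)"
    by (simp add: powr_diff powr_minus divide_inverse)
  also have "\<dots> \<le> C * fact p / Im z ^ p * n powr (-2)"
    using n p z C_nonneg by (intro mult_left_mono powr_mono) auto
  finally show ?thesis unfolding n_def .
qed

lemma summable_fser:
  assumes z: "Im z > 0"
  shows "summable (\<lambda>m. norm (a m * e (of_nat (Suc m) * z)))"
proof -
  obtain p :: nat where p: "real p \<ge> \<sigma> + 2" using real_arch_simple by blast
  show ?thesis
  proof (rule summable_comparison_test'[of _ 0])
    show "summable (\<lambda>m. C * fact p / Im z ^ p * real (Suc m) powr (-2))"
      by (intro summable_mult summable_Suc_powr) simp
  qed (use fser_term_le[OF p z] in simp)
qed

text \<open>One estimate with two uses: a fixed p controls the growth towards the real line, and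
  arbitrarily large p give rapid decay upwards.\<close>

lemma fser_bound:
  assumes p: "real p \<ge> \<sigma> + 2"
  shows "\<exists>D\<ge>0. \<forall>z. Im z > 0 \<longrightarrow> norm (fser a z) \<le> D / Im z ^ p"
proof (intro exI conjI allI impI)
  define S where "S = (\<Sum>m. real (Suc m) powr (-2))"
  have S: "(\<lambda>m. real (Suc m) powr (-2)) sums S" unfolding S_def
    by (intro summable_sums summable_Suc_powr) simp
  show "0 \<le> C * fact p * S"
    using C_nonneg suminf_nonneg[OF sums_summable[OF S]] by (auto simp: S_def)
  fix z assume z: "Im z > 0"
  have "norm (fser a z) \<le> (\<Sum>m. norm (a m * e (of_nat (Suc m) * z)))"
    unfolding fser_def by (rule summable_norm[OF summable_fser[OF z]])
  also have "\<dots> \<le> (\<Sum>m. C * fact p / Im z ^ p * real (Suc m) powr (-2))"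
    by (intro suminf_le fser_term_le[OF p z] summable_fser[OF z] summable_mult summable_Suc_powr) auto
  also have "\<dots> = C * fact p / Im z ^ p * S"
    unfolding S_def by (intro suminf_mult summable_Suc_powr) auto
  finally have "norm (fser a z) \<le> C * fact p / Im z ^ p * S" .
  then show "norm (fser a z) \<le> C * fact p * S / Im z ^ p" by simp
qed

lemma holomorphic_fser: "fser a holomorphic_on {z. Im z > 0}"
proof (rule holomorphic_uniform_sequence[of _ "\<lambda>n z. \<Sum>m<n. a m * e (of_nat (Suc m) * z)"])
  show "open {z. Im z > 0}" by (rule open_halfspace_Im_gt)
  show "(\<lambda>z. \<Sum>m<n. a m * e (of_nat (Suc m) * z)) holomorphic_on {z. Im z > 0}" for n
    unfolding e_def by (intro holomorphic_intros)
  fix x assume "x \<in> {z. Im z > 0}"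
  then have x: "Im x > 0" by simp
  obtain p :: nat where p: "real p \<ge> \<sigma> + 2" using real_arch_simple by blast
  have *: "Im y \<ge> Im x / 2" if "y \<in> cball x (Im x / 2)" for y
    using abs_Im_le_cmod[of "x - y"] that by (auto simp: dist_norm abs_le_iff)
  have "uniform_limit (cball x (Im x / 2)) (\<lambda>n z. \<Sum>m<n. a m * e (of_nat (Suc m) * z)) (fser a) sequentially"
    unfolding fser_def
  proof (rule Weierstrass_m_test)
    show "summable (\<lambda>m. C * fact p / (Im x / 2) ^ p * real (Suc m) powr (-2))"
      by (intro summable_mult summable_Suc_powr) simp
    fix m y assume "y \<in> cball x (Im x / 2)"
    from *[OF this] have y: "Im y \<ge> Im x / 2" .
    have "norm (a m * e (of_nat (Suc m) * y)) \<le> C * fact p / Im y ^ p * real (Suc m) powr (-2)"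
      by (rule fser_term_le[OF p]) (use y x in auto)
    also have "\<dots> \<le> C * fact p / (Im x / 2) ^ p * real (Suc m) powr (-2)"
      by (intro mult_right_mono divide_left_mono power_mono mult_pos_pos zero_less_power)
         (use y x C_nonneg in auto)
    finally show "norm (a m * e (of_nat (Suc m) * y)) \<le> C * fact p / (Im x / 2) ^ p * real (Suc m) powr (-2)" .
  qed
  moreover have "cball x (Im x / 2) \<subseteq> {z. Im z > 0}" using * x by fastforce
  ultimately show "\<exists>d>0. cball x d \<subseteq> {z. 0 < Im z} \<and>
      uniform_limit (cball x d) (\<lambda>n z. \<Sum>m<n. a m * e (of_nat (Suc m) * z)) (fser a) sequentially"
    using x by (intro exI[of _ "Im x / 2"]) auto
qed

end

text \<open>Termwise integration is available for the Lebesgue integral over the whole line; the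
  indicator of S carries it over to the gauge integral over S, in which the Mellin transforms are
  written.\<close>

lemma integral_suminf_absolutely:
  fixes f :: "nat \<Rightarrow> real \<Rightarrow> complex"
  assumes int: "\<And>m. f m absolutely_integrable_on S"
    and sm: "\<And>x. x \<in> S \<Longrightarrow> summable (\<lambda>m. norm (f m x))"
    and smi: "summable (\<lambda>m. integral S (\<lambda>x. norm (f m x)))"
  shows "(\<lambda>x. \<Sum>m. f m x) absolutely_integrable_on S"
    and "(\<lambda>m. integral S (f m)) sums integral S (\<lambda>x. \<Sum>m. f m x)"
proof -
  let ?g = "\<lambda>m x. indicat_real S x *\<^sub>R f m x"
  have g: "integrable lebesgue (?g m)" for m using int[of m] by (simp add: set_integrable_def)
  have n: "(\<integral>x. norm (?g m x) \<partial>lebesgue) = integral S (\<lambda>x. norm (f m x))" for m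
  proof -
    have "(\<lambda>x. norm (f m x)) absolutely_integrable_on S"
      using absolutely_integrable_norm[OF int[of m]] by (simp add: o_def)
    from set_lebesgue_integral_eq_integral(2)[OF this]
    show ?thesis by (simp add: set_lebesgue_integral_def)
  qed
  have A: "AE x in lebesgue. summable (\<lambda>m. norm (?g m x))"
    using sm by (intro always_eventually) (auto simp: indicator_def)
  have B: "summable (\<lambda>m. \<integral>x. norm (?g m x) \<partial>lebesgue)" unfolding n by (rule smi)
  have eq: "(\<Sum>m. ?g m x) = indicat_real S x *\<^sub>R (\<Sum>m. f m x)" for x
    by (auto simp: indicator_def)
  have "integrable lebesgue (\<lambda>x. \<Sum>m. ?g m x)" by (rule integrable_suminf[OF g A B])
  then show I: "(\<lambda>x. \<Sum>m. f m x) absolutely_integrable_on S"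
    unfolding eq by (simp add: set_integrable_def)
  have "(\<lambda>m. integral\<^sup>L lebesgue (?g m)) sums (\<integral>x. (\<Sum>m. ?g m x) \<partial>lebesgue)"
    by (rule sums_integral[OF g A B])
  then show "(\<lambda>m. integral S (f m)) sums integral S (\<lambda>x. \<Sum>m. f m x)"
    unfolding eq using set_lebesgue_integral_eq_integral(2)[OF I] set_lebesgue_integral_eq_integral(2)[OF int]
    by (simp add: set_lebesgue_integral_def)
qed

lemma Gamma_integral_scaled:
  assumes s: "Re s > 0" and \<kappa>: "\<kappa> > 0"
  defines "f \<equiv> \<lambda>t. of_real (exp (- \<kappa> * t)) * complex_of_real t powr (s - 1)"
  shows "f absolutely_integrable_on {0<..}" and "integral {0<..} f = Gamma s * of_real \<kappa> powr (- s)"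
    and "integral {0<..} (\<lambda>t. norm (f t)) = Gamma (Re s) * \<kappa> powr (- Re s)"
proof -
  let ?F = "\<lambda>s t. complex_of_real t powr (s - 1) / of_real (exp t)"
  let ?f = "\<lambda>s t. of_real (exp (- \<kappa> * t)) * complex_of_real t powr (s - 1)"
  have im: "(\<lambda>t. \<kappa> * t) ` {0<..} = {0<..}"
    using \<kappa> by (auto simp: image_iff intro!: bexI[of _ "_ / \<kappa>"])
  have main: "?f s absolutely_integrable_on {0<..} \<and> integral {0<..} (?f s) = Gamma s * of_real \<kappa> powr (- s)"
    if s: "Re s > 0" for s
  proof -
    have F: "?F s absolutely_integrable_on (\<lambda>t. \<kappa> * t) ` {0<..} \<and> integral ((\<lambda>t. \<kappa> * t) ` {0<..}) (?F s) = Gamma s"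
      unfolding im using absolutely_integrable_Gamma_integral'[OF s] Gamma_integral_complex'[OF s]
      by (auto simp: integral_unique)
    have "(\<lambda>t. \<bar>\<kappa>\<bar> *\<^sub>R ?F s (\<kappa> * t)) absolutely_integrable_on {0<..} \<and>
          integral {0<..} (\<lambda>t. \<bar>\<kappa>\<bar> *\<^sub>R ?F s (\<kappa> * t)) = Gamma s"
      by (rule iffD2[OF has_absolute_integral_change_of_variables_real F])
         (use \<kappa> in \<open>auto intro!: derivative_eq_intros inj_onI\<close>)
    moreover have eq: "\<bar>\<kappa>\<bar> *\<^sub>R ?F s (\<kappa> * t) = of_real \<kappa> powr s * ?f s t" if "t \<in> {0<..}" for t
      using that \<kappa> by (simp add: powr_times_real powr_diff scaleR_conv_of_real exp_minus field_simps)
    then have c: "(\<lambda>t. \<bar>\<kappa>\<bar> *\<^sub>R ?F s (\<kappa> * t)) absolutely_integrable_on {0<..} \<longleftrightarrow>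
          (\<lambda>t. of_real \<kappa> powr s * ?f s t) absolutely_integrable_on {0<..}"
        "integral {0<..} (\<lambda>t. \<bar>\<kappa>\<bar> *\<^sub>R ?F s (\<kappa> * t)) = integral {0<..} (\<lambda>t. of_real \<kappa> powr s * ?f s t)"
      by (intro set_integrable_cong integral_cong refl; simp only:)+
    ultimately have *: "(\<lambda>t. of_real \<kappa> powr s * ?f s t) absolutely_integrable_on {0<..}"
        "integral {0<..} (\<lambda>t. of_real \<kappa> powr s * ?f s t) = Gamma s"
      unfolding c by simp_all
    have k0: "of_real \<kappa> powr s \<noteq> 0" using \<kappa> by simp
    have "?f s absolutely_integrable_on {0<..}"
      using *(1) k0 set_integrable_mult_right_iff by blast
    moreover have "integral {0<..} (?f s) = Gamma s * of_real \<kappa> powr (- s)"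
      using *(2) k0 unfolding integral_mult_right by (simp add: powr_minus divide_simps mult.commute)
    ultimately show ?thesis by blast
  qed
  show "f absolutely_integrable_on {0<..}" "integral {0<..} f = Gamma s * of_real \<kappa> powr (- s)"
    using main[OF s] unfolding f_def by auto
  have r: "Re (of_real (Re s)) > 0" using s by simp
  have Re_powr: "Re (of_real t powr (of_real (Re s) - 1)) = t powr (Re s - 1)" if "t > 0" for t
    using powr_of_real[of t "Re s - 1"] that by simp
  \<comment> \<open>The norm of the integrand is the integrand at the real exponent Re s, so
    \<open>main\<close> applies to it as well.\<close>
  have "integral {0<..} (\<lambda>t. norm (f t)) = integral {0<..} (\<lambda>t. Re (?f (of_real (Re s)) t))"
    by (intro integral_cong)
       (auto simp: f_def norm_mult norm_powr_real_powr Re_powr)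
  also have "\<dots> = Re (integral {0<..} (?f (of_real (Re s))))"
    using integral_linear[OF set_lebesgue_integral_eq_integral(1)[OF conjunct1[OF main[OF r]]] bounded_linear_Re]
    by (simp only: o_def)
  also have "\<dots> = Gamma (Re s) * \<kappa> powr (- Re s)"
    using main[OF r] \<kappa> by (simp add: Gamma_complex_of_real powr_of_real flip: of_real_minus)
  finally show "integral {0<..} (\<lambda>t. norm (f t)) = Gamma (Re s) * \<kappa> powr (- Re s)" .
qed

lemma mellin_fser:
  assumes a: "\<And>m. norm (a m) \<le> C * real (Suc m) powr \<sigma>" and \<sigma>: "\<sigma> > 0" and \<rho>: "\<rho> > 0" and s: "Re s > \<sigma> + 1"
  defines "h \<equiv> \<lambda>t. fser a (\<i> * of_real (\<rho> * t)) * complex_of_real t powr (s - 1)"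
  shows "h absolutely_integrable_on {0<..}"
    and "integral {0<..} h = Gamma s * of_real (2 * pi * \<rho>) powr (- s) * (\<Sum>m. a m * of_nat (Suc m) powr (- s))"
proof -
  define \<kappa> where "\<kappa> m = 2 * pi * \<rho> * real (Suc m)" for m
  define f where "f m t = a m * (of_real (exp (- \<kappa> m * t)) * complex_of_real t powr (s - 1))" for m t
  have \<kappa>: "\<kappa> m > 0" for m
    unfolding \<kappa>_def by (intro mult_pos_pos \<rho> pi_gt_zero) simp_all
  have s0: "Re s > 0" using s \<sigma> by simp
  have e_eq: "e (of_nat (Suc m) * (\<i> * of_real (\<rho> * t))) = of_real (exp (- \<kappa> m * t))" for m t
  proof -
    have "2 * of_real pi * \<i> * (of_nat (Suc m) * (\<i> * of_real (\<rho> * t))) = (\<i> * \<i>) * of_real (\<kappa> m * t)"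
      by (simp only: \<kappa>_def of_real_mult of_real_of_nat_eq of_real_numeral mult_ac)
    then have "e (of_nat (Suc m) * (\<i> * of_real (\<rho> * t))) = exp (of_real (- \<kappa> m * t))"
      unfolding e_def by simp
    then show ?thesis by (simp only: exp_of_real)
  qed
  have h_eq: "(\<Sum>m. f m t) = h t" if "t \<in> {0<..}" for t
  proof -
    have "summable (\<lambda>m. a m * e (of_nat (Suc m) * (\<i> * of_real (\<rho> * t))))"
      by (rule summable_norm_cancel[OF summable_fser[OF a]]) (use that \<rho> in auto)
    from suminf_mult2[OF this, of "of_real t powr (s - 1)"] show ?thesis
      unfolding h_def fser_def f_def e_eq by (simp add: mult_ac)
  qed
  have int: "f m absolutely_integrable_on {0<..}" for m
    unfolding f_def using Gamma_integral_scaled(1)[OF s0 \<kappa>] by simp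
  have sm: "summable (\<lambda>m. norm (f m t))" if "t \<in> {0<..}" for t
    using summable_mult2[OF summable_fser[OF a, of "\<i> * of_real (\<rho> * t)"], of "norm (of_real t powr (s - 1))"] that \<rho>
    unfolding f_def e_eq by (simp add: norm_mult mult_ac)
  have ni: "integral {0<..} (\<lambda>t. norm (f m t)) = norm (a m) * (Gamma (Re s) * \<kappa> m powr (- Re s))" for m
    unfolding f_def norm_mult[of "a m"] using Gamma_integral_scaled(3)[OF s0 \<kappa>] by simp
  have G: "Gamma (Re s) > 0" using s0 by (rule Gamma_real_pos)
  \<comment> \<open>This is the absolute convergence of the Dirichlet series, and the place where Re
    s > \<sigma> + 1 enters.\<close>
  have smi: "summable (\<lambda>m. integral {0<..} (\<lambda>t. norm (f m t)))"
  proof (rule summable_comparison_test'[of _ 0])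
    show "summable (\<lambda>m. C * Gamma (Re s) * (2 * pi * \<rho>) powr (- Re s) * real (Suc m) powr (\<sigma> - Re s))"
      by (intro summable_mult summable_Suc_powr) (use s in auto)
    fix m :: nat
    have "norm (a m) * (Gamma (Re s) * \<kappa> m powr (- Re s)) \<le>
        (C * real (Suc m) powr \<sigma>) * (Gamma (Re s) * \<kappa> m powr (- Re s))"
      using a[of m] G by (intro mult_right_mono) auto
    also have "\<dots> = C * Gamma (Re s) * (2 * pi * \<rho>) powr (- Re s) * real (Suc m) powr (\<sigma> - Re s)"
      unfolding \<kappa>_def using \<rho> by (simp add: powr_mult powr_diff powr_minus divide_inverse)
    finally show "norm (integral {0<..} (\<lambda>t. norm (f m t))) \<le>
        C * Gamma (Re s) * (2 * pi * \<rho>) powr (- Re s) * real (Suc m) powr (\<sigma> - Re s)"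
      unfolding ni using G by simp
  qed
  note * = integral_suminf_absolutely[OF int sm smi]
  show "h absolutely_integrable_on {0<..}"
    by (rule iffD1[OF set_integrable_cong[OF refl refl h_eq] *(1)])
  have fm: "integral {0<..} (f m) = Gamma s * of_real (2 * pi * \<rho>) powr (- s) * (a m * of_nat (Suc m) powr (- s))" for m
  proof -
    have "of_real (\<kappa> m) powr (- s) = of_real (2 * pi * \<rho>) powr (- s) * of_nat (Suc m) powr (- s)"
      unfolding \<kappa>_def using powr_times_real[of "of_real (2 * pi * \<rho>)" "of_nat (Suc m)" "-s"] \<rho>
      by (simp del: of_nat_Suc)
    then show ?thesis unfolding f_def using Gamma_integral_scaled(2)[OF s0 \<kappa>] by simp
  qed
  have "integral {0<..} h = integral {0<..} (\<lambda>t. \<Sum>m. f m t)"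
    by (intro integral_cong) (simp add: h_eq)
  also have "\<dots> = (\<Sum>m. integral {0<..} (f m))" using *(2) by (simp add: sums_iff)
  also have "\<dots> = (\<Sum>m. Gamma s * of_real (2 * pi * \<rho>) powr (- s) * (a m * of_nat (Suc m) powr (- s)))"
    by (simp only: fm)
  also have "\<dots> =
      Gamma s * of_real (2 * pi * \<rho>) powr (- s) * (\<Sum>m. a m * of_nat (Suc m) powr (- s))"
  proof (rule suminf_mult)
    show "summable (\<lambda>m. a m * complex_of_nat (Suc m) powr (- s))"
    proof (rule summable_norm_cancel, rule summable_comparison_test'[of _ 0])
      show "summable (\<lambda>m. C * real (Suc m) powr (\<sigma> - Re s))"
        by (intro summable_mult summable_Suc_powr) (use s in auto)
      fix m :: nat
      have "norm (complex_of_nat (Suc m) powr (- s)) = real (Suc m) powr (- Re s)"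
        by (subst norm_powr_real_powr) (auto simp del: of_nat_Suc)
      then show "norm (norm (a m * complex_of_nat (Suc m) powr (- s))) \<le> C * real (Suc m) powr (\<sigma> - Re s)"
        using mult_right_mono[OF a[of m], of "real (Suc m) powr (- Re s)"]
        by (simp add: norm_mult powr_diff powr_minus divide_inverse mult_ac del: of_nat_Suc)
    qed
  qed
  finally show "integral {0<..} h = Gamma s * of_real (2 * pi * \<rho>) powr (- s) * (\<Sum>m. a m * of_nat (Suc m) powr (- s))" .
qed

section \<open>Tails of Mellin integrals over [1, \<infinity>)\<close>

lemma tail_integrand_bound:
  fixes \<phi> :: "real \<Rightarrow> complex"
  assumes D: "\<And>p::nat. \<exists>D\<ge>0. \<forall>t\<ge>1. norm (\<phi> t) \<le> D / t ^ p"
  obtains D where "D \<ge> 0" "\<And>s t. Re s \<le> c \<Longrightarrow> t \<ge> 1 \<Longrightarrow> norm (\<phi> t * of_real t powr (s - 1)) \<le> D * t powr (-2)"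
proof -
  obtain p :: nat where p: "real p \<ge> c + 1" using real_arch_simple by blast
  obtain D where D: "D \<ge> 0" "\<And>t. t \<ge> 1 \<Longrightarrow> norm (\<phi> t) \<le> D / t ^ p" using assms[of p] by blast
  have "norm (\<phi> t * of_real t powr (s - 1)) \<le> D * t powr (-2)" if "Re s \<le> c" "t \<ge> 1" for s t
  proof -
    have "norm (\<phi> t * of_real t powr (s - 1)) \<le> D / t ^ p * t powr (Re s - 1)"
      unfolding norm_mult using that D(2) by (intro mult_mono) (auto simp: norm_powr_real_powr D)
    also have "\<dots> = D * t powr (Re s - 1 - real p)"
      using that by (simp add: powr_diff powr_realpow)
    also have "\<dots> \<le> D * t powr (-2)"
      using that p D by (intro mult_left_mono powr_mono) auto
    finally show ?thesis .
  qed
  with D that show ?thesis by blast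
qed

context
  fixes \<phi> :: "real \<Rightarrow> complex"
  assumes cont: "continuous_on {1..} \<phi>"
    and D: "\<And>p::nat. \<exists>D\<ge>0. \<forall>t\<ge>1. norm (\<phi> t) \<le> D / t ^ p"
begin

lemma tail_continuous: "a \<ge> 1 \<Longrightarrow> continuous_on {a..} (\<lambda>t. \<phi> t * of_real t powr (s - 1))"
  by (intro continuous_intros continuous_on_subset[OF cont]) (auto simp: complex_nonpos_Reals_iff)

lemma tail_measurable: "a \<ge> 1 \<Longrightarrow> (\<lambda>t. \<phi> t * of_real t powr (s - 1)) \<in> borel_measurable (lebesgue_on {a..})"
  by (rule continuous_imp_measurable_on_sets_lebesgue[OF tail_continuous]) auto

lemma tail_integrable:
  assumes "a \<ge> 1"
  shows "(\<lambda>t. \<phi> t * of_real t powr (s - 1)) absolutely_integrable_on {a..}"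
proof -
  obtain E where E: "E \<ge> 0" "\<And>s' t. Re s' \<le> Re s \<Longrightarrow> t \<ge> 1 \<Longrightarrow> norm (\<phi> t * of_real t powr (s' - 1)) \<le> E * t powr (-2)"
    using tail_integrand_bound[OF D] by blast
  show ?thesis
  proof (rule measurable_bounded_by_integrable_imp_absolutely_integrable[OF tail_measurable[OF assms]])
    show "(\<lambda>t. E * t powr (-2)) integrable_on {a..}"
      using has_integral_powr_to_inf[of "-2" a] assms by (intro integrable_on_mult_right) (auto simp: integrable_on_def)
  qed (use E assms in auto)
qed

lemma tail_norm_le:
  assumes E: "\<And>t. t \<ge> 1 \<Longrightarrow> norm (\<phi> t * of_real t powr (s - 1)) \<le> E * t powr (-2)" and a: "a \<ge> 1"
  shows "norm (integral {a..} (\<lambda>t. \<phi> t * of_real t powr (s - 1))) \<le> E / a"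
proof (rule integral_norm_bound_integral'[OF _ tail_measurable[OF a]])
  show "((\<lambda>t. E * t powr (-2)) has_integral E / a) {a..}"
    using has_integral_mult_right[OF has_integral_powr_to_inf[of "-2" a], of E] a
    by (simp add: powr_minus divide_inverse)
qed (use E a in auto)

text \<open>The tail is bounded on every left half-plane, however large c is, whereas the head over
  (0, 1] is bounded on a right half-plane. The inversion of the functional equation plays these two
  facts against each other.\<close>

lemma tail_bounded: "\<exists>B. \<forall>s. Re s \<le> c \<longrightarrow> norm (integral {1..} (\<lambda>t. \<phi> t * of_real t powr (s - 1))) \<le> B"
proof -
  obtain E where E: "E \<ge> 0" "\<And>s t. Re s \<le> c \<Longrightarrow> t \<ge> 1 \<Longrightarrow> norm (\<phi> t * of_real t powr (s - 1)) \<le> E * t powr (-2)"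
    using tail_integrand_bound[OF D] by blast
  show ?thesis using tail_norm_le[OF E(2), of _ 1] by auto
qed

text \<open>Over compact intervals the integral is holomorphic by differentiation under the integral
  sign; the remainders are at most E / (n + 1), uniformly near each point.\<close>

lemma tail_holomorphic: "(\<lambda>s. integral {1..} (\<lambda>t. \<phi> t * of_real t powr (s - 1))) holomorphic_on UNIV"
proof (rule holomorphic_uniform_sequence[of _ "\<lambda>n s. integral (cbox 1 (1 + real n)) (\<lambda>t. \<phi> t * of_real t powr (s - 1))"])
  fix n
  show "(\<lambda>s. integral (cbox 1 (1 + real n)) (\<lambda>t. \<phi> t * of_real t powr (s - 1))) holomorphic_on UNIV"
  proof (rule leibniz_rule_holomorphic)
    fix s :: complex and t :: real assume t: "t \<in> cbox 1 (1 + real n)"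
    have "((\<lambda>s. of_real t powr (s - 1)) has_field_derivative Ln (of_real t) * of_real t powr (s - 1) * 1) (at s)"
      by (rule DERIV_chain2[OF has_field_derivative_powr_right])
         (use t in \<open>auto intro!: derivative_eq_intros\<close>)
    from DERIV_cmult[OF this, of "\<phi> t"]
    show "((\<lambda>s. \<phi> t * of_real t powr (s - 1)) has_field_derivative
        \<phi> t * (Ln (of_real t) * of_real t powr (s - 1))) (at s within UNIV)"
      by simp
  next
    fix s
    show "(\<lambda>t. \<phi> t * of_real t powr (s - 1)) integrable_on cbox 1 (1 + real n)"
      by (intro integrable_continuous continuous_on_subset[OF tail_continuous[of 1]]) auto
  next
    have "continuous_on (UNIV \<times> cbox 1 (1 + real n))
        (\<lambda>p. \<phi> (snd p) * (Ln (of_real (snd p)) * of_real (snd p) powr (fst p - 1)))"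
      by (intro continuous_intros continuous_on_compose2[OF cont]) (auto simp: complex_nonpos_Reals_iff)
    then show "continuous_on (UNIV \<times> cbox 1 (1 + real n))
        (\<lambda>(s, t). \<phi> t * (Ln (of_real t) * of_real t powr (s - 1)))"
      by (simp add: case_prod_unfold)
  qed auto
next
  fix x :: complex
  obtain E where E: "E \<ge> 0" "\<And>s t. Re s \<le> Re x + 1 \<Longrightarrow> t \<ge> 1 \<Longrightarrow> norm (\<phi> t * of_real t powr (s - 1)) \<le> E * t powr (-2)"
    using tail_integrand_bound[OF D] by blast
  let ?I = "\<lambda>S s. integral S (\<lambda>t. \<phi> t * of_real t powr (s - 1))"
  have split: "?I {1..} s - ?I (cbox 1 (1 + real n)) s = ?I {1 + real n..} s" for n s
  proof -
    have 1: "(\<lambda>t. \<phi> t * of_real t powr (s - 1)) integrable_on cbox 1 (1 + real n)"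
      by (intro integrable_continuous continuous_on_subset[OF tail_continuous[of 1]]) auto
    have 2: "(\<lambda>t. \<phi> t * of_real t powr (s - 1)) integrable_on {1 + real n..}"
      by (rule set_lebesgue_integral_eq_integral(1)[OF tail_integrable]) simp
    have "cbox 1 (1 + real n) \<inter> {1 + real n..} = {1 + real n}" by auto
    then have 3: "negligible (cbox 1 (1 + real n) \<inter> {1 + real n..})" by simp
    have 4: "cbox 1 (1 + real n) \<union> {1 + real n..} = {1..}" by auto
    from has_integral_Un[OF integrable_integral[OF 1] integrable_integral[OF 2] 3]
    show ?thesis unfolding 4 by (simp add: integral_unique)
  qed
  have "uniform_limit (cball x 1) (\<lambda>n. ?I (cbox 1 (1 + real n))) (?I {1..}) sequentially"
  proof (rule uniform_limitI)
    fix \<epsilon> :: real assume "\<epsilon> > 0"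
    have "((\<lambda>n. E / (1 + real n)) \<longlongrightarrow> 0) sequentially" by real_asymp
    then have "eventually (\<lambda>n. E / (1 + real n) < \<epsilon>) sequentially"
      using \<open>\<epsilon> > 0\<close> by (rule order_tendstoD)
    then show "\<forall>\<^sub>F n in sequentially. \<forall>s\<in>cball x 1. dist (?I (cbox 1 (1 + real n)) s) (?I {1..} s) < \<epsilon>"
    proof eventually_elim
      case (elim n)
      show ?case
      proof
        fix s assume "s \<in> cball x 1"
        then have "Re s \<le> Re x + 1" using abs_Re_le_cmod[of "x - s"] by (auto simp: dist_norm abs_le_iff)
        then have "norm (?I {1 + real n..} s) \<le> E / (1 + real n)"
          by (intro tail_norm_le E(2)) auto
        with elim show "dist (?I (cbox 1 (1 + real n)) s) (?I {1..} s) < \<epsilon>"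
          unfolding dist_norm norm_minus_commute[of "?I (cbox 1 (1 + real n)) s"] split by linarith
      qed
    qed
  qed
  then show "\<exists>d>0. cball x d \<subseteq> UNIV \<and>
      uniform_limit (cball x d) (\<lambda>n. ?I (cbox 1 (1 + real n))) (?I {1..}) sequentially"
    by (intro exI[of _ 1]) auto
qed auto

end

lemma integral_inverse_substitution:
  fixes f :: "real \<Rightarrow> complex"
  assumes "f absolutely_integrable_on {1..}"
  shows "(\<lambda>t. of_real (1 / t\<^sup>2) * f (1 / t)) absolutely_integrable_on {0<..1}"
    and "integral {0<..1} (\<lambda>t. of_real (1 / t\<^sup>2) * f (1 / t)) = integral {1..} f"
proof -
  have im: "(\<lambda>t::real. 1 / t) ` {0<..1} = {1..}"
  proof (intro equalityI subsetI)
    fix x :: real assume "x \<in> {1..}"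
    then have "x = 1 / (1 / x)" "1 / x \<in> {0<..1}" by auto
    then show "x \<in> (\<lambda>t. 1 / t) ` {0<..1}" by (rule image_eqI)
  qed auto
  have inj: "inj_on (\<lambda>t::real. 1 / t) {0<..1}" by (auto simp: inj_on_def)
  have "(\<lambda>t. \<bar>- 1 / t\<^sup>2\<bar> *\<^sub>R f (1 / t)) absolutely_integrable_on {0<..1} \<and>
      integral {0<..1} (\<lambda>t. \<bar>- 1 / t\<^sup>2\<bar> *\<^sub>R f (1 / t)) = integral {1..} f"
    by (rule iffD2[OF has_absolute_integral_change_of_variables_real])
       (use assms im inj in \<open>auto intro!: derivative_eq_intros simp: power2_eq_square\<close>)
  then show "(\<lambda>t. of_real (1 / t\<^sup>2) * f (1 / t)) absolutely_integrable_on {0<..1}"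
    and "integral {0<..1} (\<lambda>t. of_real (1 / t\<^sup>2) * f (1 / t)) = integral {1..} f"
    by (simp_all add: scaleR_conv_of_real)
qed

section \<open>The inversion of the functional equation\<close>

lemma mellin_head_bound:
  fixes \<phi> :: "real \<Rightarrow> complex"
  assumes int: "(\<lambda>t. \<phi> t * of_real t powr (s - 1)) absolutely_integrable_on {0<..1}"
    and D: "\<And>t. t > 0 \<Longrightarrow> norm (\<phi> t) \<le> D / t ^ p" and s: "Re s \<ge> real p + 1" and D0: "D \<ge> 0"
  shows "norm (integral {0<..1} (\<lambda>t. \<phi> t * of_real t powr (s - 1))) \<le> D"
proof (rule integral_norm_bound_integral')
  show "(\<lambda>t. \<phi> t * of_real t powr (s - 1)) \<in> borel_measurable (lebesgue_on {0<..1})"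
    using int by (rule absolutely_integrable_imp_borel_measurable) auto
  have "((\<lambda>t::real. D) has_integral D) {0..1}" using has_integral_const_real[of D 0 1] by simp
  then show "((\<lambda>t::real. D) has_integral D) {0<..1}"
  proof (rule iffD1[OF has_integral_spike_set_eq, rotated 2])
    show "negligible {x \<in> {0..1} - {0<..1::real}. D \<noteq> 0}" "negligible {x \<in> {0<..1::real} - {0..1}. D \<noteq> 0}"
      by (rule negligible_subset[of "{0}"]; force)+
  qed
  fix t :: real assume t: "t \<in> {0<..1}"
  have "norm (\<phi> t * of_real t powr (s - 1)) \<le> D / t ^ p * t powr (Re s - 1)"
    unfolding norm_mult using t D D0 by (intro mult_mono) (auto simp: norm_powr_real_powr)
  also have "\<dots> = D * t powr (Re s - 1 - real p)"
    using t by (simp add: powr_diff powr_realpow)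
  also have "\<dots> \<le> D * 1"
    using t s D0 by (intro mult_left_mono powr_le1) auto
  finally show "norm (\<phi> t * of_real t powr (s - 1)) \<le> D" by simp
qed auto

text \<open>Finite order in a form stable under the shift of s by (k - 1) / 2, which B absorbs. The
  sign of B makes the exponential at least 1, so that bounded terms can be absorbed into C.\<close>

definition strip_growth :: "(complex \<Rightarrow> complex) \<Rightarrow> bool" where
  "strip_growth P \<longleftrightarrow> (\<forall>c. \<exists>C B m. B \<ge> 0 \<and> (\<forall>z. \<bar>Re z\<bar> \<le> c \<longrightarrow> norm (P z) \<le> C * exp ((norm z + B) ^ m)))"

lemma strip_growth_le:
  assumes "strip_growth P" "c \<ge> 0" "\<And>z. \<bar>Re z\<bar> \<le> c \<Longrightarrow> norm (R z) \<le> norm (P z) + K"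
  shows "\<exists>C B m. \<forall>z. \<bar>Re z\<bar> \<le> c \<longrightarrow> norm (R z) \<le> C * exp ((norm z + B) ^ m)"
proof -
  obtain C B m where *: "B \<ge> 0" "\<And>z. \<bar>Re z\<bar> \<le> c \<Longrightarrow> norm (P z) \<le> C * exp ((norm z + B) ^ m)"
    using assms(1) unfolding strip_growth_def by blast
  have "norm (R z) \<le> (C + \<bar>K\<bar>) * exp ((norm z + B) ^ m)" if "\<bar>Re z\<bar> \<le> c" for z
  proof -
    have "\<bar>K\<bar> * 1 \<le> \<bar>K\<bar> * exp ((norm z + B) ^ m)" using * by (intro mult_left_mono) auto
    with *(2)[OF that] assms(3)[OF that] show ?thesis by (simp add: ring_distribs)
  qed
  then show ?thesis by blast
qed

lemma continuous_on_vanishing_at_0: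
  fixes u :: "real \<Rightarrow> complex"
  assumes "continuous_on {0<..} u" "u 0 = 0" "\<And>t. t \<in> {0<..1} \<Longrightarrow> norm (u t) \<le> E * t"
  shows "continuous_on {0..1} u"
  unfolding continuous_on_eq_continuous_within
proof
  fix x :: real assume x: "x \<in> {0..1}"
  show "continuous (at x within {0..1}) u"
  proof (cases "x = 0")
    case True
    have "(u \<longlongrightarrow> 0) (at 0 within {0..1})"
    proof (rule Lim_null_comparison)
      show "\<forall>\<^sub>F t in at 0 within {0..1}. norm (u t) \<le> E * t"
        using assms(3) by (auto simp: eventually_at_filter)
      have "((\<lambda>t. E * t) \<longlongrightarrow> E * 0) (at 0 within {0..1})" by (intro tendsto_intros)
      then show "((\<lambda>t. E * t) \<longlongrightarrow> 0) (at 0 within {0..1})" by simp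
    qed
    then show ?thesis using True assms(2) by (simp add: continuous_within)
  next
    case False
    with x have "isCont u x" using assms(1) continuous_on_eq_continuous_at[of "{0<..}" u] by auto
    then show ?thesis by (rule continuous_at_imp_continuous_at_within)
  qed
qed

text \<open>No decay of the Gamma factor and no contour shift is needed: after removing the tails of the two
  Mellin integrals, the functional equation leaves a bounded entire function, and the constancy of that
  function says that all moments of the defect, weighted by $1 - t$, vanish.\<close>

theorem hecke_inversion:
  fixes a b :: "nat \<Rightarrow> complex" and k :: nat and P Q :: "complex \<Rightarrow> complex"
  assumes a: "\<And>m. norm (a m) \<le> Ca * real (Suc m) powr \<sigma>" and b: "\<And>m. norm (b m) \<le> Cb * real (Suc m) powr \<sigma>"
    and \<sigma>: "\<sigma> > 0" and \<rho>: "\<rho> > 0"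
    and P: "P holomorphic_on UNIV" "strip_growth P" and Q: "Q holomorphic_on UNIV"
    and Pint: "\<And>s. Re s > s0 \<Longrightarrow> P s = integral {0<..} (\<lambda>t. fser a (\<i> * of_real (\<rho> * t)) * of_real t powr (s - 1))"
    and Qint: "\<And>s. Re s > s0 \<Longrightarrow> Q s = integral {0<..} (\<lambda>t. fser b (\<i> * of_real (\<rho> * t)) * of_real t powr (s - 1))"
    and FE: "\<And>s. P s = w * Q (of_nat k - s)"
    and t: "0 < t" "t < 1"
  shows "fser a (\<i> * of_real (\<rho> * t)) = w * of_real t powr (- of_nat k) * fser b (\<i> * of_real (\<rho> / t))"
proof -
  define \<phi> where "\<phi> t = fser a (\<i> * of_real (\<rho> * t))" for t
  define \<psi> where "\<psi> t = fser b (\<i> * of_real (\<rho> * t))" for t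
  obtain p :: nat where p: "real p \<ge> \<sigma> + 2" using real_arch_simple by blast
  have decay: "\<exists>D\<ge>0. \<forall>t>0. norm (fser x (\<i> * of_real (\<rho> * t))) \<le> D / t ^ q"
    if x: "\<And>m. norm (x m) \<le> C * real (Suc m) powr \<sigma>" and q: "real q \<ge> \<sigma> + 2" for x C q
  proof -
    obtain D where D: "D \<ge> 0" "\<And>z. Im z > 0 \<Longrightarrow> norm (fser x z) \<le> D / Im z ^ q"
      using fser_bound[OF x q] by blast
    show ?thesis
      using D \<rho> D(2)[of "\<i> * of_real (\<rho> * t)" for t]
      by (intro exI[of _ "D / \<rho> ^ q"]) (auto simp: power_mult_distrib)
  qed
  have tail: "\<exists>D\<ge>0. \<forall>t\<ge>1. norm (fser x (\<i> * of_real (\<rho> * t))) \<le> D / t ^ q"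
    if x: "\<And>m. norm (x m) \<le> C * real (Suc m) powr \<sigma>" for x C q
  proof -
    have "real (max p q) \<ge> \<sigma> + 2" using p by simp
    from decay[OF x this] obtain D where D: "D \<ge> 0" "\<And>t. t > 0 \<Longrightarrow> norm (fser x (\<i> * of_real (\<rho> * t))) \<le> D / t ^ max p q"
      by blast
    have "norm (fser x (\<i> * of_real (\<rho> * t))) \<le> D / t ^ q" if "t \<ge> 1" for t
    proof -
      have "D / t ^ max p q \<le> D / t ^ q"
        using that D(1) by (intro divide_left_mono power_increasing) auto
      then show ?thesis using D(2)[of t] that by linarith
    qed
    then show ?thesis using D(1) by blast
  qed
  have cont: "continuous_on {0<..} (\<lambda>t. fser x (\<i> * of_real (\<rho> * t)))"
    if x: "\<And>m. norm (x m) \<le> C * real (Suc m) powr \<sigma>" for x C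
    by (rule continuous_on_compose2[OF holomorphic_on_imp_continuous_on[OF holomorphic_fser[OF x]]])
       (use \<rho> in \<open>auto intro!: continuous_intros\<close>)
  have cont1: "continuous_on {1..} \<phi>" "continuous_on {1..} \<psi>"
    unfolding \<phi>_def \<psi>_def
    by (rule continuous_on_subset[OF cont[OF a]], force) (rule continuous_on_subset[OF cont[OF b]], force)
  have tl: "\<exists>D\<ge>0. \<forall>t\<ge>1. norm (\<phi> t) \<le> D / t ^ q" "\<exists>D\<ge>0. \<forall>t\<ge>1. norm (\<psi> t) \<le> D / t ^ q" for q
    unfolding \<phi>_def \<psi>_def by (rule tail[OF a], rule tail[OF b])
  obtain D1 where D1: "D1 \<ge> 0" "\<And>t. t > 0 \<Longrightarrow> norm (\<phi> t) \<le> D1 / t ^ p"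
    using decay[OF a p] unfolding \<phi>_def by blast
  obtain D2 where D2: "D2 \<ge> 0" "\<And>t. t > 0 \<Longrightarrow> norm (\<psi> t) \<le> D2 / t ^ p"
    using decay[OF b p] unfolding \<psi>_def by blast
  define A where "A s = integral {1..} (\<lambda>t. \<phi> t * of_real t powr (s - 1))" for s
  define B where "B s = integral {1..} (\<lambda>t. \<psi> t * of_real t powr (s - 1))" for s
  have hA: "A holomorphic_on UNIV" "B holomorphic_on UNIV"
    unfolding A_def B_def using tail_holomorphic[OF cont1(1) tl(1)] tail_holomorphic[OF cont1(2) tl(2)] .
  \<comment> \<open>The margin collects all demands: beyond \<open>s0\<close> and \<sigma> + 1 the
    Mellin integrals are available, from p + 1 on the heads are bounded, and p + k + 2 makes t^(c -
    1) compensate a singularity of order p + k at 0 with a power of t to spare.\<close>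
  define c where "c = max (max (s0 + 1) (\<sigma> + 2)) 0 + real p + real k + 2"
  have c: "c > s0" "c > \<sigma> + 1" "c \<ge> real p + real k + 2" unfolding c_def by auto
  have head: "(\<lambda>t. \<phi> t * of_real t powr (s - 1)) absolutely_integrable_on {0<..1}"
     "P s - A s = integral {0<..1} (\<lambda>t. \<phi> t * of_real t powr (s - 1))"
     "(\<lambda>t. \<psi> t * of_real t powr (s - 1)) absolutely_integrable_on {0<..1}"
     "Q s - B s = integral {0<..1} (\<lambda>t. \<psi> t * of_real t powr (s - 1))" if s: "Re s \<ge> c" for s
  proof -
    have 1: "(\<lambda>t. \<phi> t * of_real t powr (s - 1)) absolutely_integrable_on {0<..}"
      unfolding \<phi>_def using mellin_fser(1)[OF a \<sigma> \<rho>] s c by auto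
    have 2: "(\<lambda>t. \<psi> t * of_real t powr (s - 1)) absolutely_integrable_on {0<..}"
      unfolding \<psi>_def using mellin_fser(1)[OF b \<sigma> \<rho>] s c by auto
    have split: "f absolutely_integrable_on {0<..1}"
        "integral {0<..} f - integral {1..} f = integral {0<..1} f"
      if f: "f absolutely_integrable_on {0<..}" for f :: "real \<Rightarrow> complex"
    proof -
      show i: "f absolutely_integrable_on {0<..1}" using f by (rule set_integrable_subset) auto
      have j: "f absolutely_integrable_on {1..}" using f by (rule set_integrable_subset) auto
      have "{0<..1} \<inter> {1..} = {1::real}" by auto
      then have n: "negligible ({0<..1} \<inter> {1::real..})" by simp
      have u: "{0<..1} \<union> {1..} = {0::real<..}" by auto
      from has_integral_Un[OF integrable_integral[OF set_lebesgue_integral_eq_integral(1)[OF i]]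
          integrable_integral[OF set_lebesgue_integral_eq_integral(1)[OF j]] n]
      show "integral {0<..} f - integral {1..} f = integral {0<..1} f"
        unfolding u by (simp add: integral_unique)
    qed
    show "(\<lambda>t. \<phi> t * of_real t powr (s - 1)) absolutely_integrable_on {0<..1}"
      "(\<lambda>t. \<psi> t * of_real t powr (s - 1)) absolutely_integrable_on {0<..1}"
      using split(1)[OF 1] split(1)[OF 2] .
    show "P s - A s = integral {0<..1} (\<lambda>t. \<phi> t * of_real t powr (s - 1))"
      using split(2)[OF 1] Pint[of s] s c unfolding A_def \<phi>_def by simp
    show "Q s - B s = integral {0<..1} (\<lambda>t. \<psi> t * of_real t powr (s - 1))"
      using split(2)[OF 2] Qint[of s] s c unfolding B_def \<psi>_def by simp
  qed
  have PA: "norm (P s - A s) \<le> D1" if "Re s \<ge> c" for s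
    unfolding head(2)[OF that] by (rule mellin_head_bound[OF head(1)[OF that] D1(2)]) (use that c D1(1) in auto)
  have QB: "norm (Q s - B s) \<le> D2" if "Re s \<ge> c" for s
    unfolding head(4)[OF that] by (rule mellin_head_bound[OF head(3)[OF that] D2(2)]) (use that c D2(1) in auto)
  obtain KA where KA: "\<And>s. Re s \<le> c + real k \<Longrightarrow> norm (A s) \<le> KA"
    unfolding A_def using tail_bounded[OF cont1(1) tl(1)] by blast
  obtain KB where KB: "\<And>s. Re s \<le> c + real k \<Longrightarrow> norm (B s) \<le> KB"
    unfolding B_def using tail_bounded[OF cont1(2) tl(2)] by blast
  \<comment> \<open>After substituting 1 / t in the tail of the transform of \<psi>, this is, for
    large Re s, the integral over (0, 1] of the defect of the inversion formula against t^(s - 1).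
    Written with tails it is visibly entire.\<close>
  define R where "R s = P s - A s - w * B (of_nat k - s)" for s
  have hR: "R holomorphic_on UNIV"
  proof -
    have "B \<circ> (\<lambda>s. of_nat k - s) holomorphic_on UNIV"
      by (rule holomorphic_on_compose_gen[OF _ hA(2)]) (auto intro!: holomorphic_intros)
    then show ?thesis unfolding R_def o_def by (intro holomorphic_intros P(1) hA)
  qed
  \<comment> \<open>The functional equation reflects Re s \<ge> c to Re s \<le> k - c. The strip of
    half-width c + k has its edges inside these two half-planes and contains everything between
    them.\<close>
  define c' where "c' = c + real k"
  have c'0: "c' > 0" unfolding c'_def c_def by auto
  define K where "K = \<bar>max (D1 + norm w * KB) (norm w * D2 + KA)\<bar> + 1"
  have right: "norm (R s) \<le> K" if "Re s \<ge> c" for s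
  proof -
    have "norm (R s) \<le> norm (P s - A s) + norm w * norm (B (of_nat k - s))"
      unfolding R_def by (metis norm_triangle_ineq4 norm_mult)
    also have "\<dots> \<le> D1 + norm w * KB"
      using PA[OF that] KB[of "of_nat k - s"] that c by (intro add_mono mult_left_mono) auto
    finally show ?thesis unfolding K_def by linarith
  qed
  have left: "norm (R s) \<le> K" if "Re s \<le> - c'  + 2 * real k" for s
  proof -
    \<comment> \<open>The functional equation gives R the same shape with P and Q exchanged, up to
      the factor w.\<close>
    have "R s = w * (Q (of_nat k - s) - B (of_nat k - s)) - A s"
      unfolding R_def FE[of s] by (simp add: algebra_simps)
    then have "norm (R s) \<le> norm w * norm (Q (of_nat k - s) - B (of_nat k - s)) + norm (A s)"
      by (metis norm_triangle_ineq4 norm_mult)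
    also have "\<dots> \<le> norm w * D2 + KA"
      using QB[of "of_nat k - s"] KA[of s] that c unfolding c'_def by (intro add_mono mult_left_mono) auto
    finally show ?thesis unfolding K_def by linarith
  qed
  have K0: "K > 0" unfolding K_def by linarith
  obtain C Bq m where growth: "\<And>z. \<bar>Re z\<bar> \<le> c' \<Longrightarrow> norm (R z) \<le> C * exp ((norm z + Bq) ^ m)"
  proof -
    have "norm (R z) \<le> norm (P z) + (KA + norm w * KB')"
      if "\<bar>Re z\<bar> \<le> c'" "\<And>s. Re s \<le> c' + real k \<Longrightarrow> norm (B s) \<le> KB'" for z KB'
    proof -
      have "norm (R z) \<le> norm (P z) + norm (A z) + norm w * norm (B (of_nat k - z))"
        unfolding R_def norm_mult[symmetric] by (rule order.trans[OF norm_triangle_ineq4 add_right_mono[OF norm_triangle_ineq4]])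
      also have "\<dots> \<le> norm (P z) + KA + norm w * KB'"
        using KA[of z] that(2)[of "of_nat k - z"] that(1) unfolding c'_def by (intro add_mono mult_left_mono) auto
      finally show ?thesis by simp
    qed
    moreover obtain KB' where "\<And>s. Re s \<le> c' + real k \<Longrightarrow> norm (B s) \<le> KB'"
      unfolding B_def using tail_bounded[OF cont1(2) tl(2)] by blast
    ultimately have "\<And>z. \<bar>Re z\<bar> \<le> c' \<Longrightarrow> norm (R z) \<le> norm (P z) + (KA + norm w * KB')" by blast
    from strip_growth_le[OF P(2) _ this] c'0 that show ?thesis by fastforce
  qed
  have bdd: "norm (R z) \<le> K" for z
  proof (cases "\<bar>Re z\<bar> \<le> c'")
    case True
    show ?thesis
    proof (rule phragmen_lindelof_strip[OF hR c'0 K0 growth _ True])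
      fix z assume "\<bar>Re z\<bar> = c'"
      then show "norm (R z) \<le> K" using left[of z] right[of z] unfolding c'_def by (cases "Re z \<ge> 0") auto
    qed auto
  next
    case False
    then show ?thesis using left[of z] right[of z] unfolding c'_def by (cases "Re z \<ge> 0") auto
  qed
  have "R constant_on UNIV"
    by (rule Liouville_theorem[OF hR]) (auto simp: bounded_iff intro!: exI[of _ K] bdd)
  then obtain \<kappa> where \<kappa>: "\<And>s. R s = \<kappa>" by (auto simp: constant_on_def)
  define \<delta> where "\<delta> t = \<phi> t - w * of_real t powr (- of_nat k) * \<psi> (1 / t)" for t
  have R_int: "(\<lambda>t. \<delta> t * of_real t powr (s - 1)) absolutely_integrable_on {0<..1} \<and>
      integral {0<..1} (\<lambda>t. \<delta> t * of_real t powr (s - 1)) = \<kappa>" if s: "Re s \<ge> c" for s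
  proof -
    define f where "f u = \<psi> u * of_real u powr (of_nat k - s - 1)" for u
    have f: "f absolutely_integrable_on {1..}"
      unfolding f_def using tail_integrable[OF cont1(2) tl(2), of 1] by auto
    have eq: "of_real (1 / t\<^sup>2) * f (1 / t) = of_real t powr (- of_nat k) * \<psi> (1 / t) * of_real t powr (s - 1)"
      if t: "t \<in> {0<..1}" for t
    proof -
      have "complex_of_real (1 / t) powr (of_nat k - s - 1) = of_real t powr (s + 1 - of_nat k)"
      proof -
        have L: "Ln (complex_of_real (1 / t)) = of_real (- ln t)"
          by (subst Ln_of_real) (use t in \<open>auto simp: ln_div\<close>)
        have "complex_of_real (1 / t) powr (of_nat k - s - 1) = exp ((of_nat k - s - 1) * of_real (- ln t))"
          unfolding powr_def L using t by simp
        also have "(of_nat k - s - 1) * of_real (- ln t) = (s + 1 - of_nat k) * of_real (ln t)"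
          by (simp add: algebra_simps)
        also have "exp \<dots> = of_real t powr (s + 1 - of_nat k)"
          using t by (simp add: powr_def Ln_of_real)
        finally show ?thesis .
      qed
      moreover have "of_real (1 / t\<^sup>2) = complex_of_real t powr (- 2)"
        using t by (simp add: powr_minus divide_inverse powr_numeral)
      moreover have "complex_of_real t powr (- 2) * of_real t powr (s + 1 - of_nat k) =
          of_real t powr (- of_nat k) * of_real t powr (s - 1)"
        unfolding powr_add[symmetric] by (simp add: algebra_simps)
      ultimately show ?thesis unfolding f_def by (simp add: algebra_simps)
    qed
    have I: "(\<lambda>t. of_real t powr (- of_nat k) * \<psi> (1 / t) * of_real t powr (s - 1)) absolutely_integrable_on {0<..1}"
      by (rule iffD1[OF set_integrable_cong[OF refl refl eq] integral_inverse_substitution(1)[OF f]])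
    have J: "integral {0<..1} (\<lambda>t. of_real t powr (- of_nat k) * \<psi> (1 / t) * of_real t powr (s - 1)) = B (of_nat k - s)"
      using trans[OF integral_cong[OF eq, symmetric] integral_inverse_substitution(2)[OF f]] unfolding B_def f_def by simp
    have d: "\<delta> t * of_real t powr (s - 1) = \<phi> t * of_real t powr (s - 1) -
        w * (of_real t powr (- of_nat k) * \<psi> (1 / t) * of_real t powr (s - 1))" for t
      unfolding \<delta>_def by (simp only: left_diff_distrib mult.assoc)
    have wI: "(\<lambda>t. w * (of_real t powr (- of_nat k) * \<psi> (1 / t) * of_real t powr (s - 1))) absolutely_integrable_on {0<..1}"
      using I by (rule set_integrable_mult_right)
    have "integral {0<..1} (\<lambda>t. \<delta> t * of_real t powr (s - 1)) = (P s - A s) - w * B (of_nat k - s)"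
      unfolding d head(2)[OF s] J[symmetric] integral_mult_right[symmetric]
      by (rule integral_diff) (rule set_lebesgue_integral_eq_integral(1), rule head(1)[OF s] wI)+
    also have "\<dots> = \<kappa>" using \<kappa>[of s] unfolding R_def by simp
    moreover have "(\<lambda>t. \<delta> t * of_real t powr (s - 1)) absolutely_integrable_on {0<..1}"
      unfolding d using set_integral_diff(1)[OF head(1)[OF s] wI] .
    ultimately show ?thesis by simp
  qed
  \<comment> \<open>The n-th moment of u is R(c + n) - R(c + n + 1), which vanishes because R is
    constant; the power of t makes u continuous at 0.\<close>
  define u where "u t = \<delta> t * of_real (t powr (c - 1)) * of_real (1 - t)" for t
  have c1: "continuous_on {0<..} \<delta>"
    unfolding \<delta>_def \<phi>_def \<psi>_def
    by (intro continuous_intros cont[OF a] continuous_on_compose2[OF cont[OF b]]) (auto simp: complex_nonpos_Reals_iff)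
  \<comment> \<open>Since \<open>0 powr (c - 1)\<close> is 0, the conventional value of \<delta> at
    0, where 1 / 0 = 0 enters, has no influence.\<close>
  have u0: "u 0 = 0" unfolding u_def by simp
  have cu: "continuous_on {0<..} u"
    unfolding u_def by (intro continuous_intros c1) auto
  have ub: "norm (u t) \<le> (D1 + norm w * D2) * t" if t: "t \<in> {0<..1}" for t
  proof -
    have tp: "t powr (c - 1) \<le> t ^ (p + k + 1)"
    proof -
      have "t powr (c - 1) \<le> t powr real (p + k + 1)" by (intro powr_mono') (use t c in auto)
      then show ?thesis using t by (simp only: powr_realpow greaterThanAtMost_iff)
    qed
    have "norm (\<delta> t) \<le> norm (\<phi> t) + norm w * (1 / t ^ k) * norm (\<psi> (1 / t))"
    proof -
      have "norm (complex_of_real t powr (- of_nat k)) = 1 / t ^ k"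
        using t by (simp add: powr_minus powr_nat norm_inverse norm_power divide_inverse)
      then show ?thesis
        unfolding \<delta>_def using norm_triangle_ineq4[of "\<phi> t" "w * of_real t powr (- of_nat k) * \<psi> (1 / t)"]
        by (simp only: norm_mult)
    qed
    also have "\<dots> \<le> D1 / t ^ p + norm w * (1 / t ^ k) * (D2 * t ^ p)"
      using D1(2)[of t] D2(2)[of "1 / t"] t by (intro add_mono mult_left_mono) (auto simp: power_divide)
    also have "\<dots> \<le> D1 / t ^ (p + k) + norm w * (1 / t ^ (p + k)) * (D2 * 1)"
      using t D1(1) D2(1)
      by (intro add_mono divide_left_mono mult_mono power_decreasing power_le_one) auto
    also have "\<dots> = (D1 + norm w * D2) / t ^ (p + k)" by (simp add: add_divide_distrib)
    finally have 1: "norm (\<delta> t) \<le> (D1 + norm w * D2) / t ^ (p + k)" .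
    have "norm (u t) = norm (\<delta> t) * t powr (c - 1) * (1 - t)"
      unfolding u_def norm_mult norm_of_real using t by simp
    also have "\<dots> \<le> (D1 + norm w * D2) / t ^ (p + k) * t ^ (p + k + 1) * 1"
      using 1 tp t D1(1) D2(1) by (intro mult_mono) auto
    also have "\<dots> = (D1 + norm w * D2) * t" using t by simp
    finally show ?thesis .
  qed
  have cont_u: "continuous_on {0..1} u"
    by (rule continuous_on_vanishing_at_0[OF cu u0 ub])
  have mom: "integral {0..1} (\<lambda>t. u t * of_real t ^ n) = 0" for n
  proof -
    have "integral {0..1} (\<lambda>t. u t * of_real t ^ n) = integral {0<..1} (\<lambda>t. u t * of_real t ^ n)"
      by (rule integral_spike_set; rule negligible_subset[of "{0}"]) auto
    also have "\<dots> = integral {0<..1} (\<lambda>t. \<delta> t * of_real t powr (of_real (c + real n) - 1) -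
        \<delta> t * of_real t powr (of_real (c + real n + 1) - 1))"
    proof (rule integral_cong)
      fix t :: real assume t: "t \<in> {0<..1}"
      have "complex_of_real t powr (of_real (c + real n) - 1) = of_real (t powr (c - 1) * t ^ n)"
        using t powr_of_real[of t "c + real n - 1"] by (simp add: powr_add powr_diff powr_realpow)
      moreover have "complex_of_real t powr (of_real (c + real n + 1) - 1) = of_real (t powr (c - 1) * t ^ n * t)"
        using t powr_of_real[of t "c + real n"] by (simp add: powr_add powr_diff powr_realpow)
      ultimately show "u t * of_real t ^ n = \<delta> t * of_real t powr (of_real (c + real n) - 1) -
        \<delta> t * of_real t powr (of_real (c + real n + 1) - 1)"
        unfolding u_def by (simp add: algebra_simps)
    qed
    also have "\<dots> = \<kappa> - \<kappa>"
      using R_int[of "of_real (c + real n)"] R_int[of "of_real (c + real n + 1)"] set_lebesgue_integral_eq_integral(1)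
      by (subst integral_diff) auto
    finally show ?thesis by simp
  qed
  have "u t = 0" by (rule zero_moments_imp_zero[OF cont_u mom]) (use t in auto)
  then have "\<delta> t = 0" unfolding u_def using t by auto
  then show ?thesis unfolding \<delta>_def \<phi>_def \<psi>_def by simp
qed

section \<open>Twists by Ramanujan sums\<close>

abbreviation UH :: "complex set" where "UH \<equiv> {z. Im z > 0}"

lemma norm_ramanujan_sum_le: "norm (ramanujan_sum q n) \<le> real q"
proof -
  have "norm (ramanujan_sum q n) \<le> (\<Sum>a\<in>{a. a < q \<and> coprime a q}. 1)"
    unfolding ramanujan_sum_def by (intro sum_norm_le) (simp add: norm_e)
  also have "\<dots> = real (card {a. a < q \<and> coprime a q})" by simp
  also have "\<dots> \<le> real (card {..<q})" by (intro of_nat_mono card_mono) auto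
  finally show ?thesis by simp
qed

lemma fser_twist:
  fixes a :: "nat \<Rightarrow> complex"
  assumes a: "\<And>m. norm (a m) \<le> C * real (Suc m) powr \<sigma>" and z: "Im z > 0" and q: "q > 0"
  shows "fser (\<lambda>m. a m * ramanujan_sum q (Suc m)) z = (\<Sum>j | j < q \<and> coprime j q. fser a (z + of_nat j / of_nat q))"
proof -
  have "a m * ramanujan_sum q (Suc m) * e (of_nat (Suc m) * z) =
      (\<Sum>j | j < q \<and> coprime j q. a m * e (of_nat (Suc m) * (z + of_nat j / of_nat q)))" for m
    unfolding ramanujan_sum_def
    by (simp add: sum_distrib_left sum_distrib_right distrib_left e_add mult_ac del: of_nat_Suc mult_Suc_right mult_Suc)
  then have "fser (\<lambda>m. a m * ramanujan_sum q (Suc m)) z =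
      (\<Sum>m. \<Sum>j | j < q \<and> coprime j q. a m * e (of_nat (Suc m) * (z + of_nat j / of_nat q)))"
    unfolding fser_def by simp
  also have "\<dots> = (\<Sum>j | j < q \<and> coprime j q. fser a (z + of_nat j / of_nat q))"
    unfolding fser_def
  proof (rule suminf_sum)
    fix j assume "j \<in> {j. j < q \<and> coprime j q}"
    show "summable (\<lambda>m. a m * e (of_nat (Suc m) * (z + of_nat j / of_nat q)))"
      by (rule summable_norm_cancel[OF summable_fser[OF a]]) (use z in \<open>simp add: Im_divide\<close>)
  qed
  finally show ?thesis .
qed

lemma fser_add_int: "fser a (z + of_int n) = fser a z"
proof -
  have "e (of_nat (Suc m) * (z + of_int n)) = e (of_nat (Suc m) * z)" for m
    using e_of_int[of "int (Suc m) * n"] by (simp add: distrib_left e_add del: of_nat_Suc e_of_int)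
  then show ?thesis by (simp add: fser_def)
qed

lemma strip_growth_finite_order:
  assumes F: "entire_finite_order F" and M: "(M::real) \<ge> 1"
  shows "strip_growth (\<lambda>s. 1 / 2 * of_real M powr s * F (s - of_real d))"
  unfolding strip_growth_def
proof
  fix c :: real
  obtain r C where C: "\<And>z. norm (F z) \<le> C * exp (norm z powr r)" and hol: "F holomorphic_on UNIV"
    using F unfolding entire_finite_order_def by blast
  obtain m :: nat where m: "real m \<ge> r" using real_arch_simple by blast
  \<comment> \<open>In the unit disk a larger exponent makes the power of the norm smaller, so there
    the bound comes from compactness.\<close>
  have "compact (F ` cball 0 1)"
    by (intro compact_continuous_image holomorphic_on_imp_continuous_on holomorphic_on_subset[OF hol]) auto
  then obtain C1 where "\<forall>z\<in>cball 0 1. norm (F z) \<le> C1"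
    by (auto dest!: compact_imp_bounded simp: bounded_iff)
  then have C1: "\<And>z. norm z \<le> 1 \<Longrightarrow> norm (F z) \<le> C1" by simp
  define C2 where "C2 = \<bar>C\<bar> + \<bar>C1\<bar>"
  have F_le: "norm (F z) \<le> C2 * exp ((norm z) ^ m)" for z
  proof (cases "norm z \<le> 1")
    case True
    have "norm (F z) \<le> C2 * 1" using C1[OF True] unfolding C2_def by simp
    also have "\<dots> \<le> C2 * exp ((norm z) ^ m)" unfolding C2_def by (intro mult_left_mono) auto
    finally show ?thesis .
  next
    case False
    have "norm z powr r \<le> norm z powr real m" using False m by (intro powr_mono) auto
    also have "\<dots> = norm z ^ m" using False by (intro powr_realpow) auto
    finally have "C * exp (norm z powr r) \<le> C2 * exp (norm z ^ m)"
      unfolding C2_def by (intro mult_mono) auto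
    then show ?thesis using C[of z] by linarith
  qed
  have "norm (1 / 2 * of_real M powr s * F (s - of_real d)) \<le> (M powr c * C2) * exp ((norm s + \<bar>d\<bar>) ^ m)"
    if s: "\<bar>Re s\<bar> \<le> c" for s
  proof -
    have "norm (1 / 2 * of_real M powr s * F (s - of_real d)) = 1 / 2 * M powr (Re s) * norm (F (s - of_real d))"
      using M by (simp add: norm_mult norm_powr_real_powr)
    also have "\<dots> \<le> 1 * M powr c * (C2 * exp ((norm s + \<bar>d\<bar>) ^ m))"
    proof (intro mult_mono)
      show "M powr Re s \<le> M powr c" using s M by (intro powr_mono) auto
      have "norm (F (s - of_real d)) \<le> C2 * exp (norm (s - of_real d) ^ m)" by (rule F_le)
      also have "\<dots> \<le> C2 * exp ((norm s + \<bar>d\<bar>) ^ m)"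
        using norm_triangle_ineq4[of s "of_real d"] unfolding C2_def
        by (intro mult_left_mono) (auto intro!: power_mono)
      finally show "norm (F (s - of_real d)) \<le> C2 * exp ((norm s + \<bar>d\<bar>) ^ m)" .
    qed auto
    finally show ?thesis by simp
  qed
  then show "\<exists>C B m. B \<ge> 0 \<and> (\<forall>z. \<bar>Re z\<bar> \<le> c \<longrightarrow> norm (1 / 2 * of_real M powr z * F (z - of_real d)) \<le> C * exp ((norm z + B) ^ m))"
    using abs_ge_zero by blast
qed

text \<open>The 1 / 2 cancels the 2 in \<open>Gamma_C\<close>, and the scaling z = i t / M turns (2
  pi / M)^(-s) into (2 pi)^(-s) M^s. The shift by (k - 1) / 2 replaces the symmetry between s and 1
  - s by the one between s and k - s.\<close>

lemma mellin_Lambda_twist: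
  assumes a: "\<And>m. norm (a (Suc m)) \<le> C * real (Suc m) powr \<sigma>" and \<sigma>: "\<sigma> > 0" and M: "M > 0" and s: "Re s > \<sigma> + 1"
  shows "integral {0<..} (\<lambda>t. fser (\<lambda>m. a (Suc m) * ramanujan_sum q (Suc m)) (\<i> * of_real (1 / M * t)) * of_real t powr (s - 1)) =
    1 / 2 * of_real M powr s * Lambda_twist k a q (s - of_real ((real k - 1) / 2))"
proof -
  have b: "norm (a (Suc m) * ramanujan_sum q (Suc m)) \<le> (C * real q) * real (Suc m) powr \<sigma>" for m
    using mult_mono[OF a[of m] norm_ramanujan_sum_le[of q "Suc m"]] C_nonneg[of "\<lambda>m. a (Suc m)", OF a]
    by (simp add: norm_mult mult_ac del: of_nat_Suc)
  have rho: "1 / M > 0" using M by simp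
  have "of_real (2 * pi * (1 / M)) powr (- s) = of_real (2 * pi) powr (- s) * of_real (1 / M) powr (- s)"
    unfolding of_real_mult[of "2 * pi"] by (rule powr_times_real) (use M in auto)
  also have "of_real (1 / M) powr (- s) = of_real M powr s"
  proof -
    have L: "Ln (complex_of_real (1 / M)) = of_real (- ln M)"
      by (subst Ln_of_real) (use M in \<open>auto simp: ln_div\<close>)
    show ?thesis unfolding powr_def L using M by (simp add: Ln_of_real)
  qed
  finally have 1: "of_real (2 * pi * (1 / M)) powr (- s) = of_real (2 * pi) powr (- s) * of_real M powr s" .
  show ?thesis
    unfolding mellin_fser(2)[OF b \<sigma> rho s] 1 Lambda_twist_def Gamma_C_def
    by (simp add: algebra_simps del: of_nat_Suc)
qed

text \<open>The setting of the theorem at an arbitrary level; the list of levels enters only where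
  \<open>K\<close> is shown to be all of \<open>Gamma0 N\<close>.\<close>

locale ramanujan_twists =
  fixes N k :: nat and \<xi> :: "int \<Rightarrow> complex" and fc gc :: "nat \<Rightarrow> complex" and \<sigma> :: real
  assumes N: "N \<ge> 1"
    and chi: "dirichlet_character N \<xi>"
    and k: "k > 0" "\<xi> (-1) = (-1) ^ k"
    and sigma: "\<sigma> > 0"
    and growth_f: "\<exists>C. \<forall>n\<ge>1. norm (fc n) \<le> C * real n powr \<sigma>"
    and growth_g: "\<exists>C. \<forall>n\<ge>1. norm (gc n) \<le> C * real n powr \<sigma>"
    and FE: "\<forall>q::nat. q \<ge> 1 \<and> coprime q N \<longrightarrow>
       (\<exists>F G. entire_finite_order F \<and> entire_finite_order G \<and>
          (\<forall>s. Re s > \<sigma> + 1 - (real k - 1) / 2 \<longrightarrow>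
               F s = Lambda_twist k fc q s \<and> G s = Lambda_twist k gc q s) \<and>
          (\<forall>s. F s = \<i> ^ k * \<xi> (int q) * (of_nat (N * q\<^sup>2)) powr (1/2 - s) * G (1 - s)))"
begin

definition f where "f = fser (\<lambda>m. fc (Suc m))"
definition g where "g = fser (\<lambda>m. gc (Suc m))"

lemma coeff_bounds:
  obtains Cf Cg where "\<And>m. norm (fc (Suc m)) \<le> Cf * real (Suc m) powr \<sigma>"
    "\<And>m. norm (gc (Suc m)) \<le> Cg * real (Suc m) powr \<sigma>"
  using growth_f growth_g by (metis One_nat_def Suc_le_mono le0)

lemma f_holomorphic: "f holomorphic_on UH" and g_holomorphic: "g holomorphic_on UH"
  using coeff_bounds holomorphic_fser unfolding f_def g_def by metis+

lemma f_add_int: "f (z + of_int n) = f z" and g_add_int: "g (z + of_int n) = g z"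
  unfolding f_def g_def by (rule fser_add_int)+

text \<open>With M = q sqrt N as unit the conductor disappears: for d = (k - 1) / 2 one has 1 - (s -
  d) = (k - s) - d, and the conductor contributes M^(k - 2 s), which turns the M^s in P into the
  M^(k - s) in Q.\<close>

lemma functional_equation_segment:
  assumes q: "q \<ge> 1" "coprime q N" and t: "0 < t" "t < 1"
  defines "M \<equiv> sqrt (real (N * q\<^sup>2))"
  shows "(\<Sum>j | j < q \<and> coprime j q. f (\<i> * of_real (t / M) + of_nat j / of_nat q)) =
    \<i> ^ k * \<xi> (int q) * of_real t powr (- of_nat k) *
    (\<Sum>j | j < q \<and> coprime j q. g (\<i> * of_real (1 / (t * M)) + of_nat j / of_nat q))"
proof -
  obtain Cf Cg where Cf: "\<And>m. norm (fc (Suc m)) \<le> Cf * real (Suc m) powr \<sigma>"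
    and Cg: "\<And>m. norm (gc (Suc m)) \<le> Cg * real (Suc m) powr \<sigma>"
    by (rule coeff_bounds) blast
  obtain F G where FG: "entire_finite_order F" "entire_finite_order G"
    and L: "\<And>s. Re s > \<sigma> + 1 - (real k - 1) / 2 \<Longrightarrow> F s = Lambda_twist k fc q s \<and> G s = Lambda_twist k gc q s"
    and fe: "\<And>s. F s = \<i> ^ k * \<xi> (int q) * (of_nat (N * q\<^sup>2)) powr (1/2 - s) * G (1 - s)"
    using FE[rule_format, of q] q by blast
  have Nq: "real (N * q\<^sup>2) \<ge> 1" using N q
    by (metis One_nat_def Suc_leI less_le_trans mult_pos_pos of_nat_1 of_nat_mono zero_less_one zero_less_power)
  have M: "M \<ge> 1" unfolding M_def using Nq by (metis real_sqrt_ge_1_iff)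
  define d where "d = (real k - 1) / 2"
  define P where "P s = 1 / 2 * of_real M powr s * F (s - of_real d)" for s
  define Q where "Q s = 1 / 2 * of_real M powr s * G (s - of_real d)" for s
  have hol: "(\<lambda>s. 1 / 2 * of_real M powr s * X (s - of_real d)) holomorphic_on UNIV"
    if X: "entire_finite_order X" for X
  proof -
    have "X holomorphic_on UNIV" using X unfolding entire_finite_order_def by blast
    then have "X \<circ> (\<lambda>s. s - of_real d) holomorphic_on UNIV"
      by (intro holomorphic_on_compose_gen[of _ _ X UNIV]) (auto intro!: holomorphic_intros)
    then show ?thesis unfolding o_def using M by (intro holomorphic_intros) auto
  qed
  let ?tw = "\<lambda>a m. a (Suc m) * ramanujan_sum q (Suc m)"
  have tw: "norm (?tw a m) \<le> (C * real q) * real (Suc m) powr \<sigma>"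
    if a: "\<And>m. norm (a (Suc m)) \<le> C * real (Suc m) powr \<sigma>" for a C m
    using mult_mono[OF a[of m] norm_ramanujan_sum_le[of q "Suc m"]] C_nonneg[of "\<lambda>m. a (Suc m)", OF a]
    by (simp add: norm_mult mult_ac del: of_nat_Suc)
  have M0: "M > 0" using M by simp
  have "fser (?tw fc) (\<i> * of_real (1 / M * t)) =
      (\<i> ^ k * \<xi> (int q)) * of_real t powr (- of_nat k) * fser (?tw gc) (\<i> * of_real (1 / M / t))"
  proof (rule hecke_inversion[OF tw[OF Cf] tw[OF Cg] sigma _ _ _ _ _ _ _ t])
    show "P holomorphic_on UNIV" "Q holomorphic_on UNIV" unfolding P_def Q_def using hol FG by blast+
    show "strip_growth P" unfolding P_def by (rule strip_growth_finite_order[OF FG(1) M])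
    show "1 / M > 0" using M0 by simp
    fix s
    show "P s = \<i> ^ k * \<xi> (int q) * Q (of_nat k - s)"
    proof -
      have M2: "complex_of_nat (N * q\<^sup>2) = of_real M * of_real M"
        unfolding M_def using of_nat_0_le_iff by (metis of_real_mult of_real_of_nat_eq real_sqrt_mult_self abs_of_nat)
      have e1: "(of_real M * of_real M :: complex) powr z = of_real M powr (2 * z)" for z
        using powr_times_real[of "of_real M" "of_real M" z] M0 by (simp add: powr_add[symmetric])
      have e2: "1 - (s - complex_of_real d) = (of_nat k - s) - of_real d"
        unfolding d_def by (simp add: field_simps)
      have e3: "2 * (1 / 2 - (s - complex_of_real d)) = of_nat k - 2 * s"
        unfolding d_def by (simp add: field_simps)
      have e4: "complex_of_real M powr s * of_real M powr (of_nat k - 2 * s) = of_real M powr (of_nat k - s)"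
        unfolding powr_add[symmetric] by simp
      have "P s = 1 / 2 * (of_real M powr s * of_real M powr (of_nat k - 2 * s)) * (\<i> ^ k * \<xi> (int q)) * G ((of_nat k - s) - of_real d)"
        unfolding P_def fe[of "s - of_real d"] M2 e1 e2 e3 by (simp only: mult_ac)
      then show ?thesis unfolding e4 Q_def by (simp only: mult_ac)
    qed
  next
    fix s assume s: "Re s > \<sigma> + 1"
    then have "Re (s - of_real d) > \<sigma> + 1 - (real k - 1) / 2" unfolding d_def by simp
    note L = L[OF this]
    show "P s = integral {0<..} (\<lambda>t. fser (?tw fc) (\<i> * of_real (1 / M * t)) * of_real t powr (s - 1))"
      unfolding mellin_Lambda_twist[OF Cf sigma M0 s, of q k] P_def using L unfolding d_def by simp
    show "Q s = integral {0<..} (\<lambda>t. fser (?tw gc) (\<i> * of_real (1 / M * t)) * of_real t powr (s - 1))"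
      unfolding mellin_Lambda_twist[OF Cg sigma M0 s, of q k] Q_def using L unfolding d_def by simp
  qed
  moreover have "fser (?tw fc) (\<i> * of_real (1 / M * t)) = (\<Sum>j | j < q \<and> coprime j q. f (\<i> * of_real (1 / M * t) + of_nat j / of_nat q))"
    unfolding f_def by (rule fser_twist[OF Cf]) (use M0 t q in auto)
  moreover have "fser (?tw gc) (\<i> * of_real (1 / M / t)) = (\<Sum>j | j < q \<and> coprime j q. g (\<i> * of_real (1 / M / t) + of_nat j / of_nat q))"
    unfolding g_def by (rule fser_twist[OF Cg]) (use M0 t q in auto)
  ultimately show ?thesis by (simp add: mult_ac)
qed

lemma Im_minus_inverse: "Im z > 0 \<Longrightarrow> M > 0 \<Longrightarrow> Im (- 1 / (of_real M * z)) > 0"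
  by (simp add: Im_divide power2_eq_square zero_less_mult_iff sum_power2_gt_zero_iff add_pos_nonneg zero_less_divide_iff
      add_nonneg_pos)

text \<open>The identity theorem extends the relation from the segment z = i t / M, 0 < t < 1. There
  M z = i t, so multiplying by (M z)^k turns the factor i^k t^(-k) into (-1)^k.\<close>

lemma functional_equation:
  assumes q: "q \<ge> 1" "coprime q N" and z: "Im z > 0"
  defines "M \<equiv> sqrt (real (N * q\<^sup>2))"
  shows "(of_real M * z) ^ k * (\<Sum>j | j < q \<and> coprime j q. f (z + of_nat j / of_nat q)) =
    (-1) ^ k * \<xi> (int q) * (\<Sum>j | j < q \<and> coprime j q. g (- 1 / (of_real (M\<^sup>2) * z) + of_nat j / of_nat q))"
proof -
  have M: "M > 0" unfolding M_def using N q by simp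
  have M2: "M\<^sup>2 > 0" using M by simp
  let ?D = "\<lambda>z. (of_real M * z) ^ k * (\<Sum>j | j < q \<and> coprime j q. f (z + of_nat j / of_nat q)) -
    (-1) ^ k * \<xi> (int q) * (\<Sum>j | j < q \<and> coprime j q. g (- 1 / (of_real (M\<^sup>2) * z) + of_nat j / of_nat q))"
  define S where "S = (\<lambda>t. \<i> * complex_of_real (t / M)) ` {0<..<1}"
  have "?D z = 0"
  proof (rule analytic_continuation[of ?D UH S "\<i> * of_real (1 / 2 / M)"])
    have sh: "f \<circ> (\<lambda>z. z + of_nat j / of_nat q) holomorphic_on UH" for j
      by (rule holomorphic_on_compose_gen[OF _ f_holomorphic])
         (auto intro!: holomorphic_intros simp: Im_divide)
    have sg: "g \<circ> (\<lambda>z. - 1 / (of_real (M\<^sup>2) * z) + of_nat j / of_nat q) holomorphic_on UH" for j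
    proof (rule holomorphic_on_compose_gen[OF _ g_holomorphic])
      show "(\<lambda>z. - 1 / (of_real (M\<^sup>2) * z) + of_nat j / of_nat q) holomorphic_on UH"
        using M q by (intro holomorphic_intros) auto
      show "(\<lambda>z. - 1 / (of_real (M\<^sup>2) * z) + of_nat j / of_nat q) ` UH \<subseteq> UH"
        using Im_minus_inverse[OF _ M2] by (auto simp: Im_divide[of "of_nat j"])
    qed
    show "?D holomorphic_on UH"
      by (intro holomorphic_intros sh[unfolded o_def] sg[unfolded o_def])
    show "open UH" by (rule open_halfspace_Im_gt)
    show "connected UH" by (intro convex_connected convex_halfspace_Im_gt)
    show "S \<subseteq> UH" unfolding S_def using M by auto
    show "\<i> * of_real (1 / 2 / M) \<in> UH" using M by simp
    show "\<i> * complex_of_real (1 / 2 / M) islimpt S"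
      unfolding islimpt_approachable
    proof (intro allI impI)
      fix \<epsilon> :: real assume e: "\<epsilon> > 0"
      define h where "h = min (1 / 4) (\<epsilon> * M / 2)"
      have h: "h > 0" "h < 1 / 2" "h / M < \<epsilon>" unfolding h_def using e M by (auto simp: min_def field_simps)
      have "\<i> * complex_of_real ((1 / 2 + h) / M) \<in> S" unfolding S_def using h by (intro imageI) auto
      moreover have "\<i> * complex_of_real ((1 / 2 + h) / M) \<noteq> \<i> * complex_of_real (1 / 2 / M)"
        using h(1) M unfolding mult_cancel_left of_real_eq_iff by (simp add: field_simps)
      moreover have "dist (\<i> * complex_of_real ((1 / 2 + h) / M)) (\<i> * complex_of_real (1 / 2 / M)) < \<epsilon>"
      proof -
        have "\<i> * complex_of_real ((1 / 2 + h) / M) - \<i> * complex_of_real (1 / 2 / M) = \<i> * of_real (h / M)"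
          by (simp add: add_divide_distrib distrib_left)
        then show ?thesis unfolding dist_norm using h(1,3) M by (simp add: norm_mult norm_divide)
      qed
      ultimately show "\<exists>x'\<in>S. x' \<noteq> \<i> * complex_of_real (1 / 2 / M) \<and> dist x' (\<i> * complex_of_real (1 / 2 / M)) < \<epsilon>" by blast
    qed
    show "z \<in> UH" using z by simp
    fix x assume "x \<in> S"
    then obtain t where t: "0 < t" "t < 1" and x: "x = \<i> * of_real (t / M)" unfolding S_def by auto
    have 1: "- 1 / (of_real (M\<^sup>2) * x) = \<i> * of_real (1 / (t * M))"
      unfolding x using M t by (simp add: field_simps power2_eq_square)
    have 2: "of_real M * x = \<i> * of_real t" unfolding x using M by simp
    have 3: "complex_of_real t powr (- of_nat k) = inverse (of_real t ^ k)"
      using t by (simp add: powr_minus powr_nat)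
    have 4: "(\<i> * complex_of_real t) ^ k * \<i> ^ k * inverse (of_real t ^ k) = (-1) ^ k"
    proof -
      have "(\<i> * complex_of_real t) ^ k * \<i> ^ k * inverse (of_real t ^ k) = (\<i> * \<i>) ^ k"
        unfolding power_mult_distrib using t by simp
      then show ?thesis by simp
    qed
    have "(\<i> * of_real t) ^ k * (\<Sum>j | j < q \<and> coprime j q. f (\<i> * of_real (t / M) + of_nat j / of_nat q)) =
      ((\<i> * complex_of_real t) ^ k * \<i> ^ k * inverse (of_real t ^ k)) * \<xi> (int q) * (\<Sum>j | j < q \<and> coprime j q. g (\<i> * of_real (1 / (t * M)) + of_nat j / of_nat q))"
      unfolding functional_equation_segment[OF q t, folded M_def] 3 by (simp only: mult_ac)
    then show "?D x = 0" unfolding 1 2 4 unfolding x by simp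
  qed
  then show ?thesis by simp
qed

end

section \<open>The slash action\<close>

type_synonym mat = "real \<times> real \<times> real \<times> real"

fun mdet :: "mat \<Rightarrow> real" where "mdet (a, b, c, d) = a * d - b * c"

fun mmul :: "mat \<Rightarrow> mat \<Rightarrow> mat" where
  "mmul (a, b, c, d) (a', b', c', d') = (a * a' + b * c', a * b' + b * d', c * a' + d * c', c * b' + d * d')"

text \<open>There is no power of the determinant: the matrices that will occur have determinant 1,
  although their entries need not be integers. The value 0 off the half-plane turns identities of
  slashed functions into equations between functions.\<close>

fun slash :: "nat \<Rightarrow> mat \<Rightarrow> (complex \<Rightarrow> complex) \<Rightarrow> complex \<Rightarrow> complex" where
  "slash k (a, b, c, d) \<phi> z =
     (if Im z > 0 then \<phi> ((of_real a * z + of_real b) / (of_real c * z + of_real d)) / (of_real c * z + of_real d) ^ k else 0)"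

lemma denominator_nonzero:
  assumes "Im z > 0" "a * d - b * c > (0::real)"
  shows "of_real c * z + of_real d \<noteq> 0"
proof
  assume *: "of_real c * z + of_real d = 0"
  then have "Im (of_real c * z + of_real d) = 0" by simp
  then have "c = 0" using assms by simp
  with * have "d = 0" by simp
  with \<open>c = 0\<close> assms show False by simp
qed

lemma Im_moebius:
  "Im ((of_real a * z + of_real b) / (of_real c * z + of_real d)) =
    (a * d - b * c) * Im z / (norm (of_real c * z + of_real d))\<^sup>2"
  unfolding Im_divide cmod_power2 by (simp add: algebra_simps)

lemma Im_moebius_pos:
  assumes "Im z > 0" "a * d - b * c > (0::real)"
  shows "Im ((of_real a * z + of_real b) / (of_real c * z + of_real d)) > 0"
  unfolding Im_moebius using assms denominator_nonzero[OF assms] by simp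

text \<open>A right action, by the cocycle rule for c z + d: the matrix applied last stands on the
  right of the product.\<close>

lemma slash_slash:
  assumes "mdet B > 0"
  shows "slash k B (slash k A \<phi>) = slash k (mmul A B) \<phi>"
proof
  fix z
  obtain a b c d where A: "A = (a, b, c, d)" by (cases A)
  obtain a' b' c' d' where B: "B = (a', b', c', d')" by (cases B)
  show "slash k B (slash k A \<phi>) z = slash k (mmul A B) \<phi> z"
  proof (cases "Im z > 0")
    case True
    define j where "j = of_real c' * z + of_real d'"
    define w where "w = (of_real a' * z + of_real b') / j"
    have det: "a' * d' - b' * c' > 0" using assms B by simp
    have j: "j \<noteq> 0" unfolding j_def by (rule denominator_nonzero[OF True det])
    have w: "Im w > 0" unfolding w_def j_def by (rule Im_moebius_pos[OF True det])
    have wj: "w * j = of_real a' * z + of_real b'" unfolding w_def using j by simp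
    have 1: "(of_real c * w + of_real d) * j = of_real (c * a' + d * c') * z + of_real (c * b' + d * d')"
      unfolding ring_distribs mult.assoc wj unfolding j_def by (simp add: algebra_simps)
    have 2: "(of_real a * w + of_real b) * j = of_real (a * a' + b * c') * z + of_real (a * b' + b * d')"
      unfolding ring_distribs mult.assoc wj unfolding j_def by (simp add: algebra_simps)
    have "slash k B (slash k A \<phi>) z = slash k A \<phi> w / j ^ k"
      using True by (simp add: B j_def w_def)
    also have "\<dots> = \<phi> ((of_real a * w + of_real b) / (of_real c * w + of_real d)) / ((of_real c * w + of_real d) * j) ^ k"
      using w by (simp add: A power_mult_distrib)
    also have "(of_real a * w + of_real b) / (of_real c * w + of_real d) =
        ((of_real a * w + of_real b) * j) / ((of_real c * w + of_real d) * j)"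
      using j by simp
    finally show ?thesis unfolding 1 2 using True by (simp add: A B)
  qed (simp add: A B)
qed

lemma slash_1: "(\<And>z. Im z \<le> 0 \<Longrightarrow> \<phi> z = 0) \<Longrightarrow> slash k (1, 0, 0, 1) \<phi> = \<phi>"
  by (auto simp: fun_eq_iff not_less)

lemma slash_mult_left: "slash k A (\<lambda>z. x * \<phi> z) = (\<lambda>z. x * slash k A \<phi> z)"
  by (cases A) (auto simp: fun_eq_iff)

lemma slash_minus: "slash k A (\<lambda>z. - \<phi> z) = (\<lambda>z. - slash k A \<phi> z)"
  by (cases A) (auto simp: fun_eq_iff)

lemma slash_diff: "slash k A (\<lambda>z. \<phi> z - \<psi> z) = (\<lambda>z. slash k A \<phi> z - slash k A \<psi> z)"
  by (cases A) (auto simp: fun_eq_iff diff_divide_distrib)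

lemma slash_zero: "slash k A (\<lambda>z. 0) = (\<lambda>z. 0)"
  by (cases A) (auto simp: fun_eq_iff)

lemma slash_outside: "Im z \<le> 0 \<Longrightarrow> slash k A \<phi> z = 0"
  by (cases A) auto

lemma slash_holomorphic:
  assumes \<phi>: "\<phi> holomorphic_on UH" and "mdet A > 0"
  shows "slash k A \<phi> holomorphic_on UH"
proof -
  obtain a b c d where A: "A = (a, b, c, d)" by (cases A)
  have det: "a * d - b * c > 0" using assms A by simp
  let ?m = "\<lambda>z. (of_real a * z + of_real b) / (of_real c * z + of_real d)"
  have nz: "of_real c * z + of_real d \<noteq> 0" if "z \<in> UH" for z
    using denominator_nonzero[OF _ det] that by auto
  have comp: "\<phi> \<circ> ?m holomorphic_on UH"
  proof (rule holomorphic_on_compose_gen[OF _ \<phi>])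
    show "?m holomorphic_on UH" by (intro holomorphic_intros nz)
    show "?m ` UH \<subseteq> UH" using Im_moebius_pos[OF _ det] by auto
  qed
  have "(\<lambda>z. \<phi> (?m z) / (of_real c * z + of_real d) ^ k) holomorphic_on UH"
    by (intro holomorphic_on_divide comp[unfolded o_def] holomorphic_intros) (use nz in auto)
  then show ?thesis by (rule holomorphic_transform) (auto simp: A)
qed

text \<open>Representatives may be negative, and the two sides of a relation may use different
  systems. This lets a residue be paired with its negative, and b be chosen to suit a.\<close>

definition reduced_reps :: "nat \<Rightarrow> int set \<Rightarrow> bool" where
  "reduced_reps q A \<longleftrightarrow> bij_betw (\<lambda>a. a mod int q) A {a. 0 \<le> a \<and> a < int q \<and> coprime a (int q)}"

lemma sum_reduced_reps:
  fixes h :: "complex \<Rightarrow> complex"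
  assumes A: "reduced_reps q A" and q: "q > 0" and h: "\<And>z n. h (z + of_int n) = h z"
  shows "(\<Sum>j | j < q \<and> coprime j q. h (z + of_nat j / of_nat q)) = (\<Sum>a\<in>A. h (z + of_int a / of_nat q))"
proof -
  have eq: "h (z + of_int (a mod int q) / of_nat q) = h (z + of_int a / of_nat q)" for a
  proof -
    have "of_int a = complex_of_int (a mod int q) + of_int (a div int q) * of_nat q"
      by (metis mod_div_mult_eq of_int_add of_int_mult of_int_of_nat_eq)
    then have "z + of_int a / of_nat q = (z + of_int (a mod int q) / of_nat q) + of_int (a div int q)"
      using q by (simp add: add_divide_distrib)
    then show ?thesis by (simp only: h)
  qed
  have "(\<Sum>j | j < q \<and> coprime j q. h (z + of_nat j / of_nat q)) =
      (\<Sum>a | 0 \<le> a \<and> a < int q \<and> coprime a (int q). h (z + of_int a / of_nat q))"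
    by (rule sum.reindex_bij_witness[of _ nat int]) (auto simp: coprime_int_iff[symmetric] simp del: coprime_int_iff)
  also have "\<dots> = (\<Sum>a\<in>A. h (z + of_int (a mod int q) / of_nat q))"
    using A unfolding reduced_reps_def by (rule sum.reindex_bij_betw[symmetric])
  finally show ?thesis unfolding eq .
qed

context ramanujan_twists
begin

text \<open>The value off the half-plane matches the convention of \<open>slash\<close>.\<close>

definition F where "F z = (if Im z > 0 then f z else 0)"

lemma F_outside: "Im z \<le> 0 \<Longrightarrow> F z = 0" unfolding F_def by simp

lemma F_holomorphic: "F holomorphic_on UH"
  using f_holomorphic by (rule holomorphic_transform) (auto simp: F_def)

lemma xi_1: "\<xi> 1 = 1" and xi_mult: "\<xi> (m * n) = \<xi> m * \<xi> n" and xi_add: "\<xi> (n + int N) = \<xi> n"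
  and xi_0_iff: "\<xi> n = 0 \<longleftrightarrow> \<not> coprime n (int N)"
  using chi unfolding dirichlet_character_def by auto

text \<open>The relation for q = 1, read as: g is the image of f under the Fricke involution z -> -1
  / (N z).\<close>

lemma g_eq:
  assumes "Im u > 0"
  shows "g u = f (- 1 / (of_nat N * u)) / (of_real (sqrt (real N)) * u) ^ k"
proof -
  have N0: "real N > 0" using N by simp
  define w where "w = - 1 / (of_nat N * u)"
  have u0: "u \<noteq> 0" using assms by auto
  have w: "Im w > 0" unfolding w_def using Im_minus_inverse[OF assms N0] by simp
  have wu: "- 1 / (of_nat N * w) = u" unfolding w_def using N0 u0 by simp
  have one: "{j. j < 1 \<and> coprime j 1} = {0::nat}" by auto
  have s: "complex_of_real (sqrt (real N)) * of_real (sqrt (real N)) = of_nat N"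
    by (simp flip: of_real_mult)
  have s0: "complex_of_real (sqrt (real N)) \<noteq> 0" using N0 by simp
  have "(of_real (sqrt (real N)) * w) ^ k * f w = (-1) ^ k * g u"
    using functional_equation[of 1 w] w N0 wu xi_1 by (simp add: one)
  moreover have "of_real (sqrt (real N)) * w = - 1 / (of_real (sqrt (real N)) * u)"
    unfolding w_def s[symmetric] using s0 u0 by (simp add: field_simps)
  moreover have "(- 1 / (of_real (sqrt (real N)) * u)) ^ k = (-1) ^ k / (of_real (sqrt (real N)) * u) ^ k"
    by (rule power_divide)
  ultimately have "(-1) ^ k * (f w / (of_real (sqrt (real N)) * u) ^ k) = (-1) ^ k * g u" by simp
  then have "f w / (of_real (sqrt (real N)) * u) ^ k = g u" by (subst (asm) mult_left_cancel) auto
  then show ?thesis by (simp add: w_def)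
qed

lemma relation:
  assumes q: "q \<ge> 1" "coprime q N" and A: "reduced_reps q A" and B: "reduced_reps q B"
  shows "(\<Sum>a\<in>A. slash k (1, of_int a / real q, 0, 1) F z) =
    \<xi> (int q) * (\<Sum>b\<in>B. slash k (real q, 0, - real N * of_int b, 1 / real q) F z)"
proof (cases "Im z > 0")
  case True
  define M where "M = sqrt (real (N * q\<^sup>2))"
  have N0: "real N > 0" using N by simp
  have q0: "q > 0" using q by simp
  have M: "M > 0" unfolding M_def using N q by simp
  have M2: "M\<^sup>2 = real N * (real q)\<^sup>2" unfolding M_def using N0 by simp
  have Msq: "complex_of_real M = of_real (sqrt (real N)) * of_nat q"
    unfolding M_def by (simp add: real_sqrt_mult)
  have s: "complex_of_real (sqrt (real N)) * of_real (sqrt (real N)) = of_nat N"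
    by (simp flip: of_real_mult)
  have s0: "complex_of_real (sqrt (real N)) \<noteq> 0" using N0 by simp
  have z0: "z \<noteq> 0" using True by auto
  have main: "(of_real M * z) ^ k * (\<Sum>a\<in>A. f (z + of_int a / of_nat q)) =
      (-1) ^ k * \<xi> (int q) * (\<Sum>b\<in>B. g (- 1 / (of_real (M\<^sup>2) * z) + of_int b / of_nat q))"
    using functional_equation[OF q True, folded M_def]
    unfolding sum_reduced_reps[OF A q0 f_add_int, of z] sum_reduced_reps[OF B q0 g_add_int] .
  \<comment> \<open>The inversion z -> -1 / (M^2 z), the translation by b / q and the Fricke
    involution compose to a matrix that can be scaled to determinant 1 with entries rational in q, N
    and b; the square roots cancel.\<close>
  have trm: "g (- 1 / (of_real (M\<^sup>2) * z) + of_int b / of_nat q) * (-1) ^ k / (of_real M * z) ^ k =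
      slash k (real q, 0, - real N * of_int b, 1 / real q) F z" for b
  proof -
    define u where "u = - 1 / (of_real (M\<^sup>2) * z) + of_int b / of_nat q"
    have u: "Im u > 0" unfolding u_def using Im_minus_inverse[OF True, of "M\<^sup>2"] M by simp
    have det: "real q * (1 / real q) - 0 * (- real N * of_int b) > 0" using q0 by simp
    define j where "j = of_real (- real N * of_int b) * z + complex_of_real (1 / real q)"
    have j0: "j \<noteq> 0" unfolding j_def by (rule denominator_nonzero[OF True det])
    have Nu: "of_nat N * u * (of_nat q * z) = - j"
      unfolding u_def M2 j_def using N0 q0 z0 by (simp add: field_simps power2_eq_square)
    have arg: "- 1 / (of_nat N * u) = of_nat q * z / j"
    proof -
      have "- 1 / (of_nat N * u) = - (of_nat q * z) / (of_nat N * u * (of_nat q * z))"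
        using q0 z0 by simp
      then show ?thesis unfolding Nu by simp
    qed
    have arg2: "of_nat q * z / j = (of_real (real q) * z + of_real 0) / j" by simp
    have "g u * (-1) ^ k / (of_real M * z) ^ k =
        f (of_nat q * z / j) * (-1) ^ k / ((of_real (sqrt (real N)) * u) * (of_real M * z)) ^ k"
      unfolding g_eq[OF u] arg by (simp add: power_mult_distrib)
    also have "(of_real (sqrt (real N)) * u) * (of_real M * z) = - j"
      unfolding Msq Nu[symmetric] s[symmetric] by (simp only: mult_ac)
    also have "f (of_nat q * z / j) * (-1) ^ k / (- j) ^ k = f (of_nat q * z / j) / j ^ k"
      by (simp add: power_minus[of j])
    also have "\<dots> = slash k (real q, 0, - real N * of_int b, 1 / real q) F z"
    proof -
      have "Im ((of_real (real q) * z + of_real 0) / j) > 0"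
        unfolding j_def by (rule Im_moebius_pos[OF True det])
      then show ?thesis unfolding arg2 using True by (simp add: F_def j_def)
    qed
    finally show ?thesis unfolding u_def .
  qed
  have Mz: "(of_real M * z) ^ k \<noteq> 0" using M z0 by simp
  have "(\<Sum>a\<in>A. slash k (1, of_int a / real q, 0, 1) F z) = (\<Sum>a\<in>A. f (z + of_int a / of_nat q))"
    using True by (intro sum.cong) (auto simp: F_def)
  also have "\<dots> = ((-1) ^ k * \<xi> (int q) * (\<Sum>b\<in>B. g (- 1 / (of_real (M\<^sup>2) * z) + of_int b / of_nat q))) / (of_real M * z) ^ k"
    unfolding main[symmetric] using Mz by simp
  also have "\<dots> = \<xi> (int q) * (\<Sum>b\<in>B. g (- 1 / (of_real (M\<^sup>2) * z) + of_int b / of_nat q) * (-1) ^ k / (of_real M * z) ^ k)"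
    by (simp add: sum_distrib_left sum_divide_distrib mult_ac)
  finally show ?thesis unfolding trm .
qed (simp add: slash_outside sum.neutral)

end

section \<open>Elliptic eigenfunctions\<close>

text \<open>The power sums satisfy s_(m+2) = t s_(m+1) - s_m with t = p / q. Multiplying s_m by q^m
  clears denominators, and modulo q only p^m survives. Exponents start at 1, since at 0 the power
  sum is 2 instead of p^0.\<close>

lemma trace_recurrence:
  fixes j i :: complex and p q :: int
  assumes j: "j * i = 1" and t: "of_int q * (j + i) = of_int p"
  shows "\<exists>v. of_int q ^ Suc m * (j ^ Suc m + i ^ Suc m) = of_int v \<and> [v = p ^ Suc m] (mod q)"
proof (induction m rule: induct_nat_012)
  case 0
  show ?case using t by (intro exI[of _ p]) auto
next
  case 1
  have "of_int q ^ 2 * (j ^ 2 + i ^ 2) = (of_int q * (j + i))\<^sup>2 - 2 * of_int q ^ 2 * (j * i)"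
    by (simp add: power2_eq_square algebra_simps)
  also have "\<dots> = of_int (p\<^sup>2 - 2 * q\<^sup>2)" unfolding t j by simp
  finally show ?case
    by (intro exI[of _ "p\<^sup>2 - 2 * q\<^sup>2"])
       (auto simp: cong_iff_dvd_diff numeral_2_eq_2[symmetric] power2_eq_square[of q])
next
  case (ge2 m)
  then obtain v w where v: "of_int q ^ Suc m * (j ^ Suc m + i ^ Suc m) = of_int v"
    and w: "of_int q ^ Suc (Suc m) * (j ^ Suc (Suc m) + i ^ Suc (Suc m)) = of_int w" "[w = p ^ Suc (Suc m)] (mod q)"
    by blast
  have "j ^ Suc (Suc (Suc m)) + i ^ Suc (Suc (Suc m)) =
      (j + i) * (j ^ Suc (Suc m) + i ^ Suc (Suc m)) - (j * i) * (j ^ Suc m + i ^ Suc m)"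
    by (simp add: algebra_simps)
  then have "of_int q ^ Suc (Suc (Suc m)) * (j ^ Suc (Suc (Suc m)) + i ^ Suc (Suc (Suc m))) =
      (of_int q * (j + i)) * (of_int q ^ Suc (Suc m) * (j ^ Suc (Suc m) + i ^ Suc (Suc m)))
      - of_int q ^ 2 * (j * i) * (of_int q ^ Suc m * (j ^ Suc m + i ^ Suc m))"
    by (simp add: algebra_simps power2_eq_square)
  also have "\<dots> = of_int (p * w - q\<^sup>2 * v)" unfolding t j v w(1) by simp
  finally have 1: "of_int q ^ Suc (Suc (Suc m)) * (j ^ Suc (Suc (Suc m)) + i ^ Suc (Suc (Suc m))) = of_int (p * w - q\<^sup>2 * v)" .
  have "[p * w - q\<^sup>2 * v = p * p ^ Suc (Suc m) - 0] (mod q)"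
    by (intro cong_diff cong_mult w(2) cong_refl) (simp add: cong_0_iff power2_eq_square)
  with 1 show ?case by (intro exI[of _ "p * w - q\<^sup>2 * v"]) simp
qed

text \<open>A sum of two roots of unity is an algebraic integer, so if it is rational it is an
  integer. Concretely, j^m = 1 forces i^m = 1, so 2 q^m is congruent to p^m modulo q; then q divides
  p^m, and in lowest terms q = 1.\<close>

lemma rational_trace_not_root_of_unity:
  fixes j i :: complex
  assumes j: "j * i = 1" "j + i = of_real t" and t: "t \<in> \<rat>" "t \<notin> \<int>" and m: "m > 0"
  shows "j ^ m \<noteq> 1"
proof
  assume jm: "j ^ m = 1"
  obtain p q where pq: "q > 0" "coprime p q" "t = of_int p / of_int q"
    using Rats_cases'[OF t(1)] by metis
  have q1: "q \<noteq> 1" using t(2) pq by auto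
  have tq: "of_int q * (j + i) = of_int p" using j pq by simp
  obtain m' where m': "m = Suc m'" using m gr0_conv_Suc by blast
  obtain v where v: "of_int q ^ m * (j ^ m + i ^ m) = of_int v" "[v = p ^ m] (mod q)"
    using trace_recurrence[OF j(1) tq, of m'] unfolding m' by blast
  have "(j * i) ^ m = 1" using j by simp
  then have "i ^ m = 1" using jm by (simp add: power_mult_distrib)
  then have "complex_of_int v = of_int (2 * q ^ m)" using v(1) jm by (simp add: mult.commute)
  then have "v = 2 * q ^ m" by (simp only: of_int_eq_iff)
  then have "q dvd v" using m by simp
  then have "q dvd p ^ m" using v(2) cong_dvd_iff by blast
  then have "is_unit q" using pq(2) by (metis coprime_commute coprime_power_right_iff coprime_absorb_left m)
  then show False using q1 pq(1) by simp
qed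

theorem slash_elliptic_eigenfunction_zero:
  assumes h: "h holomorphic_on UH" "\<And>z. Im z \<le> 0 \<Longrightarrow> h z = 0"
    and det: "a * d - b * c = 1" and t: "\<bar>a + d\<bar> < 2" "a + d \<in> \<rat>" "a + d \<notin> \<int>"
    and eig: "slash k (a, b, c, d) h = (\<lambda>z. l * h z)" and l: "l ^ r = 1" "r > 0" and k: "k > 0"
  shows "h = (\<lambda>z. 0)"
proof (rule ccontr)
  assume "h \<noteq> (\<lambda>z. 0)"
  then obtain z1 where z1: "h z1 \<noteq> 0" by auto
  then have "z1 \<in> UH" using h(2) by force
  with z1 have nz: "\<exists>w\<in>UH. h w \<noteq> 0" by blast
  define s where "s = sqrt (4 - (a + d)\<^sup>2)"
  have lt4: "(a + d)\<^sup>2 < 4" using t(1) power_strict_mono[of "\<bar>a + d\<bar>" 2 2] by simp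
  then have s: "s > 0" "s * s = 4 - (a + d)\<^sup>2" unfolding s_def by (auto simp: real_sqrt_mult_self)
  have c0: "c \<noteq> 0"
  proof
    assume "c = 0"
    then have "(a + d)\<^sup>2 = (a - d)\<^sup>2 + 4" using det by (simp add: power2_eq_square algebra_simps)
    then show False using lt4 zero_le_power2[of "a - d"] by linarith
  qed
  \<comment> \<open>The sign of c selects the fixed point that lies in the upper half-plane.\<close>
  define \<epsilon> where "\<epsilon> = sgn c"
  have \<epsilon>: "\<epsilon> * \<epsilon> = 1" "c * \<epsilon> = \<bar>c\<bar>" unfolding \<epsilon>_def using c0 by (auto simp: sgn_if)
  define z0 where "z0 = (of_real (a - d) + \<i> * of_real (\<epsilon> * s)) / of_real (2 * c)"
  \<comment> \<open>j is the automorphy factor at the fixed point. It and i are the eigenvalues of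
    the matrix: their sum is the trace, their product the determinant.\<close>
  define j where "j = of_real c * z0 + of_real d"
  define i where "i = of_real a - of_real c * z0"
  have z0: "Im z0 > 0"
    unfolding z0_def using c0 s \<epsilon> by (simp add: Im_divide_of_real \<epsilon>_def sgn_if field_simps zero_less_divide_iff)
  have cz: "of_real c * z0 = (of_real (a - d) + \<i> * of_real (\<epsilon> * s)) / 2" unfolding z0_def using c0 by simp
  have ji: "j + i = of_real (a + d)" unfolding j_def i_def by simp
  have ji1: "j * i = 1"
  proof -
    have jeq: "j = (of_real (a + d) + \<i> * of_real (\<epsilon> * s)) / 2" unfolding j_def cz by (simp add: field_simps)
    have ieq: "i = (of_real (a + d) - \<i> * of_real (\<epsilon> * s)) / 2" unfolding i_def cz by (simp add: field_simps)
    have "j * i = (of_real ((a + d)\<^sup>2) - (\<i> * \<i>) * of_real ((\<epsilon> * \<epsilon>) * (s * s))) / 4"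
      unfolding jeq ieq by (simp add: power2_eq_square algebra_simps)
    also have "\<dots> = 1" unfolding \<epsilon> s(2) by simp
    finally show ?thesis .
  qed
  have j0: "j \<noteq> 0" using ji1 by auto
  have fixpt: "of_real a * z0 + of_real b = z0 * j"
  proof -
    have "of_real c * (of_real a * z0 + of_real b) = of_real c * z0 * of_real a + (of_real (a * d) - 1)"
      using det by (simp add: algebra_simps flip: of_real_mult)
    also have "\<dots> = of_real c * z0 * of_real a + (of_real a * of_real d - j * i)" using ji1 by simp
    also have "\<dots> = of_real c * (z0 * j)" unfolding j_def i_def by (simp add: algebra_simps)
    finally show ?thesis using c0 by simp
  qed
  define n where "n = nat (zorder h z0)"
  define u where "u = zor_poly h z0"
  have op: "open UH" and cn: "connected UH"
    by (rule open_halfspace_Im_gt) (intro convex_connected convex_halfspace_Im_gt)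
  obtain \<rho> where \<rho>: "\<rho> > 0" "cball z0 \<rho> \<subseteq> UH" "u holomorphic_on cball z0 \<rho>"
    and u: "\<And>w. w \<in> cball z0 \<rho> \<Longrightarrow> h w = u w * (w - z0) ^ n" "u z0 \<noteq> 0"
    using zorder_exist_zero[OF h(1) op cn _ nz] z0 unfolding n_def u_def
    by (metis (no_types, lifting) centre_in_cball less_imp_le mem_Collect_eq)
  define \<mu> :: "complex \<Rightarrow> complex" where "\<mu> w = (of_real a * w + of_real b) / (of_real c * w + of_real d)" for w
  have \<mu>0: "\<mu> z0 = z0" unfolding \<mu>_def fixpt using j0 by (simp add: j_def[symmetric])
  have c\<mu>: "isCont \<mu> z0" unfolding \<mu>_def using j0 by (auto intro!: continuous_intros simp: j_def)
  have cu: "isCont u z0"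
    using \<rho> by (metis continuous_on_interior holomorphic_on_imp_continuous_on centre_in_ball interior_cball)
  have cu\<mu>: "isCont (\<lambda>w. u (\<mu> w)) z0" using isCont_o2[OF c\<mu>] cu \<mu>0 by simp
  have "\<forall>\<^sub>F w in at z0. \<mu> w \<in> ball z0 \<rho>"
    using c\<mu> \<mu>0 \<rho>(1) unfolding isCont_def by (metis centre_in_ball open_ball topological_tendstoD)
  moreover have "\<forall>\<^sub>F w in at z0. w \<in> ball z0 \<rho> - {z0}"
    using \<rho>(1) by (intro eventually_at_in_open) auto
  ultimately have ev: "\<forall>\<^sub>F w in at z0. u (\<mu> w) = l * u w * (of_real c * w + of_real d) ^ (n + k) * j ^ n"
  proof eventually_elim
    case (elim w)
    have w: "w \<in> cball z0 \<rho>" "w \<noteq> z0" "\<mu> w \<in> cball z0 \<rho>" using elim by auto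
    then have wU: "Im w > 0" using \<rho> by auto
    have det0: "a * d - b * c > 0" using det by simp
    define jw where "jw = of_real c * w + of_real d"
    have jw: "jw \<noteq> 0" unfolding jw_def by (rule denominator_nonzero[OF wU det0])
    \<comment> \<open>The Moebius map has derivative j^(-2) at its fixed point; this is the exact
      form of that statement for finite differences.\<close>
    have diff: "\<mu> w - z0 = (w - z0) / (jw * j)"
    proof -
      have mw: "\<mu> w * jw = of_real a * w + of_real b"
        unfolding \<mu>_def jw_def[symmetric] using jw by simp
      have "(\<mu> w - z0) * (jw * j) = (\<mu> w * jw) * j - (z0 * j) * jw"
        by (simp add: algebra_simps)
      also have "\<dots> = (of_real a * w + of_real b) * j - (z0 * j) * jw"
        unfolding mw ..
      also have "\<dots> = (of_real a * w + of_real b) * j - (of_real a * z0 + of_real b) * jw"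
        unfolding fixpt ..
      also have "\<dots> = of_real (a * d - b * c) * (w - z0)"
        unfolding jw_def j_def by (simp add: algebra_simps)
      finally show ?thesis using det jw j0 by (simp add: field_simps)
    qed
    have "h (\<mu> w) / jw ^ k = l * h w"
      using fun_cong[OF eig, of w] wU by (simp add: \<mu>_def jw_def)
    then have "u (\<mu> w) * ((w - z0) / (jw * j)) ^ n / jw ^ k = l * (u w * (w - z0) ^ n)"
      unfolding u(1)[OF w(1)] u(1)[OF w(3)] diff .
    moreover have "(w - z0) ^ n \<noteq> 0" using w by simp
    ultimately show ?case
      unfolding jw_def[symmetric] using jw j0 w(2) by (simp add: power_divide power_mult_distrib power_add field_simps)
  qed
  have "((\<lambda>w. u (\<mu> w)) \<longlongrightarrow> u z0) (at z0)" using cu\<mu> \<mu>0 unfolding isCont_def by simp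
  moreover have "((\<lambda>w. u (\<mu> w)) \<longlongrightarrow> l * u z0 * (of_real c * z0 + of_real d) ^ (n + k) * j ^ n) (at z0)"
  proof (rule Lim_transform_eventually)
    show "((\<lambda>w. l * u w * (of_real c * w + of_real d) ^ (n + k) * j ^ n) \<longlongrightarrow>
        l * u z0 * (of_real c * z0 + of_real d) ^ (n + k) * j ^ n) (at z0)"
      using cu unfolding isCont_def by (intro tendsto_intros)
  qed (use ev in \<open>auto elim: eventually_mono\<close>)
  \<comment> \<open>Comparison of leading coefficients yields l j^(2 n + k) = 1, so j is a root of
    unity; k > 0 keeps the exponent positive even when h does not vanish at z0.\<close>
  ultimately have "u z0 = l * u z0 * j ^ (n + k) * j ^ n"
    unfolding j_def[symmetric] using tendsto_unique[OF at_neq_bot] by blast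
  then have "l * j ^ (n + k + n) = 1" using u(2) by (simp add: power_add field_simps)
  then have "(l * j ^ (n + k + n)) ^ r = 1" by simp
  then have "j ^ ((n + k + n) * r) = 1" using l by (simp add: power_mult_distrib power_mult)
  then show False
    using rational_trace_not_root_of_unity[OF ji1 ji t(2,3)] l k by simp
qed

section \<open>The stabiliser in the Hecke congruence group\<close>

type_synonym imat = "int \<times> int \<times> int \<times> int"

fun imul :: "imat \<Rightarrow> imat \<Rightarrow> imat" where
  "imul (a, b, c, d) (a', b', c', d') = (a * a' + b * c', a * b' + b * d', c * a' + d * c', c * b' + d * d')"

fun iinv :: "imat \<Rightarrow> imat" where "iinv (a, b, c, d) = (d, - b, - c, a)"

fun rmat :: "imat \<Rightarrow> mat" where "rmat (a, b, c, d) = (of_int a, of_int b, of_int c, of_int d)"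

lemma rmat_imul: "rmat (imul A B) = mmul (rmat A) (rmat B)"
  by (cases A; cases B) simp

definition Gamma0 :: "nat \<Rightarrow> imat set" where
  "Gamma0 N = {(a, b, c, d). a * d - b * c = 1 \<and> int N dvd c}"

lemma Gamma0_iff [simp]: "(a, b, c, d) \<in> Gamma0 N \<longleftrightarrow> a * d - b * c = 1 \<and> int N dvd c"
  by (simp add: Gamma0_def)

lemma imul_Gamma0: "A \<in> Gamma0 N \<Longrightarrow> B \<in> Gamma0 N \<Longrightarrow> imul A B \<in> Gamma0 N"
proof (cases A; cases B)
  fix a b c d a' b' c' d' assume *: "A \<in> Gamma0 N" "B \<in> Gamma0 N" "A = (a, b, c, d)" "B = (a', b', c', d')"
  have "(a * a' + b * c') * (c * b' + d * d') - (a * b' + b * d') * (c * a' + d * c') = (a * d - b * c) * (a' * d' - b' * c')"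
    by (simp add: algebra_simps)
  then show ?thesis using * by auto
qed

lemma iinv_Gamma0: "A \<in> Gamma0 N \<Longrightarrow> iinv A \<in> Gamma0 N"
  by (cases A) (auto simp: algebra_simps)

lemma mdet_rmat: "A \<in> Gamma0 N \<Longrightarrow> mdet (rmat A) = 1"
  by (cases A) (auto simp flip: of_int_mult of_int_diff)

lemma imul_iinv: "A \<in> Gamma0 N \<Longrightarrow> imul A (iinv A) = (1, 0, 0, 1)" "A \<in> Gamma0 N \<Longrightarrow> imul (iinv A) A = (1, 0, 0, 1)"
  by (cases A; auto simp: algebra_simps)+

context ramanujan_twists
begin

lemma xi_shift: "\<xi> (n + int N * m) = \<xi> n"
proof (induction m rule: int_induct[where k = 0])
  case (step1 i) then show ?case using xi_add[of "n + int N * i"] by (simp add: algebra_simps)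
next
  case (step2 i) then show ?case using xi_add[of "n + int N * (i - 1)"] by (simp add: algebra_simps)
qed simp

lemma xi_dvd_cong: "int N dvd m - n \<Longrightarrow> \<xi> m = \<xi> n"
  using xi_shift by (metis add_diff_cancel_left' add_diff_eq dvd_def diff_add_cancel add.commute)

lemma xi_power: "\<xi> (m ^ n) = \<xi> m ^ n"
  by (induction n) (auto simp: xi_mult xi_1)

text \<open>Euler's theorem. The eigenvalues in the elliptic argument are 1 or quotients of such
  values.\<close>

lemma xi_root_of_unity:
  assumes "coprime n (int N)"
  shows "\<xi> n ^ totient N = 1"
proof -
  define m where "m = nat (n mod int N)"
  have m: "int m = n mod int N" unfolding m_def using N by simp
  have "coprime (int m) (int N)" unfolding m using assms N by (simp add: coprime_mod_left_iff)
  then have "coprime m N" by simp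
  from euler_theorem[OF this] have "[int m ^ totient N = 1] (mod int N)"
    using cong_int_iff[of "m ^ totient N" 1 N] by simp
  then have "int N dvd int m ^ totient N - 1" by (simp add: cong_iff_dvd_diff)
  then have "\<xi> (int m ^ totient N) = \<xi> 1" by (rule xi_dvd_cong)
  then have "\<xi> (int m) ^ totient N = 1" by (simp add: xi_power xi_1)
  moreover have "\<xi> (int m) = \<xi> n" unfolding m by (intro xi_dvd_cong) (simp add: mod_eq_dvd_iff[symmetric])
  ultimately show ?thesis by simp
qed

text \<open>For a matrix of $\Gamma_0(N)$ the character of the upper left entry is the inverse of the character
  of the lower right one; in the relations for the twists the upper left entry is $q$.\<close>

definition act :: "imat \<Rightarrow> (complex \<Rightarrow> complex) \<Rightarrow> complex \<Rightarrow> complex" where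
  "act A \<phi> z = \<xi> (fst A) * slash k (rmat A) \<phi> z"

lemma act_def': "act A \<phi> = (\<lambda>z. \<xi> (fst A) * slash k (rmat A) \<phi> z)"
  by (simp add: fun_eq_iff act_def)

text \<open>The upper left entry of the product is a a' + b c' with N dividing c', so modulo N it is
  multiplicative and \<open>act\<close> is a right action of \<open>Gamma0 N\<close>.\<close>

lemma act_act:
  assumes "A \<in> Gamma0 N" "B \<in> Gamma0 N"
  shows "act B (act A \<phi>) = act (imul A B) \<phi>"
proof -
  have "\<xi> (fst (imul A B)) = \<xi> (fst A) * \<xi> (fst B)"
    using assms by (cases A; cases B) (auto simp: xi_mult[symmetric] intro!: xi_dvd_cong dvd_mult)
  then show ?thesis
    unfolding act_def' slash_mult_left rmat_imul using slash_slash[of "rmat B" k "rmat A" \<phi>] mdet_rmat[OF assms(2)]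
    by (simp add: mult_ac)
qed

definition K :: "imat set" where "K = {A \<in> Gamma0 N. act A F = F}"

definition defect :: "imat \<Rightarrow> complex \<Rightarrow> complex" where "defect A z = F z - act A F z"

lemma K_Gamma0: "A \<in> K \<Longrightarrow> A \<in> Gamma0 N" unfolding K_def by simp

lemma K_iff_defect: "A \<in> Gamma0 N \<Longrightarrow> A \<in> K \<longleftrightarrow> defect A = (\<lambda>z. 0)"
  unfolding K_def defect_def by (auto simp: fun_eq_iff)

lemma F_slash_1: "slash k (1, 0, 0, 1) F = F"
  by (rule slash_1) (rule F_outside)

lemma K_mult: "A \<in> K \<Longrightarrow> B \<in> K \<Longrightarrow> imul A B \<in> K"
  using act_act[of A B F] imul_Gamma0[of A N B] unfolding K_def by auto

lemma act_1: "(\<And>z. Im z \<le> 0 \<Longrightarrow> \<phi> z = 0) \<Longrightarrow> act (1, 0, 0, 1) \<phi> = \<phi>"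
  unfolding act_def' using slash_1[of \<phi> k] by (simp add: xi_1 del: slash.simps)

lemma K_inv: "A \<in> K \<Longrightarrow> iinv A \<in> K"
  using act_act[of A "iinv A" F] iinv_Gamma0[of A N] imul_iinv(1)[of A N] act_1[OF F_outside] unfolding K_def by auto

lemma K_T: "(1, n, 0, 1) \<in> K"
proof -
  have "slash k (1, of_int n, 0, 1) F = F"
    by (auto simp: fun_eq_iff F_def f_add_int)
  then show ?thesis unfolding K_def act_def' by (simp add: xi_1)
qed

lemma K_neg: "(-1, 0, 0, -1) \<in> K"
proof -
  have "(\<lambda>z. (-1) ^ k * slash k (-1, 0, 0, -1) F z) = F"
    by (auto simp: fun_eq_iff F_def simp flip: power_mult_distrib)
  then show ?thesis unfolding K_def act_def' by (simp add: k(2) del: slash.simps)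
qed

lemma reduced_reps_1: "reduced_reps 1 {a}"
  unfolding reduced_reps_def bij_betw_def by auto

text \<open>Modulo 1 any single integer is a full system of representatives, so the relation for q =
  1 may be read with a = 0 on one side and b = 1 on the other.\<close>

lemma K_U: "(1, 0, int N, 1) \<in> K"
proof -
  have "slash k (1, 0, - real N, 1) F z = F z" for z
    using relation[of 1 "{0}" "{1}" z] reduced_reps_1 F_slash_1 by (simp add: xi_1 del: slash.simps)
  then have "(1, 0, - int N, 1) \<in> K" unfolding K_def act_def' by (simp add: xi_1 fun_eq_iff del: slash.simps)
  from K_inv[OF this] show ?thesis by simp
qed

text \<open>Since the translations lie in \<open>K\<close>, membership depends on the bottom row only.\<close>

definition row :: "int \<Rightarrow> int \<Rightarrow> bool" where "row c d \<longleftrightarrow> (\<exists>a b. (a, b, c, d) \<in> K)"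

lemma K_iff_row:
  assumes "(a, b, c, d) \<in> Gamma0 N"
  shows "(a, b, c, d) \<in> K \<longleftrightarrow> row c d"
proof
  assume "row c d"
  then obtain a' b' where *: "(a', b', c, d) \<in> K" unfolding row_def by blast
  \<comment> \<open>The number b a' - a b' is the upper right entry of (a, b; c, d) times the
    inverse of (a', b'; c, d), and this product is a translation.\<close>
  have eq: "imul (1, b * a' - a * b', 0, 1) (a', b', c, d) = (a, b, c, d)"
  proof -
    have d1: "a' * d - b' * c = 1" "a * d - b * c = 1" using K_Gamma0[OF *] assms by auto
    have "a' + (b * a' - a * b') * c = a' * (1 + b * c) - a * (b' * c)" by (simp add: algebra_simps)
    also have "1 + b * c = a * d" using d1(2) by linarith
    also have "a' * (a * d) - a * (b' * c) = a * (a' * d - b' * c)" by (simp add: algebra_simps)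
    finally have 1: "a' + (b * a' - a * b') * c = a" unfolding d1 by simp
    have "b' + (b * a' - a * b') * d = b' * (1 - a * d) + b * (a' * d)" by (simp add: algebra_simps)
    also have "1 - a * d = - (b * c)" using d1(2) by linarith
    also have "b' * (- (b * c)) + b * (a' * d) = b * (a' * d - b' * c)" by (simp add: algebra_simps)
    finally have 2: "b' + (b * a' - a * b') * d = b" unfolding d1 by simp
    show ?thesis using 1 2 by simp
  qed
  show "(a, b, c, d) \<in> K" using K_mult[OF K_T[of "b * a' - a * b'"] *] unfolding eq .
qed (auto simp: row_def)

lemma rowI: "(a, b, c, d) \<in> K \<Longrightarrow> row c d"
  unfolding row_def by blast

lemma row_mult:
  assumes "row c d" "row c' d'" "(a', b', c', d') \<in> Gamma0 N"
  shows "row (c * a' + d * c') (c * b' + d * d')"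
proof -
  obtain a b where "(a, b, c, d) \<in> K" using assms(1) unfolding row_def by blast
  moreover have "(a', b', c', d') \<in> K" using assms(2,3) K_iff_row by blast
  ultimately have "imul (a, b, c, d) (a', b', c', d') \<in> K" by (rule K_mult)
  then show ?thesis by (auto intro: rowI)
qed

lemma row_shift: "row c d \<Longrightarrow> row c (d + n * c)"
  using row_mult[OF _ rowI[OF K_T[of n]], of c d 1 n] by (simp add: algebra_simps)

lemma row_neg: "row c d \<Longrightarrow> row (- c) (- d)"
  using row_mult[OF _ rowI[OF K_neg], of c d "-1" 0] by simp

lemma row_neg_iff: "row (- c) (- d) \<longleftrightarrow> row c d"
  using row_neg[of c d] row_neg[of "-c" "-d"] by auto

lemma row_inv:
  assumes "row c d" "(a, b, c, d) \<in> Gamma0 N"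
  shows "row (- c) a"
  using K_inv[of "(a, b, c, d)"] assms K_iff_row[OF assms(2)] by (auto intro: rowI)

lemma row_inv': "row c d \<Longrightarrow> (a, b, c, d) \<in> Gamma0 N \<Longrightarrow> row c (- a)"
  using row_neg[OF row_inv] by simp

text \<open>Defects form a cocycle: the defect of A B is that of B plus \<open>act B\<close> of that
  of A. This lemma, \<open>defect_mult_right\<close> and \<open>defect_inv\<close> are the cases A
  in K, B in K, and A B = 1.\<close>

lemma defect_mult:
  assumes "A \<in> K" "B \<in> Gamma0 N"
  shows "defect (imul A B) = defect B"
proof -
  have "act A F = F" using assms(1) unfolding K_def by simp
  then have "act (imul A B) F = act B F" using act_act[OF K_Gamma0[OF assms(1)] assms(2), of F] by simp
  then show ?thesis unfolding defect_def by simp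
qed

lemma act_diff: "act A (\<lambda>z. \<phi> z - \<psi> z) = (\<lambda>z. act A \<phi> z - act A \<psi> z)"
  unfolding act_def' slash_diff by (simp add: fun_eq_iff algebra_simps)

lemma defect_mult_right:
  assumes "A \<in> Gamma0 N" "B \<in> K"
  shows "defect (imul A B) = act B (defect A)"
proof -
  have "act B (defect A) = (\<lambda>z. act B F z - act B (act A F) z)"
    unfolding defect_def by (rule act_diff)
  then show ?thesis
    unfolding act_act[OF assms(1) K_Gamma0[OF assms(2)]] using assms(2) by (simp add: K_def defect_def fun_eq_iff)
qed

lemma defect_inv:
  assumes "A \<in> Gamma0 N"
  shows "defect (iinv A) = (\<lambda>z. - act (iinv A) (defect A) z)"
proof -
  have "act (iinv A) (defect A) = (\<lambda>z. act (iinv A) F z - act (iinv A) (act A F) z)"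
    unfolding defect_def by (rule act_diff)
  also have "act (iinv A) (act A F) = F"
    unfolding act_act[OF assms iinv_Gamma0[OF assms]] imul_iinv(1)[OF assms] by (rule act_1[OF F_outside])
  finally show ?thesis unfolding defect_def by (simp add: fun_eq_iff)
qed

lemma defect_outside: "Im z \<le> 0 \<Longrightarrow> defect A z = 0"
  unfolding defect_def act_def by (simp add: F_outside slash_outside)

lemma defect_holomorphic: "A \<in> Gamma0 N \<Longrightarrow> defect A holomorphic_on UH"
  unfolding defect_def act_def
  by (intro holomorphic_intros F_holomorphic slash_holomorphic) (auto simp: mdet_rmat)

lemma defect_elliptic:
  assumes A: "A \<in> Gamma0 N" and det: "a * d - b * c = 1"
    and t: "\<bar>a + d\<bar> < 2" "a + d \<in> \<rat>" "a + d \<notin> \<int>"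
    and eig: "slash k (a, b, c, d) (defect A) = (\<lambda>z. l * defect A z)" and l: "l ^ totient N = 1"
  shows "A \<in> K"
  unfolding K_iff_defect[OF A]
  by (rule slash_elliptic_eigenfunction_zero[OF defect_holomorphic[OF A] defect_outside det t eig l]) (use N k in auto)

text \<open>\<beta> picks one integer b from the class solving N a b = -1 modulo q, and
  \<open>m a\<close> is the resulting lower right entry. As a runs through the reduced residues so
  does b, which allows the two sums in \<open>relation\<close> to be matched term by term.\<close>

lemma defect_relation:
  assumes q: "q \<ge> 1" "coprime q N" and A: "finite A" "reduced_reps q A"
    and \<beta>: "inj_on \<beta> A" "reduced_reps q (\<beta> ` A)" and m: "\<And>a. a \<in> A \<Longrightarrow> 1 + int N * a * \<beta> a = int q * m a"
  shows "(\<Sum>a\<in>A. slash k (1, of_int a / real q, 0, 1) (defect (int q, - a, - int N * \<beta> a, m a)) z) = 0"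
proof -
  have q0: "real q \<noteq> 0" using q by simp
  have *: "slash k (1, of_int a / real q, 0, 1) (defect (int q, - a, - int N * \<beta> a, m a)) z =
      slash k (1, of_int a / real q, 0, 1) F z - \<xi> (int q) * slash k (real q, 0, - real N * of_int (\<beta> a), 1 / real q) F z"
    if a: "a \<in> A" for a
  proof -
    have "defect (int q, - a, - int N * \<beta> a, m a) = (\<lambda>z. F z - \<xi> (int q) * slash k (rmat (int q, - a, - int N * \<beta> a, m a)) F z)"
      unfolding defect_def act_def by (simp add: fun_eq_iff del: rmat.simps)
    moreover have "mmul (rmat (int q, - a, - int N * \<beta> a, m a)) (1, of_int a / real q, 0, 1) =
        (real q, 0, - real N * of_int (\<beta> a), 1 / real q)"
    proof -
      have "real_of_int (1 + int N * a * \<beta> a) = of_int (int q * m a)" using m[OF a] by simp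
      then have "of_int (m a) = (1 + real N * of_int a * of_int (\<beta> a)) / real q" using q0 by (simp add: field_simps)
      then show ?thesis using q0 by (simp add: field_simps)
    qed
    moreover have "mdet (1, of_int a / real q, 0, 1) > 0" by simp
    ultimately show ?thesis
      by (simp only: slash_diff slash_mult_left slash_slash)
  qed
  have "(\<Sum>a\<in>A. slash k (1, of_int a / real q, 0, 1) (defect (int q, - a, - int N * \<beta> a, m a)) z) =
      (\<Sum>a\<in>A. slash k (1, of_int a / real q, 0, 1) F z - \<xi> (int q) * slash k (real q, 0, - real N * of_int (\<beta> a), 1 / real q) F z)"
    by (intro sum.cong refl *)
  also have "\<dots> = 0"
    unfolding sum_subtractf sum_distrib_left[symmetric] relation[OF q A(2) \<beta>(2), of z]
    by (simp add: sum.reindex[OF \<beta>(1)] o_def del: slash.simps)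
  finally show ?thesis .
qed

end

section \<open>Relations between the defects\<close>

text \<open>The moduli above 1 with at most two reduced residues, followed by the moduli 5 and 8 for
  levels 6 and 15.\<close>

lemma reduced_reps_2: "reduced_reps 2 {1}"
  and reduced_reps_3: "reduced_reps 3 {1, -1}"
  and reduced_reps_4: "reduced_reps 4 {1, -1}"
  and reduced_reps_6: "reduced_reps 6 {1, -1}"
  and reduced_reps_5: "reduced_reps 5 {1, -1, 2, -2}"
  and reduced_reps_8: "reduced_reps 8 {1, -1, 3, -3}"
proof -
  have *: "{a. 0 \<le> a \<and> a < int q \<and> coprime a (int q)} = Set.filter (\<lambda>a. coprime a (int q)) {0..<int q}" for q
    by auto
  have "Set.filter (\<lambda>a. coprime a 2) {0..<2} = {1::int}"
    "Set.filter (\<lambda>a. coprime a 3) {0..<3} = {1, 2::int}"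
    "Set.filter (\<lambda>a. coprime a 4) {0..<4} = {1, 3::int}"
    "Set.filter (\<lambda>a. coprime a 6) {0..<6} = {1, 5::int}"
    "Set.filter (\<lambda>a. coprime a 5) {0..<5} = {1, 2, 3, 4::int}"
    "Set.filter (\<lambda>a. coprime a 8) {0..<8} = {1, 3, 5, 7::int}"
    by code_simp+
  then show "reduced_reps 2 {1}" "reduced_reps 3 {1, -1}" "reduced_reps 4 {1, -1}" "reduced_reps 6 {1, -1}"
    "reduced_reps 5 {1, -1, 2, -2}" "reduced_reps 8 {1, -1, 3, -3}"
    unfolding reduced_reps_def * bij_betw_def by auto
qed

context ramanujan_twists
begin

lemma defect_slash_1: "slash k (1, 0, 0, 1) (defect A) = defect A"
  by (rule slash_1) (rule defect_outside)

text \<open>Modulo 2 a single reduced residue remains, so the relation says that one translate of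
  one defect vanishes; a = b = 1 is admissible because 1 + N = 2 (n + 1).\<close>

lemma K_twist_2:
  assumes "N = 2 * n + 1"
  shows "(2, -1, - int N, int n + 1) \<in> K"
proof -
  have "int N = 2 * int n + 1" using assms by simp
  then have "2 * (int n + 1) - (-1) * (- int N) = 1" by simp
  then have G: "(2, -1, - int N, int n + 1) \<in> Gamma0 N" by (simp only: Gamma0_iff) simp
  have cop: "coprime 2 N" using assms by simp
  have "slash k (1, 1 / 2, 0, 1) (defect (2, -1, - int N, int n + 1)) z = 0" for z
    using defect_relation[OF _ cop _ reduced_reps_2, of "\<lambda>a. a" "\<lambda>_. int n + 1" z] reduced_reps_2 assms
    by (simp del: slash.simps)
  then have "slash k (1, 1 / 2, 0, 1) (defect (2, -1, - int N, int n + 1)) = (\<lambda>z. 0)" by (simp add: fun_eq_iff del: slash.simps)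
  then have "slash k (1, - 1 / 2, 0, 1) (slash k (1, 1 / 2, 0, 1) (defect (2, -1, - int N, int n + 1))) = (\<lambda>z. 0)"
    by (simp only: slash_zero)
  then have "defect (2, -1, - int N, int n + 1) = (\<lambda>z. 0)"
    by (simp add: slash_slash defect_slash_1 del: slash.simps)
  then show ?thesis using K_iff_defect[OF G] by simp
qed

text \<open>If $N + 1 = qm$ and $\pm 1$ represent the reduced residues modulo $q$ and modulo $m$, then the twists
  by $c_q$ and $c_m$ involve the same two matrices and their inverses. Eliminating one of the two defects
  makes the other one invariant under an elliptic matrix of trace $4 / (N + 1) - 2$.\<close>

lemma K_pair:
  assumes qm: "q * m = N + 1" and q: "reduced_reps q {1, -1}" and m: "reduced_reps m {1, -1}"
    and nt: "real_of_int 4 / real (N + 1) \<notin> \<int>" and N4: "N > 3"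
  shows "(int q, -1, - int N, int m) \<in> K" "(int q, 1, int N, int m) \<in> K"
proof -
  define A :: imat where "A = (int q, -1, - int N, int m)"
  define B :: imat where "B = (int q, 1, int N, int m)"
  have qmi: "int q * int m = int N + 1" using qm by (metis of_nat_1 of_nat_add of_nat_mult)
  have G: "A \<in> Gamma0 N" "B \<in> Gamma0 N" unfolding A_def B_def using qmi by auto
  have "q \<noteq> 0" by (rule notI) (use qm in simp)
  moreover have "m \<noteq> 0" by (rule notI) (use qm in simp)
  ultimately have q0: "q \<noteq> 0" "m \<noteq> 0" .
  have cop: "coprime q N" "coprime m N"
    using qm by (metis coprime_Suc_left_nat Suc_eq_plus1 coprime_mult_left_iff)+
  have q1: "q \<ge> 1" "m \<ge> 1" using q0 by auto
  have mq: "1 + int N * a * a = int q * int m" "1 + int N * a * a = int m * int q" if "a \<in> {1, -1}" for a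
    using that qmi by (auto simp: mult.commute)
  have relq: "slash k (1, 1 / q, 0, 1) (defect A) z + slash k (1, - 1 / q, 0, 1) (defect B) z = 0" for z
    using defect_relation[of q "{1, -1}" "\<lambda>a. a" "\<lambda>_. int m" z, OF q1(1) cop(1) _ q _ _ mq(1)] q unfolding A_def B_def
    by (simp del: slash.simps add: add.commute)
  \<comment> \<open>The inverses carry m in the upper left corner: they are the two matrices that
    belong to the twist by c_m.\<close>
  have iA: "iinv A = (int m, 1, int N, int q)" and iB: "iinv B = (int m, -1, - int N, int q)"
    unfolding A_def B_def by simp_all
  have relm: "slash k (1, 1 / m, 0, 1) (defect (iinv B)) z + slash k (1, - 1 / m, 0, 1) (defect (iinv A)) z = 0" for z
    using defect_relation[of m "{1, -1}" "\<lambda>a. a" "\<lambda>_. int q" z, OF q1(2) cop(2) _ m _ _ mq(2)] m unfolding iA iB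
    by (simp del: slash.simps add: add.commute)
  have 1: "defect B = (\<lambda>z. - slash k (1, 2 / q, 0, 1) (defect A) z)"
  proof -
    have "slash k (1, - 1 / q, 0, 1) (defect B) = (\<lambda>z. - slash k (1, 1 / q, 0, 1) (defect A) z)"
      using relq by (auto simp: fun_eq_iff eq_neg_iff_add_eq_0 add.commute simp del: slash.simps)
    then have "slash k (1, 1 / q, 0, 1) (slash k (1, - 1 / q, 0, 1) (defect B)) =
        (\<lambda>z. - slash k (1, 1 / q, 0, 1) (slash k (1, 1 / q, 0, 1) (defect A)) z)"
      by (simp only: slash_minus)
    then show ?thesis by (simp add: slash_slash defect_slash_1 del: slash.simps)
  qed
  have xm: "\<xi> (int m) \<noteq> 0" using cop xi_0_iff by simp
  \<comment> \<open>Both terms of the relation for m carry the factor \<xi>(m). It cancels, which is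
    why the eigenvalue will be 1.\<close>
  have "slash k (1, 1 / m, 0, 1) (slash k (rmat (iinv B)) (defect B)) z = - slash k (1, - 1 / m, 0, 1) (slash k (rmat (iinv A)) (defect A)) z" for z
  proof -
    have cancel: "x = - y" if "- (c * x) + - (c * y) = 0" "c \<noteq> 0" for c x y :: complex
    proof -
      have "c * (x + y) = - (- (c * x) + - (c * y))" by (simp add: distrib_left)
      then have "c * (x + y) = 0" unfolding that(1) by simp
      then show ?thesis using that(2) by (simp add: eq_neg_iff_add_eq_0)
    qed
    have "- (\<xi> (int m) * slash k (1, 1 / m, 0, 1) (slash k (rmat (iinv B)) (defect B)) z) +
        - (\<xi> (int m) * slash k (1, - 1 / m, 0, 1) (slash k (rmat (iinv A)) (defect A)) z) = 0"
      using relm[of z] unfolding defect_inv[OF G(1)] defect_inv[OF G(2)] act_def' slash_minus slash_mult_left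
      unfolding iA iB fst_conv .
    then show ?thesis by (rule cancel) (rule xm)
  qed
  then have 2: "slash k (1, 1 / m, 0, 1) (slash k (rmat (iinv B)) (defect B)) = (\<lambda>z. - slash k (1, - 1 / m, 0, 1) (slash k (rmat (iinv A)) (defect A)) z)"
    by blast
  have d: "mdet (rmat (iinv A)) > 0" "mdet (rmat (iinv B)) > 0" "mdet (rmat A) > 0"
    using mdet_rmat G iinv_Gamma0 by (metis zero_less_one)+
  have 3: "slash k (mmul (mmul (1, 2 / q, 0, 1) (rmat (iinv B))) (1, 1 / m, 0, 1)) (defect A) =
      slash k (mmul (rmat (iinv A)) (1, - 1 / m, 0, 1)) (defect A)"
    using 2 unfolding 1 slash_minus using d by (simp add: slash_slash fun_eq_iff del: slash.simps rmat.simps mmul.simps iinv.simps)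
  \<comment> \<open>Slashing \<open>3\<close> with the inverse of the matrix on its right-hand side
    leaves the defect of A there; M is what arises on the left.\<close>
  define M where "M = mmul (mmul (mmul (mmul (1, 2 / q, 0, 1) (rmat (iinv B))) (1, 1 / m, 0, 1)) (1, 1 / m, 0, 1)) (rmat A)"
  have "slash k (rmat A) (slash k (1, 1 / m, 0, 1) (slash k (mmul (mmul (1, 2 / q, 0, 1) (rmat (iinv B))) (1, 1 / m, 0, 1)) (defect A))) =
      slash k (rmat A) (slash k (1, 1 / m, 0, 1) (slash k (mmul (rmat (iinv A)) (1, - 1 / m, 0, 1)) (defect A)))"
    unfolding 3 ..
  moreover have "mmul (mmul (mmul (rmat (iinv A)) (1, - 1 / m, 0, 1)) (1, 1 / m, 0, 1)) (rmat A) = (1, 0, 0, 1)"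
  proof -
    have "real q * real m = real N + 1" using qm by (metis of_nat_1 of_nat_add of_nat_mult)
    then show ?thesis unfolding iA unfolding A_def by (simp add: algebra_simps)
  qed
  ultimately have inv: "slash k M (defect A) = defect A"
    unfolding M_def using d by (simp add: slash_slash defect_slash_1 del: slash.simps rmat.simps mmul.simps iinv.simps)
  obtain a b c e where M: "M = (a, b, c, e)" by (cases M)
  have qmr: "real q * real m = real N + 1" using qm by (metis of_nat_1 of_nat_add of_nat_mult)
  have rq0: "real q \<noteq> 0" "real m \<noteq> 0" using q0 by auto
  have "fst M = real q * real m - 5 * real N + 4 * (real N)\<^sup>2 / (real q * real m)"
    "snd (snd (snd M)) = real q * real m - real N"
    unfolding M_def iB unfolding A_def using rq0 by (simp_all add: field_simps power2_eq_square)
  then have ae: "a = real q * real m - 5 * real N + 4 * (real N)\<^sup>2 / (real q * real m)" "e = real q * real m - real N"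
    unfolding M by simp_all
  have N1: "real N + 1 > 0" by simp
  \<comment> \<open>Since q m = N + 1, the trace does not depend on the factorisation.\<close>
  have tr: "a + e = 4 / (real N + 1) - 2"
    unfolding ae qmr using N1 by (simp add: field_simps power2_eq_square)
  have det: "a * e - b * c = 1"
  proof -
    have dm: "mdet (mmul X Y) = mdet X * mdet Y" for X Y by (cases X; cases Y) (simp add: algebra_simps)
    have "mdet M = 1" unfolding M_def dm using mdet_rmat[OF G(1)] mdet_rmat[OF iinv_Gamma0[OF G(2)]] by simp
    then show ?thesis unfolding M by simp
  qed
  have A_K: "A \<in> K"
  proof (rule defect_elliptic[OF G(1) det])
    have "4 / (real N + 1) > 0" "4 / (real N + 1) < 4" using N4 by (auto simp: field_simps)
    then show "\<bar>a + e\<bar> < 2" unfolding tr by linarith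
    show "a + e \<in> \<rat>" unfolding tr by simp
    show "a + e \<notin> \<int>"
    proof
      assume "a + e \<in> \<int>"
      then have "(a + e) + 2 \<in> \<int>" by (rule Ints_add) simp
      then show False using nt unfolding tr by (simp add: add.commute)
    qed
    show "slash k (a, b, c, e) (defect A) = (\<lambda>z. 1 * defect A z)" using inv unfolding M by (simp del: slash.simps)
  qed simp
  moreover have "B \<in> K"
    unfolding K_iff_defect[OF G(2)] 1 using A_K K_iff_defect[OF G(1)] by (simp add: slash_zero del: slash.simps)
  ultimately show "(int q, -1, - int N, int m) \<in> K" "(int q, 1, int N, int m) \<in> K"
    unfolding A_def B_def by auto
qed

text \<open>A Euclidean descent on the lower left entry: multiplying a matrix with bottom row (c, d)
  on the right by the inverse of an element of K with bottom row (c', d') replaces c by c d' - c' d.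
  Translations first normalise d. The assumption says that d / c is at distance less than 1 / |c'|
  from d' / c'.\<close>

lemma Gamma0_subset_K:
  assumes cover: "\<And>c d. c > 0 \<Longrightarrow> int N dvd c \<Longrightarrow> coprime c d \<Longrightarrow> \<bar>2 * d\<bar> \<le> c \<Longrightarrow>
      \<exists>c' d'. row c' d' \<and> \<bar>c * d' - c' * d\<bar> < c"
  shows "A \<in> Gamma0 N \<Longrightarrow> A \<in> K"
proof -
  have main: "row c d" if "(a, b, c, d) \<in> Gamma0 N" for a b c d
    using that
  proof (induction "nat \<bar>c\<bar>" arbitrary: a b c d rule: less_induct)
    case less
    have step: "row c d" if c: "c > 0" and G: "(a, b, c, d) \<in> Gamma0 N"
      and IH: "\<And>a' b' c' d'. nat \<bar>c'\<bar> < nat \<bar>c\<bar> \<Longrightarrow> (a', b', c', d') \<in> Gamma0 N \<Longrightarrow> row c' d'" for a b c d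
    proof -
      \<comment> \<open>The integer nearest to d / c, so that the remainder e satisfies |2 e| \<le>
        c.\<close>
      define n where "n = (2 * d + c) div (2 * c)"
      define e where "e = d - n * c"
      have e: "\<bar>2 * e\<bar> \<le> c"
      proof -
        have "2 * d + c = (2 * c) * n + (2 * d + c) mod (2 * c)" unfolding n_def by simp
        moreover have "0 \<le> (2 * d + c) mod (2 * c)" "(2 * d + c) mod (2 * c) < 2 * c" using c by auto
        ultimately show ?thesis unfolding e_def by (simp add: algebra_simps)
      qed
      have Ge: "(a, b - n * a, c, e) \<in> Gamma0 N" using G unfolding e_def by (simp add: algebra_simps)
      have "coprime c e"
      proof (rule coprimeI)
        fix x assume "x dvd c" "x dvd e"
        then have "x dvd a * e - (b - n * a) * c" by (intro dvd_diff dvd_mult) auto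
        then show "is_unit x" using Ge by simp
      qed
      then obtain c' d' where r: "row c' d'" and lt: "\<bar>c * d' - c' * e\<bar> < c"
        using cover[OF c _ _ e] G by auto
      then obtain a' b' where K': "(a', b', c', d') \<in> K" unfolding row_def by blast
      have G': "(a', b', c', d') \<in> Gamma0 N" using K_Gamma0[OF K'] .
      have prod: "(a * d' + (b - n * a) * (- c'), a * (- b') + (b - n * a) * a', c * d' + e * (- c'), c * (- b') + e * a') \<in> Gamma0 N"
        using imul_Gamma0[OF Ge iinv_Gamma0[OF G']] unfolding iinv.simps imul.simps .
      have "row (c * d' + e * (- c')) (c * (- b') + e * a')"
        by (rule IH[OF _ prod]) (use lt c in \<open>simp add: mult.commute\<close>)
      \<comment> \<open>Multiplying back by the element of K recovers the bottom row (c, e).\<close>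
      from row_mult[OF this r G']
      have "row ((c * d' - e * c') * a' + (- (c * b') + e * a') * c') ((c * d' - e * c') * b' + (- (c * b') + e * a') * d')"
        by simp
      moreover have "(c * d' - e * c') * a' + (- (c * b') + e * a') * c' = c * (a' * d' - b' * c')"
        by (simp add: algebra_simps)
      moreover have "(c * d' - e * c') * b' + (- (c * b') + e * a') * d' = e * (a' * d' - b' * c')"
        by (simp add: algebra_simps)
      ultimately have "row c e" using G' by simp
      from row_shift[OF this, of n] show ?thesis unfolding e_def by simp
    qed
    consider "c = 0" | "c > 0" | "c < 0" by linarith
    then show ?case
    proof cases
      case 1
      then have "a * d = 1" using less.prems by simp
      then have "d = 1 \<or> d = -1" by (auto simp: zmult_eq_1_iff)
      then show ?thesis using 1 rowI[OF K_T[of 0]] rowI[OF K_neg] by auto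
    next
      case 2
      show ?thesis by (rule step[OF 2 less.prems less.hyps])
    next
      case 3
      have "row (- c) (- d)"
        by (rule step[of "-c" "-a" "-b" "-d"]) (use 3 less in auto)
      then show ?thesis by (simp add: row_neg_iff)
    qed
  qed
  show "A \<in> Gamma0 N \<Longrightarrow> A \<in> K" using main K_iff_row by (cases A) blast
qed

end

section \<open>Generators for the individual levels\<close>

lemma fraction_notin_Ints:
  assumes "\<not> q dvd p" "q \<noteq> 0"
  shows "real_of_int p / real_of_int q \<notin> \<int>"
proof
  assume "real_of_int p / real_of_int q \<in> \<int>"
  then obtain n where n: "real_of_int p / real_of_int q = of_int n" by (auto elim: Ints_cases)
  then have "real_of_int p = of_int (n * q)" using assms(2) by (simp add: field_simps)
  then have "p = n * q" by (simp only: of_int_eq_iff)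
  then show False using assms(1) by simp
qed

context ramanujan_twists
begin

text \<open>For the two surviving terms of a relation, once both are expressed through the same
  defect. Undoing P makes this defect an eigenfunction of the elliptic matrix Q P', with eigenvalue
  \<xi>(m) / \<xi>(n).\<close>

lemma defect_two_term:
  assumes A: "A \<in> Gamma0 N" and eq: "\<And>z. \<xi> m * slash k P (defect A) z = \<xi> n * slash k Q (defect A) z"
    and mn: "coprime m (int N)" "coprime n (int N)"
    and P: "mmul P P' = (1, 0, 0, 1)" "mdet P' > 0" and Q: "mmul Q P' = (a, b, c, d)"
    and t: "a * d - b * c = 1" "\<bar>a + d\<bar> < 2" "a + d \<in> \<rat>" "a + d \<notin> \<int>"
  shows "A \<in> K"
proof -
  have x0: "\<xi> m \<noteq> 0" "\<xi> n \<noteq> 0" using mn xi_0_iff by auto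
  have "slash k P' (\<lambda>z. \<xi> m * slash k P (defect A) z) = slash k P' (\<lambda>z. \<xi> n * slash k Q (defect A) z)"
    using eq by presburger
  then have "(\<lambda>z. \<xi> m * defect A z) = (\<lambda>z. \<xi> n * slash k (a, b, c, d) (defect A) z)"
    unfolding slash_mult_left slash_slash[OF P(2)] P(1) Q defect_slash_1 .
  then have eig: "slash k (a, b, c, d) (defect A) = (\<lambda>z. (\<xi> m / \<xi> n) * defect A z)"
    using x0 by (auto simp: fun_eq_iff field_simps simp del: slash.simps)
  show ?thesis
    by (rule defect_elliptic[OF A t eig]) (simp add: power_divide xi_root_of_unity mn)
qed

lemma row_U: "row (int N) 1" "row (int N) (-1)"
  using rowI[OF K_U] rowI[OF K_inv[OF K_U, unfolded iinv.simps]] row_neg_iff[of "int N" "-1"] by auto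

text \<open>Changing the sign of d alone is not an evident symmetry of \<open>row\<close>, so each
  sign has its own derivation: (N, 2) and (N, n) come from the matrix for q = 2 by inversion and
  translation, (N, -2) from a product with a lower triangular matrix, (N, -n) from that by
  inversion.\<close>

lemma rows_2:
  assumes n: "int N = 2 * n + 1"
  shows "row (int N) 2" "row (int N) (-2)" "row (int N) n" "row (int N) (-n)"
proof -
  have "n \<ge> 0" using n by linarith
  then have "N = 2 * nat n + 1" using n by linarith
  from K_twist_2[OF this] have *: "(2, -1, - int N, n + 1) \<in> K" using \<open>n \<ge> 0\<close> by simp
  show r2: "row (int N) 2" using rowI[OF K_inv[OF *, unfolded iinv.simps]] by simp
  have "row (- int N) (n + 1 + 1 * (- int N))" by (intro row_shift rowI[OF *])
  then have "row (- int N) (- n)" using n by simp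
  then show "row (int N) n" by (simp only: row_neg_iff)
  have "row (int N * 1 + 2 * (- int N)) (int N * 0 + 2 * 1)"
    by (rule row_mult[OF r2]) (use row_U(2) row_neg_iff[of "int N" "-1"] in auto)
  then have "row (- int N) (- (- 2))" by simp
  then show r2': "row (int N) (-2)" by (simp only: row_neg_iff)
  have "(n, -1, int N, -2) \<in> Gamma0 N" using n by simp
  from row_inv'[OF r2' this] show "row (int N) (- n)" .
qed

text \<open>These are the bottom rows, up to a common sign, of the two matrices of
  \<open>K_pair\<close> and of their inverses.\<close>

lemma rows_pair:
  assumes "int q * int m = int N + 1" "reduced_reps q {1, -1}" "reduced_reps m {1, -1}"
    "\<not> int N + 1 dvd 4" "int N > 3"
  shows "row (int N) (int m)" "row (int N) (- int m)" "row (int N) (int q)" "row (int N) (- int q)"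
proof -
  have "real_of_int 4 / real_of_int (int N + 1) \<notin> \<int>" by (rule fraction_notin_Ints) (use assms(4) in auto)
  then have nt: "real_of_int 4 / real (N + 1) \<notin> \<int>" by (simp add: add.commute)
  have "int (q * m) = int (N + 1)" using assms(1) by simp
  then have qm: "q * m = N + 1" by (simp only: of_nat_eq_iff)
  have N3: "N > 3" using assms(5) by linarith
  note * = K_pair[OF qm assms(2,3) nt N3]
  show "row (int N) (int m)" by (rule rowI[OF *(2)])
  show "row (int N) (- int m)" using rowI[OF *(1)] row_neg_iff[of "int N" "- int m"] by simp
  show "row (int N) (int q)" using rowI[OF K_inv[OF *(1), unfolded iinv.simps]] by simp
  show "row (int N) (- int q)" using rowI[OF K_inv[OF *(2), unfolded iinv.simps]] row_neg_iff[of "int N" "- int q"] by simp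
qed

text \<open>With c = v t, the equation d = j t means d / c = j / v, which is impossible in lowest
  terms when v and j have a common factor. In this way the common end points of neighbouring
  intervals are ruled out.\<close>

lemma coprime_multiple_excluded:
  fixes v j t d :: int
  assumes "coprime (v * t) d" "\<not> coprime v j"
  shows "d \<noteq> j * t"
  using assms by auto

lemma integer_circle_cover:
  fixes t d n :: int
  assumes t: "t > 0" and d: "d \<noteq> 0" "\<bar>2 * d\<bar> \<le> (2 * n + 1) * t" and n: "n \<ge> 1"
  shows "\<exists>j. j \<noteq> 0 \<and> \<bar>j\<bar> \<le> n \<and> \<bar>t * j - d\<bar> < t"
proof -
  have pos: "\<exists>j. j \<noteq> 0 \<and> \<bar>j\<bar> \<le> n \<and> \<bar>t * j - x\<bar> < t" if x: "x > 0" "2 * x \<le> (2 * n + 1) * t" for x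
  proof (cases "x < t")
    case True
    then show ?thesis using x n by (intro exI[of _ 1]) auto
  next
    case False
    define j where "j = x div t"
    have r: "x = t * j + x mod t" "0 \<le> x mod t" "x mod t < t" unfolding j_def using t by auto
    have "j > 0" unfolding j_def using False t by (simp add: pos_imp_zdiv_pos_iff)
    have "t * (2 * j) \<le> t * (2 * n + 1)" using r x(2) by (simp add: algebra_simps)
    then have "j \<le> n" using t by (simp add: mult_le_cancel_left)
    moreover have "\<bar>t * j - x\<bar> < t" using r by linarith
    ultimately show ?thesis using \<open>j > 0\<close> by (intro exI[of _ j]) auto
  qed
  show ?thesis
  proof (cases "d > 0")
    case True
    then show ?thesis using pos[of d] d by simp
  next
    case False
    then obtain j where "j \<noteq> 0" "\<bar>j\<bar> \<le> n" "\<bar>t * j - (- d)\<bar> < t" using pos[of "- d"] d by auto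
    then show ?thesis by (intro exI[of _ "- j"]) auto
  qed
qed

text \<open>In each of the following cases the Ford circles of radius $1 / c'$ around $d' / c'$, for the rows
  $(c', d')$ at hand, cover the interval $[-1/2, 1/2]$ up to cusps that are not equivalent to infinity.\<close>

lemma all_rows_cover:
  assumes n: "int N = 2 * n + 1" "n \<ge> 1" and r: "\<And>j. j \<noteq> 0 \<Longrightarrow> \<bar>j\<bar> \<le> n \<Longrightarrow> row (int N) j" and A: "A \<in> Gamma0 N"
  shows "A \<in> K"
proof (rule Gamma0_subset_K[OF _ A])
  fix c d :: int assume c: "c > 0" "int N dvd c" "coprime c d" "\<bar>2 * d\<bar> \<le> c"
  then obtain t where t: "c = int N * t" by blast
  have N0: "int N > 0" using n by linarith
  have t0: "t > 0" using c(1) N0 unfolding t by (simp add: zero_less_mult_iff)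
  have "\<not> coprime (int N) 0" using n by simp
  then have d0: "d \<noteq> 0" using coprime_multiple_excluded[of "int N" t d 0] c(3) t by simp
  obtain j where j: "j \<noteq> 0" "\<bar>j\<bar> \<le> n" "\<bar>t * j - d\<bar> < t"
    using integer_circle_cover[OF t0 d0 _ n(2)] c(4) unfolding t n(1) by blast
  have "\<bar>c * j - int N * d\<bar> = int N * \<bar>t * j - d\<bar>"
  proof -
    have "c * j - int N * d = int N * (t * j - d)" unfolding t by (simp add: algebra_simps)
    then show ?thesis by (simp add: abs_mult)
  qed
  also have "\<dots> < int N * t" using j(3) N0 by simp
  finally show "\<exists>c' d'. row c' d' \<and> \<bar>c * d' - c' * d\<bar> < c" using r[OF j(1,2)] unfolding t by blast
qed

lemma Gamma0_subset_K_level_1: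
  assumes Ni: "int N = 1" and A: "A \<in> Gamma0 N"
  shows "A \<in> K"
proof (rule Gamma0_subset_K[OF _ A])
  fix c d :: int assume c: "c > 0" "\<bar>2 * d\<bar> \<le> c"
  note r = row_U[unfolded Ni]
  have r0: "row 1 0" using row_shift[OF r(1), of "-1"] by simp
  have "\<bar>c * 1 - 1 * d\<bar> < c \<or> \<bar>c * (-1) - 1 * d\<bar> < c \<or> \<bar>c * 0 - 1 * d\<bar> < c" using c by linarith
  then show "\<exists>c' d'. row c' d' \<and> \<bar>c * d' - c' * d\<bar> < c" using r r0 by blast
qed

lemma Gamma0_subset_K_level_2_3_4:
  assumes Ni: "int N \<in> {2, 3, 4}" and A: "A \<in> Gamma0 N"
  shows "A \<in> K"
proof (rule Gamma0_subset_K[OF _ A])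
  fix c d :: int assume c: "c > 0" "int N dvd c" "coprime c d" "\<bar>2 * d\<bar> \<le> c"
  then obtain t where t: "c = int N * t" by blast
  have ex: "\<not> coprime (int N) j \<Longrightarrow> d \<noteq> j * t" for j using coprime_multiple_excluded c(3) t by blast
  have "d \<noteq> 0" using ex[of 0] Ni by auto
  \<comment> \<open>The interval around 1 / N reaches from 0 to 2 / N. Only for N = 4 does it end
    within the range, at the excluded cusp 1 / 2.\<close>
  moreover have "int N = 4 \<longrightarrow> d \<noteq> 2 * t \<and> d \<noteq> -2 * t" using ex[of 2] ex[of "-2"] by (auto simp: coprime_iff_gcd_eq_1)
  ultimately have "\<bar>c * 1 - int N * d\<bar> < c \<or> \<bar>c * (-1) - int N * d\<bar> < c"
    using c Ni unfolding t by auto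
  then show "\<exists>c' d'. row c' d' \<and> \<bar>c * d' - c' * d\<bar> < c" using row_U by blast
qed

lemma Gamma0_subset_K_level_5:
  assumes Ni: "int N = 5" and A: "A \<in> Gamma0 N"
  shows "A \<in> K"
proof (rule all_rows_cover[of 2, OF _ _ _ A])
  fix j :: int assume "j \<noteq> 0" "\<bar>j\<bar> \<le> 2"
  then have "j \<in> {1, -1, 2, -2}" unfolding insert_iff empty_iff by presburger
  then show "row (int N) j"
    unfolding Ni using row_U[unfolded Ni] rows_2[of 2, unfolded Ni, simplified] by auto
qed (use Ni in auto)

lemma Gamma0_subset_K_level_7:
  assumes Ni: "int N = 7" and A: "A \<in> Gamma0 N"
  shows "A \<in> K"
proof (rule all_rows_cover[of 3, OF _ _ _ A])
  fix j :: int assume "j \<noteq> 0" "\<bar>j\<bar> \<le> 3"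
  then have "j \<in> {1, -1, 2, -2, 3, -3}" unfolding insert_iff empty_iff by presburger
  then show "row (int N) j"
    unfolding Ni using row_U[unfolded Ni] rows_2[of 3, unfolded Ni, simplified] by auto
qed (use Ni in auto)

lemma Gamma0_subset_K_level_9:
  assumes Ni: "int N = 9" and A: "A \<in> Gamma0 N"
  shows "A \<in> K"
proof (rule Gamma0_subset_K[OF _ A])
  fix c d :: int assume c: "c > 0" "int N dvd c" "coprime c d" "\<bar>2 * d\<bar> \<le> c"
  then obtain t where t: "c = 9 * t" unfolding Ni by blast
  have ex: "\<not> coprime 9 j \<Longrightarrow> d \<noteq> j * t" for j using coprime_multiple_excluded c(3) t by blast
  have "d \<noteq> 0" "d \<noteq> 3 * t" "d \<noteq> -3 * t" using ex[of 0] ex[of 3] ex[of "-3"] by (auto simp: coprime_iff_gcd_eq_1)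
  \<comment> \<open>In units of 1 / 9 the positive j give the intervals (0, 2), (1, 3), (3, 5),
    which leave out only 0 and 3 up to 9 / 2.\<close>
  then have "\<exists>j\<in>{1, -1, 2, -2, 4, -4}. \<bar>c * j - 9 * d\<bar> < c"
    using c(1,4) unfolding t by auto
  moreover have "row 9 j" if "j \<in> {1, -1, 2, -2, 4, -4}" for j
    using that row_U[unfolded Ni] rows_2[of 4, unfolded Ni] by auto
  ultimately show "\<exists>c' d'. row c' d' \<and> \<bar>c * d' - c' * d\<bar> < c" by blast
qed

lemma Gamma0_subset_K_level_8:
  assumes Ni: "int N = 8" and A: "A \<in> Gamma0 N"
  shows "A \<in> K"
proof (rule Gamma0_subset_K[OF _ A])
  fix c d :: int assume c: "c > 0" "int N dvd c" "coprime c d" "\<bar>2 * d\<bar> \<le> c"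
  then obtain t where t: "c = 8 * t" unfolding Ni by blast
  have ex: "\<not> coprime 8 j \<Longrightarrow> d \<noteq> j * t" for j using coprime_multiple_excluded c(3) t by blast
  have "d \<noteq> 0" "d \<noteq> 2 * t" "d \<noteq> -2 * t" "d \<noteq> 4 * t" "d \<noteq> -4 * t"
    using ex[of 0] ex[of 2] ex[of "-2"] ex[of 4] ex[of "-4"] by (auto simp: coprime_iff_gcd_eq_1)
  \<comment> \<open>In units of 1 / 8 the positive j give the intervals (0, 2) and (2, 4), whose end
    points are excluded.\<close>
  then have "\<exists>j\<in>{1, -1, 3, -3}. \<bar>c * j - 8 * d\<bar> < c"
    using c(1,4) unfolding t by auto
  moreover have "row 8 j" if "j \<in> {1, -1, 3, -3}" for j
    using that row_U[unfolded Ni] rows_pair[of 3 3, OF _ reduced_reps_3 reduced_reps_3, unfolded Ni] by auto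
  ultimately show "\<exists>c' d'. row c' d' \<and> \<bar>c * d' - c' * d\<bar> < c" by blast
qed

lemma Gamma0_subset_K_level_11:
  assumes Ni: "int N = 11" and A: "A \<in> Gamma0 N"
  shows "A \<in> K"
proof (rule all_rows_cover[of 5, OF _ _ _ A])
  fix j :: int assume "j \<noteq> 0" "\<bar>j\<bar> \<le> 5"
  then have "j \<in> {1, -1, 2, -2, 3, -3, 4, -4, 5, -5}" unfolding insert_iff empty_iff by presburger
  then show "row (int N) j"
    unfolding Ni using row_U[unfolded Ni] rows_2[of 5, unfolded Ni, simplified] rows_pair[of 3 4, OF _ reduced_reps_3 reduced_reps_4, unfolded Ni, simplified] by auto
qed (use Ni in auto)

lemma Gamma0_subset_K_level_17:
  assumes Ni: "int N = 17" and A: "A \<in> Gamma0 N"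
  shows "A \<in> K"
proof (rule all_rows_cover[of 8, OF _ _ _ A])
  note r1 = row_U[unfolded Ni, simplified]
  note r2 = rows_2[of 8, unfolded Ni, simplified]
  note r3 = rows_pair[of 3 6, OF _ reduced_reps_3 reduced_reps_6, unfolded Ni, simplified]
  have G: "(a, b, c, d) \<in> Gamma0 N" if "a * d - b * c = 1" "17 dvd c" for a b c d
    using that unfolding Gamma0_iff Ni by blast
  \<comment> \<open>In every product the upper left entry of the second factor is chosen so that, up
    to signs, it differs by 1 from the lower right entry of the first; the lower left entry is then
    again 17 or -17. The entry of the new row is the lower right one.\<close>
  have m5: "row 17 (-5)"
    using row_mult[OF r2(1) row_neg[OF r3(2), simplified] G[where a = 3 and b = "-1"]] by simp
  have p5: "row 17 5"
    using row_mult[OF r2(2) row_neg[OF r3(1)] G[where a = "-3" and b = "-1"]] row_neg[of "-17" "-5"] by simp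
  have m7: "row 17 (-7)" using row_inv'[OF p5 G[where a = 7 and b = 2]] by simp
  have p7: "row 17 7" using row_inv'[OF m5 G[where a = "-7" and b = 2]] by simp
  have p4: "row 17 4"
    using row_mult[OF m7 r3(3) G[where a = 6 and b = 1]] row_neg[of "-17" "-4"] by simp
  have m4: "row 17 (-4)"
    using row_mult[OF p7 r3(4) G[where a = "-6" and b = 1]] by simp
  fix j :: int assume "j \<noteq> 0" "\<bar>j\<bar> \<le> 8"
  then have "j \<in> {1, -1, 2, -2, 3, -3, 4, -4, 5, -5, 6, -6, 7, -7, 8, -8}" unfolding insert_iff empty_iff by presburger
  then show "row (int N) j" unfolding Ni using r1 r2 r3 m5 p5 m7 p7 m4 p4 by auto
qed (use Ni in auto)

text \<open>At the levels 6, 15 and 23 one generator \<open>X\<close> is still missing. In the relation for $q = 5$, $8$ and $3$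
  respectively, two terms survive, and they come from \<open>X\<close> and its inverse up to factors in \<open>K\<close>.\<close>

lemma Gamma0_subset_K_level_6:
  assumes Ni: "int N = 6" and A: "A \<in> Gamma0 N"
  shows "A \<in> K"
proof (rule Gamma0_subset_K[OF _ A])
  \<comment> \<open>The rows (6, 1) and (6, -1) reach the cusps between 0 and 1 / 3 in absolute
    value. The row (12, 5) of the inverse of X fills the gap from 1 / 3 to 1 / 2, and the row (-12,
    5) of X its mirror image.\<close>
  define X :: imat where "X = (5, -2, -12, 5)"
  have X: "X \<in> Gamma0 N" unfolding X_def Gamma0_iff Ni by simp
  have iX: "iinv X = (5, 2, 12, 5)" unfolding X_def by simp
  have G: "(a, b, c, d) \<in> Gamma0 N" if "a * d - b * c = 1" "6 dvd c" for a b c d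
    using that unfolding Gamma0_iff Ni by blast
  note r1 = row_U[unfolded Ni, simplified]
  have "(5, -1, 6, -1) \<in> K" "(5, 1, -6, -1) \<in> K"
    using K_iff_row[OF G[where a = 5 and b = "-1" and c = 6 and d = "-1"]] K_iff_row[OF G[where a = 5 and b = 1 and c = "-6" and d = "-1"]] r1(2) row_neg[OF r1(1)] by simp_all
  then have k: "defect (5, -1, 6, -1) = (\<lambda>z. 0)" "defect (5, 1, -6, -1) = (\<lambda>z. 0)"
    using K_iff_defect K_Gamma0 by blast+
  have "coprime 5 (int N)" unfolding Ni by code_simp
  then have cop: "coprime 5 N" "coprime 5 (int N)" using coprime_int_iff[of 5 N] by auto
  \<comment> \<open>The condition is a b = -1 modulo 5, as 6 = 1 modulo 5. For a = 1, -1 the choice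
    b = -a gives the bottom rows (6, -1) and (-6, -1), already in K; for a = 2, -2 the choice b = a
    gives X and its inverse.\<close>
  define \<beta> :: "int \<Rightarrow> int" where "\<beta> a = (if \<bar>a\<bar> = 1 then - a else a)" for a
  define m :: "int \<Rightarrow> int" where "m a = (if \<bar>a\<bar> = 1 then - 1 else 5)" for a
  have \<beta>: "\<beta> ` {1, -1, 2, -2} = {1, -1, 2, -2}" "inj_on \<beta> {1, -1, 2, -2}" unfolding \<beta>_def by auto
  have rel: "slash k (1, 2 / 5, 0, 1) (defect X) z + slash k (1, - 2 / 5, 0, 1) (defect (iinv X)) z = 0" for z
  proof -
    have mm: "1 + int N * a * \<beta> a = int 5 * m a" if "a \<in> {1, -1, 2, -2}" for a
      using that Ni unfolding \<beta>_def m_def by auto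
    have "(\<Sum>a\<in>{1, -1, 2, -2}. slash k (1, of_int a / real 5, 0, 1) (defect (int 5, - a, - int N * \<beta> a, m a)) z) = 0"
      using defect_relation[of 5 "{1, -1, 2, -2}" \<beta> m z, OF _ cop(1) _ reduced_reps_5 \<beta>(2) _ mm] \<beta>(1) reduced_reps_5
      by (simp del: slash.simps)
    then show ?thesis
      unfolding Ni by (simp add: \<beta>_def m_def k slash_zero iX del: slash.simps) (simp add: X_def del: slash.simps)
  qed
  have "X \<in> K"
  proof (rule defect_two_term[OF X])
    show "\<xi> 1 * slash k (1, 2 / 5, 0, 1) (defect X) z = \<xi> 5 * slash k (mmul (5, 2, 12, 5) (1, - 2 / 5, 0, 1)) (defect X) z" for z
      using rel[of z] unfolding defect_inv[OF X] act_def' slash_minus slash_mult_left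
      by (simp add: iX slash_slash xi_1 del: slash.simps mmul.simps)
    show "mmul (1, 2 / 5, 0, 1) (1, - 2 / 5, 0, 1) = (1, 0, 0, 1)" by simp
    show "mmul (mmul (5, 2, 12, 5) (1, - 2 / 5, 0, 1)) (1, - 2 / 5, 0, 1) = (5, -2, 12, -23 / 5)" by simp
    show "5 + - 23 / 5 \<notin> (\<int> :: real set)" using fraction_notin_Ints[of 5 2] by simp
  qed (use cop in auto)
  then have "X \<in> K" "iinv X \<in> K" by (simp_all only: K_inv)
  then have r5: "row (-12) 5" "row 12 5" unfolding iX unfolding X_def by (simp_all only: rowI)
  then have r5': "row 12 (-5)" using row_neg_iff[of 12 "-5"] by simp
  fix c d :: int assume c: "c > 0" "int N dvd c" "coprime c d" "\<bar>2 * d\<bar> \<le> c"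
  then obtain t where t: "c = 6 * t" unfolding Ni by blast
  have ex: "\<not> coprime 6 j \<Longrightarrow> d \<noteq> j * t" for j using coprime_multiple_excluded c(3) t by blast
  have "d \<noteq> 0" "d \<noteq> 2 * t" "d \<noteq> -2 * t" "d \<noteq> 3 * t" "d \<noteq> -3 * t"
    using ex[of 0] ex[of 2] ex[of "-2"] ex[of 3] ex[of "-3"] by (auto simp: coprime_iff_gcd_eq_1)
  then have "\<bar>c * 1 - 6 * d\<bar> < c \<or> \<bar>c * (-1) - 6 * d\<bar> < c \<or> \<bar>c * 5 - 12 * d\<bar> < c \<or> \<bar>c * (-5) - 12 * d\<bar> < c"
    using c(1,4) unfolding t by auto
  then show "\<exists>c' d'. row c' d' \<and> \<bar>c * d' - c' * d\<bar> < c" using r1 r5 r5' by blast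
qed

lemma Gamma0_subset_K_level_15:
  assumes Ni: "int N = 15" and A: "A \<in> Gamma0 N"
  shows "A \<in> K"
proof (rule Gamma0_subset_K[OF _ A])
  \<comment> \<open>In units of 1 / 15 the rows (15, j) with j = 1, 2, 4, 7 leave a gap from 5 to 6,
    between the cusps 1 / 3 and 2 / 5. The row (30, 11) has centre 11 / 2 and radius 1 / 2 in these
    units and fills it.\<close>
  define X :: imat where "X = (11, 4, 30, 11)"
  have X: "X \<in> Gamma0 N" unfolding X_def Gamma0_iff Ni by simp
  have iX: "iinv X = (11, -4, -30, 11)" unfolding X_def by simp
  have G: "(a, b, c, d) \<in> Gamma0 N" if "a * d - b * c = 1" "15 dvd c" for a b c d
    using that unfolding Gamma0_iff Ni by blast
  note r1 = row_U[unfolded Ni, simplified]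
  note r2 = rows_2[of 7, unfolded Ni, simplified]
  note r4 = rows_pair[of 4 4, OF _ reduced_reps_4 reduced_reps_4, unfolded Ni, simplified]
  \<comment> \<open>Left multiplication by these elements takes the inverse of X and X to the
    matrices with bottom rows (-45, 17) and (45, 17), which are the terms a = 3 and a = -3 of the
    relation for q = 8.\<close>
  have kk: "(-2, -1, 15, 7) \<in> K" "(-2, 1, -15, 7) \<in> K"
    using K_iff_row[OF G[where a = "-2" and b = "-1" and c = 15 and d = 7]] K_iff_row[OF G[where a = "-2" and b = 1 and c = "-15" and d = 7]] r2(3) row_neg[OF r2(4)] by simp_all
  have "(8, -1, -15, 2) \<in> K" "(8, 1, 15, 2) \<in> K"
    using K_iff_row[OF G[where a = 8 and b = "-1" and c = "-15" and d = 2]] K_iff_row[OF G[where a = 8 and b = 1 and c = 15 and d = 2]] r2(1) row_neg[OF r2(2)] by simp_all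
  then have k: "defect (8, -1, -15, 2) = (\<lambda>z. 0)" "defect (8, 1, 15, 2) = (\<lambda>z. 0)"
    using K_iff_defect K_Gamma0 by blast+
  have g3: "defect (8, -3, -45, 17) = defect (iinv X)" "defect (8, 3, 45, 17) = defect X"
    using defect_mult[OF kk(1) iinv_Gamma0[OF X]] defect_mult[OF kk(2) X] unfolding iX by (simp_all add: X_def)
  have "coprime 8 (int N)" "coprime 11 (int N)" unfolding Ni by code_simp+
  then have cop: "coprime 8 N" "coprime 11 (int N)" using coprime_int_iff[of 8 N] by auto
  define m :: "int \<Rightarrow> int" where "m a = (if \<bar>a\<bar> = 1 then 2 else 17)" for a
  have rel: "slash k (1, 3 / 8, 0, 1) (defect (iinv X)) z + slash k (1, - 3 / 8, 0, 1) (defect X) z = 0" for z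
  proof -
    have mm: "1 + int N * a * a = int 8 * m a" if "a \<in> {1, -1, 3, -3}" for a
      using that Ni unfolding m_def by auto
    have "(\<Sum>a\<in>{1, -1, 3, -3}. slash k (1, of_int a / real 8, 0, 1) (defect (int 8, - a, - int N * a, m a)) z) = 0"
      using defect_relation[of 8 "{1, -1, 3, -3}" "\<lambda>a. a" m z, OF _ cop(1) _ reduced_reps_8 _ _ mm] reduced_reps_8
      by (simp del: slash.simps)
    then show ?thesis
      unfolding Ni by (simp add: m_def k g3 slash_zero del: slash.simps)
  qed
  have "X \<in> K"
  proof (rule defect_two_term[OF X])
    show "\<xi> 1 * slash k (1, - 3 / 8, 0, 1) (defect X) z = \<xi> 11 * slash k (mmul (11, -4, -30, 11) (1, 3 / 8, 0, 1)) (defect X) z" for z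
      using rel[of z] unfolding defect_inv[OF X] act_def' slash_minus slash_mult_left
      by (simp add: iX slash_slash xi_1 del: slash.simps mmul.simps)
    show "mmul (1, - 3 / 8, 0, 1) (1, 3 / 8, 0, 1) = (1, 0, 0, 1)" by simp
    show "mmul (mmul (11, -4, -30, 11) (1, 3 / 8, 0, 1)) (1, 3 / 8, 0, 1) = (11, 17 / 4, -30, - 23 / 2)" by simp
    show "11 + - 23 / 2 \<notin> (\<int> :: real set)" using fraction_notin_Ints[of 2 "-1"] by simp
  qed (use cop in auto)
  then have "X \<in> K" "iinv X \<in> K" by (simp_all only: K_inv)
  then have r11: "row 30 11" "row (-30) 11" unfolding iX unfolding X_def by (simp_all only: rowI)
  then have r11': "row 30 (-11)" using row_neg_iff[of 30 "-11"] by simp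
  fix c d :: int assume c: "c > 0" "int N dvd c" "coprime c d" "\<bar>2 * d\<bar> \<le> c"
  then obtain t where t: "c = 15 * t" unfolding Ni by blast
  have ex: "\<not> coprime 15 j \<Longrightarrow> d \<noteq> j * t" for j using coprime_multiple_excluded c(3) t by blast
  have "\<not> coprime (15::int) 6" "\<not> coprime (15::int) 3" "\<not> coprime (15::int) 5" by code_simp+
  then have d: "d \<noteq> 0" "d \<noteq> 3 * t" "d \<noteq> -3 * t" "d \<noteq> 5 * t" "d \<noteq> -5 * t" "d \<noteq> 6 * t" "d \<noteq> -6 * t"
    using ex[of 0] ex[of 3] ex[of "-3"] ex[of 5] ex[of "-5"] ex[of 6] ex[of "-6"] by auto
  have t0: "t > 0" using c(1) unfolding t by simp
  define P where "P x \<longleftrightarrow> \<bar>t * 1 - x\<bar> < t \<or> \<bar>t * 2 - x\<bar> < t \<or> \<bar>t * 4 - x\<bar> < t \<or> \<bar>t * 7 - x\<bar> < t \<or> \<bar>t * 11 - 2 * x\<bar> < t" for x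
  have cover: "P x" if x: "0 < x" "2 * x \<le> 15 * t" "x \<noteq> 3 * t" "x \<noteq> 5 * t" "x \<noteq> 6 * t" for x
  proof -
    \<comment> \<open>The break points 3 t, 5 t, 6 t are the excluded cusps 1 / 5, 1 / 3, 2 / 5; the
      cases are served by j = 1, 2, 4, by the row (30, 11), and by j = 7.\<close>
    consider "x < 2 * t" | "2 * t \<le> x" "x < 3 * t" | "3 * t < x" "x < 5 * t" | "5 * t < x" "x < 6 * t" | "6 * t < x"
      by atomize_elim (use x(3-5) in arith)
    then show ?thesis unfolding P_def by cases (use x t0 in \<open>simp_all add: abs_less_iff\<close>)
  qed
  have "2 * d \<le> 15 * t" "2 * (- d) \<le> 15 * t" using c(4) unfolding t by linarith+
  then have "P d \<or> P (- d)"
    using cover[of d] cover[of "- d"] d by (cases "d > 0") simp_all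
  then have "(\<exists>j\<in>{1, -1, 2, -2, 4, -4, 7, -7}. \<bar>c * j - 15 * d\<bar> < c) \<or> \<bar>c * 11 - 30 * d\<bar> < c \<or> \<bar>c * (-11) - 30 * d\<bar> < c"
    unfolding P_def t abs_less_iff by (elim disjE conjE) simp_all
  moreover have "row 15 j" if "j \<in> {1, -1, 2, -2, 4, -4, 7, -7}" for j
    using that r1 r2 r4 by auto
  ultimately show "\<exists>c' d'. row c' d' \<and> \<bar>c * d' - c' * d\<bar> < c" using r11 r11' by blast
qed

lemma Gamma0_subset_K_level_23:
  assumes Ni: "int N = 23" and A: "A \<in> Gamma0 N"
  shows "A \<in> K"
proof (rule all_rows_cover[of 11, OF _ _ _ A])
  \<comment> \<open>The factorisation 24 = 3 * 8 is not covered by \<open>rows_pair\<close>, since 8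
    has four reduced residues. The relation for q = 3 has two terms, belonging to the inverse of X
    and to (3, 1; 23, 8).\<close>
  define X :: imat where "X = (8, 1, 23, 3)"
  have X: "X \<in> Gamma0 N" unfolding X_def Gamma0_iff Ni by simp
  have iX: "iinv X = (3, -1, -23, 8)" unfolding X_def by simp
  have G: "(a, b, c, d) \<in> Gamma0 N" if "a * d - b * c = 1" "23 dvd c" for a b c d
    using that unfolding Gamma0_iff Ni by blast
  note r1 = row_U[unfolded Ni, simplified]
  note r2 = rows_2[of 11, unfolded Ni, simplified]
  note r4 = rows_pair[of 4 6, OF _ reduced_reps_4 reduced_reps_6, unfolded Ni, simplified]
  have k2: "(-2, -1, 23, 11) \<in> K" using K_iff_row[OF G[where a = "-2" and b = "-1" and c = 23 and d = 11]] r2(3) by simp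
  have "row 46 (-13)" using row_mult[OF r4(1) r4(2) G[where a = "-4" and b = 1]] by simp
  then have k: "(7, -2, 46, -13) \<in> K" using K_iff_row[OF G[where a = 7 and b = "-2" and c = 46 and d = "-13"]] by simp
  \<comment> \<open>The second matrix of the relation for q = 3 is X between two elements of K. The
    left one leaves the defect unchanged, the right one acts on it, so both terms are expressed
    through the defect of X.\<close>
  have B: "imul (7, -2, 46, -13) (imul X (-2, -1, 23, 11)) = (3, 1, 23, 8)" unfolding X_def by simp
  have Xk: "imul X (-2, -1, 23, 11) \<in> Gamma0 N" by (rule imul_Gamma0[OF X K_Gamma0[OF k2]])
  have dB: "defect (3, 1, 23, 8) = act (-2, -1, 23, 11) (defect X)"
    using defect_mult[OF k Xk] defect_mult_right[OF X k2] unfolding B by simp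
  have "coprime 3 (int N)" "coprime (-2) (int N)" unfolding Ni by code_simp+
  then have cop: "coprime 3 N" "coprime 3 (int N)" "coprime (-2) (int N)" using coprime_int_iff[of 3 N] by auto
  have rel: "slash k (1, 1 / 3, 0, 1) (defect (iinv X)) z + slash k (1, - 1 / 3, 0, 1) (defect (3, 1, 23, 8)) z = 0" for z
  proof -
    have mm: "1 + int N * a * a = int 3 * 8" if "a \<in> {1, -1}" for a
      using that Ni by auto
    have "(\<Sum>a\<in>{1, -1}. slash k (1, of_int a / real 3, 0, 1) (defect (int 3, - a, - int N * a, 8)) z) = 0"
      using defect_relation[of 3 "{1, -1}" "\<lambda>a. a" "\<lambda>_. 8" z, OF _ cop(1) _ reduced_reps_3 _ _ mm] reduced_reps_3
      by (simp del: slash.simps)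
    then show ?thesis unfolding Ni by (simp add: iX del: slash.simps)
  qed
  have XK: "X \<in> K"
  proof (rule defect_two_term[OF X])
    show "\<xi> (-2) * slash k (mmul (-2, -1, 23, 11) (1, - 1 / 3, 0, 1)) (defect X) z = \<xi> 3 * slash k (mmul (3, -1, -23, 8) (1, 1 / 3, 0, 1)) (defect X) z" for z
      using rel[of z] unfolding dB defect_inv[OF X] act_def' slash_minus slash_mult_left
      by (simp add: iX slash_slash del: slash.simps mmul.simps)
    \<comment> \<open>The matrix P' is the inverse of (-2, -1; 23, 11) times the translation by -1 /
      3.\<close>
    show "mmul (mmul (-2, -1, 23, 11) (1, - 1 / 3, 0, 1)) (10 / 3, 1 / 3, -23, -2) = (1, 0, 0, 1)" by simp
    show "mmul (mmul (3, -1, -23, 8) (1, 1 / 3, 0, 1)) (10 / 3, 1 / 3, -23, -2) = (10, 1, - 253 / 3, - 25 / 3)" by simp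
    show "10 + - 25 / 3 \<notin> (\<int> :: real set)" using fraction_notin_Ints[of 3 5] by simp
  qed (use cop in auto)
  then have p3: "row 23 3" unfolding X_def by (rule rowI)
  have m8: "row 23 (-8)" using row_inv'[OF p3 G[where a = 8 and b = 1]] by simp
  have "imul (7, -2, 46, -13) (imul X (-2, -1, 23, 11)) \<in> K" by (intro K_mult k XK k2)
  then have p8: "row 23 8" unfolding B by (rule rowI)
  have m3: "row 23 (-3)" using row_inv'[OF p8 G[where a = 3 and b = 1]] by simp
  \<comment> \<open>As at level 17, the factors are matched so that the lower left entry of each
    product is again 23 or -23.\<close>
  have p5: "row 23 5" using row_mult[OF m3 r4(1) G[where a = 4 and b = 1]] by simp
  have m5: "row 23 (-5)" using row_mult[OF p3 r4(2) G[where a = "-4" and b = 1]] row_neg[of "-23" 5] by simp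
  have p7: "row 23 7" using row_mult[OF r2(2) p8 G[where a = 3 and b = 1]] by simp
  have m7: "row 23 (-7)" using row_mult[OF r2(1) m8 G[where a = "-3" and b = 1]] row_neg[of "-23" 7] by simp
  have p9: "row 23 9" using row_mult[OF r4(4) p8 G[where a = 3 and b = 1]] row_neg[of "-23" "-9"] by simp
  have m9: "row 23 (-9)" using row_mult[OF r4(3) m8 G[where a = "-3" and b = 1]] by simp
  have p10: "row 23 10" using row_mult[OF p3 r2(3) G[where a = "-2" and b = "-1"]] by simp
  have m10: "row 23 (-10)" using row_mult[OF m3 r2(4) G[where a = 2 and b = "-1"]] row_neg[of "-23" 10] by simp
  fix j :: int assume "j \<noteq> 0" "\<bar>j\<bar> \<le> 11"
  then have "j \<in> {1, -1, 2, -2, 3, -3, 4, -4, 5, -5, 6, -6, 7, -7, 8, -8, 9, -9, 10, -10, 11, -11}" unfolding insert_iff empty_iff by presburger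
  then show "row (int N) j" unfolding Ni using r1 r2 r4 p3 m3 p5 m5 p7 m7 p8 m8 p9 m9 p10 m10 by auto
qed (use Ni in auto)

end

section \<open>Behaviour at the cusps\<close>

text \<open>The damping factor is exp(-\<epsilon> sqrt(-i z)). For Im z \<ge> 1 the number -i z has
  positive real part, so the real part of its root is at least sqrt(|z| / 2), and the factor decays
  faster than any power of |z|.\<close>

lemma phragmen_lindelof_upper_half_plane:
  fixes h :: "complex \<Rightarrow> complex"
  assumes h: "h holomorphic_on UH" and D: "D \<ge> 0"
    and growth: "\<And>z. Im z \<ge> 1 \<Longrightarrow> norm (h z) \<le> D * Im z ^ p" and z: "Im z \<ge> 1"
  shows "norm (h z) \<le> D + 1"
proof -
  define S where "S = {z. Im z \<ge> 1}"
  have clS: "closed S" unfolding S_def by (rule closed_halfspace_Im_ge)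
  have SU: "S \<subseteq> UH" unfolding S_def by auto
  have int: "{z. Im z > 1} \<subseteq> interior S"
    by (rule interior_maximal) (auto simp: S_def open_halfspace_Im_gt)
  let ?w = "\<lambda>\<epsilon> z. exp (- of_real \<epsilon> * csqrt (- \<i> * z))"
  have w_hol: "?w \<epsilon> holomorphic_on S" for \<epsilon>
  proof -
    have "(\<lambda>z. csqrt (- \<i> * z)) holomorphic_on S"
      by (rule holomorphic_on_csqrt') (auto intro!: holomorphic_intros simp: S_def complex_nonpos_Reals_iff)
    then have "(\<lambda>z. - of_real \<epsilon> * csqrt (- \<i> * z)) holomorphic_on S"
      by (rule holomorphic_on_mult[OF holomorphic_on_const])
    from holomorphic_on_compose[OF this holomorphic_on_exp] show ?thesis unfolding o_def .
  qed
  have w_norm: "norm (?w \<epsilon> z) \<le> exp (- (\<epsilon> * sqrt (norm z / 2)))" if "\<epsilon> > 0" "z \<in> S" for \<epsilon> z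
  proof -
    have "sqrt (norm z / 2) \<le> sqrt ((norm (- \<i> * z) + Re (- \<i> * z)) / 2)"
      using that unfolding S_def by (intro real_sqrt_le_mono divide_right_mono) (auto simp: norm_mult)
    also have "\<dots> = Re (csqrt (- \<i> * z))" by simp
    finally have "\<epsilon> * sqrt (norm z / 2) \<le> \<epsilon> * Re (csqrt (- \<i> * z))" using that by (intro mult_left_mono) auto
    then show ?thesis by (simp add: norm_exp del: csqrt.simps)
  qed
  show ?thesis
  proof (rule phragmen_lindelof_damped[of S h ?w])
    show "closed S" by (rule clS)
    show "continuous_on S h" using h SU holomorphic_on_imp_continuous_on holomorphic_on_subset by blast
    show "h holomorphic_on interior S" using h SU interior_subset by (meson holomorphic_on_subset subset_trans)
    show "continuous_on S (?w \<epsilon>)" for \<epsilon> by (rule holomorphic_on_imp_continuous_on[OF w_hol])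
    show "?w \<epsilon> holomorphic_on interior S" for \<epsilon> by (rule holomorphic_on_subset[OF w_hol interior_subset])
    show "norm (?w \<epsilon> z) \<le> 1" if "\<epsilon> > 0" "z \<in> S" for \<epsilon> z
      by (rule order.trans[OF w_norm[OF that]]) (use that in simp)
    show "((\<lambda>\<epsilon>. ?w \<epsilon> z) \<longlongrightarrow> 1) (at_right 0)" for z
    proof -
      have "((\<lambda>\<epsilon>. ?w \<epsilon> z) \<longlongrightarrow> exp (- of_real 0 * csqrt (- \<i> * z))) (at_right 0)" by (intro tendsto_intros)
      then show ?thesis by simp
    qed
    show "norm (h z) \<le> D + 1" if "z \<in> frontier S" for z
    proof -
      have "z \<in> S" "z \<notin> interior S" using that clS by (auto simp: frontier_def)
      then have "Im z = 1" using int unfolding S_def by force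
      then show ?thesis using growth[of z] by simp
    qed
    show "z \<in> S" using z unfolding S_def by simp
    show "\<exists>r. \<forall>z\<in>S. norm z \<ge> r \<longrightarrow> norm (h z * ?w \<epsilon> z) \<le> D + 1" if \<epsilon>: "\<epsilon> > 0" for \<epsilon>
    proof -
      \<comment> \<open>From exp(-x) \<le> (2 p + 2)! / x^(2 p + 2) at x = \<epsilon> sqrt(r / 2);
        the exponent yields r^(p + 1), one power more than the growth of h.\<close>
      define c where "c = fact (2 * (p + 1)) * 2 ^ (p + 1) / \<epsilon> ^ (2 * (p + 1))"
      have c0: "c \<ge> 0" unfolding c_def using \<epsilon> by simp
      have "norm (h z * ?w \<epsilon> z) \<le> D + 1" if zS: "z \<in> S" and r: "norm z \<ge> max 1 c" for z
      proof -
        define r where "r = norm z"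
        have r1: "r \<ge> 1" "r \<ge> c" using r unfolding r_def by auto
        have x0: "\<epsilon> * sqrt (r / 2) > 0" using \<epsilon> r1 by simp
        have "(\<epsilon> * sqrt (r / 2)) ^ (2 * (p + 1)) = \<epsilon> ^ (2 * (p + 1)) * ((sqrt (r / 2))\<^sup>2) ^ (p + 1)"
          unfolding power_mult_distrib by (simp only: power_mult)
        also have "\<dots> = \<epsilon> ^ (2 * (p + 1)) * (r / 2) ^ (p + 1)" using r1 by simp
        finally have "fact (2 * (p + 1)) / (\<epsilon> * sqrt (r / 2)) ^ (2 * (p + 1)) = c / r ^ (p + 1)"
          unfolding c_def using \<epsilon> by (simp add: power_divide)
        then have we: "norm (?w \<epsilon> z) \<le> c / r ^ (p + 1)"
          using order.trans[OF w_norm[OF \<epsilon> zS] exp_minus_le_power[OF x0[unfolded r_def], of "2 * (p + 1)"]]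
          unfolding r_def by simp
        have "norm (h z) \<le> D * Im z ^ p" using growth zS unfolding S_def by simp
        also have "\<dots> \<le> D * r ^ p"
          using zS D abs_Im_le_cmod[of z] unfolding S_def r_def by (intro mult_left_mono power_mono) auto
        finally have he: "norm (h z) \<le> D * r ^ p" .
        have "norm (h z * ?w \<epsilon> z) \<le> (D * r ^ p) * (c / r ^ (p + 1))"
          unfolding norm_mult using he we D r1 by (intro mult_mono) auto
        also have "\<dots> = D * (c / r)" using r1 by simp
        also have "\<dots> \<le> D * 1" using r1 D c0 by (intro mult_left_mono) auto
        finally show ?thesis by simp
      qed
      then show ?thesis by blast
    qed
  qed
qed

context ramanujan_twists
begin

text \<open>The slashed function has period N. On a strip covering one period the bound for f near
  the real line becomes polynomial growth in Im z; periodicity extends this to Im z \<ge> 1, and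
  Phragmen-Lindeloef improves it to boundedness.\<close>

lemma cusp_bounded:
  assumes K: "\<And>A. A \<in> Gamma0 N \<Longrightarrow> A \<in> K" and det: "a * d - b * c = (1::int)"
  shows "\<exists>C. \<forall>z. Im z \<ge> 1 \<longrightarrow>
           norm (f ((of_int a * z + of_int b) / (of_int c * z + of_int d))) \<le> C * norm (of_int c * z + of_int d) ^ k"
proof -
  define G where "G = rmat (a, b, c, d)"
  define h where "h = slash k G F"
  have detr: "real_of_int a * of_int d - of_int b * of_int c = 1"
    using arg_cong[OF det, of real_of_int] by simp
  have mG: "mdet G > 0" unfolding G_def using detr by simp
  have h_hol: "h holomorphic_on UH" unfolding h_def by (rule slash_holomorphic[OF F_holomorphic mG])
  have per1: "h (z + of_nat N) = h z" if z: "Im z > 0" for z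
  proof -
    \<comment> \<open>A is the conjugate by (a, b; c, d) of the translation by N. It lies in
      \<open>Gamma0 N\<close>, and its upper left entry is 1 modulo N.\<close>
    define A :: imat where "A = (1 - a * c * int N, a * a * int N, - c * c * int N, 1 + a * c * int N)"
    have AG: "A \<in> Gamma0 N" unfolding A_def Gamma0_iff by (simp add: algebra_simps)
    have "\<xi> (1 - a * c * int N) = \<xi> 1" by (rule xi_dvd_cong) simp
    then have A: "slash k (rmat A) F = F"
      using K[OF AG] unfolding K_def act_def' by (simp add: A_def xi_1 del: slash.simps rmat.simps)
    have T: "mmul G (1, real N, 0, 1) = mmul (rmat A) G"
    proof -
      have "imul (a, b, c, d) (1, int N, 0, 1) = imul A (a, b, c, d)"
      proof -
        have "(1 - a * c * int N) * a + a * a * int N * c = a" "- c * c * int N * a + (1 + a * c * int N) * c = c"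
          by (simp_all add: algebra_simps)
        moreover have "(1 - a * c * int N) * b + a * a * int N * d = b + a * int N * (a * d - b * c)"
          "- c * c * int N * b + (1 + a * c * int N) * d = d + c * int N * (a * d - b * c)"
          by (simp_all add: algebra_simps)
        ultimately show ?thesis unfolding A_def imul.simps det by simp
      qed
      from arg_cong[OF this, of rmat] show ?thesis unfolding rmat_imul G_def by simp
    qed
    have "slash k (1, real N, 0, 1) h = h"
      unfolding h_def slash_slash[of "(1, real N, 0, 1)", simplified] T
      using slash_slash[OF mG, of k "rmat A" F] A by simp
    from fun_cong[OF this, of z] show ?thesis using z by simp
  qed
  have per: "h (z + of_int (int N * n)) = h z" if z: "Im z > 0" for z n
  proof (induction n rule: int_induct[where k = 0])
    case (step1 i)
    then show ?case using per1[of "z + of_int (int N * i)"] z by (simp add: algebra_simps)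
  next
    case (step2 i)
    then show ?case using per1[of "z + of_int (int N * (i - 1))"] z by (simp add: algebra_simps)
  qed simp
  obtain Cf Cg where Cf: "\<And>m. norm (fc (Suc m)) \<le> Cf * real (Suc m) powr \<sigma>"
    by (rule coeff_bounds) blast
  obtain p0 :: nat where p0: "real p0 \<ge> \<sigma> + 2" using real_arch_simple by blast
  \<comment> \<open>The maximum with k keeps the natural number difference 2 p - k below from being
    truncated.\<close>
  define p where "p = max p0 k"
  have p: "real p \<ge> \<sigma> + 2" "p \<ge> k" using p0 unfolding p_def by auto
  obtain D where D: "D \<ge> 0" "\<And>z. Im z > 0 \<Longrightarrow> norm (f z) \<le> D / Im z ^ p"
    using fser_bound[OF Cf p(1)] unfolding f_def by blast
  define E where "E = \<bar>real_of_int c\<bar> * (real N + 1) + \<bar>real_of_int d\<bar>"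
  have E0: "E \<ge> 0" unfolding E_def by simp
  have strip: "norm (h z) \<le> D * E ^ (2 * p - k) * Im z ^ p" if y: "Im z \<ge> 1" and x: "\<bar>Re z\<bar> \<le> real N" for z
  proof -
    define j where "j = of_int c * z + of_int d"
    have y0: "Im z > 0" using y by simp
    have j0: "j \<noteq> 0" unfolding j_def using denominator_nonzero[OF y0, of "of_int a" "of_int d" "of_int b" "of_int c"] detr by simp
    have nj: "norm j > 0" using j0 by simp
    have im: "Im ((of_int a * z + of_int b) / j) = Im z / (norm j)\<^sup>2"
      unfolding j_def using Im_moebius[of "of_int a" z "of_int b" "of_int c" "of_int d"] detr by simp
    have jE: "norm j \<le> E * Im z"
    proof -
      have "norm j \<le> \<bar>real_of_int c\<bar> * norm z + \<bar>real_of_int d\<bar>"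
        unfolding j_def by (rule order.trans[OF norm_triangle_ineq]) (simp add: norm_mult)
      also have "\<dots> \<le> \<bar>real_of_int c\<bar> * ((real N + 1) * Im z) + \<bar>real_of_int d\<bar> * Im z"
      proof (intro add_mono mult_left_mono)
        have "norm z \<le> real N * 1 + Im z" using cmod_le[of z] x y by simp
        also have "\<dots> \<le> real N * Im z + Im z" using y by (intro add_mono mult_left_mono) auto
        finally show "norm z \<le> (real N + 1) * Im z" by (simp add: algebra_simps)
        show "\<bar>real_of_int d\<bar> \<le> \<bar>real_of_int d\<bar> * Im z" using mult_left_mono[OF y, of "\<bar>real_of_int d\<bar>"] by simp
      qed auto
      finally show ?thesis unfolding E_def by (simp add: algebra_simps)
    qed
    have "norm (h z) = norm (f ((of_int a * z + of_int b) / j)) / norm j ^ k"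
      using y0 im nj unfolding h_def G_def F_def j_def by (simp add: norm_divide norm_power)
    also have "\<dots> \<le> (D / (Im z / (norm j)\<^sup>2) ^ p) / norm j ^ k"
      using D(2)[of "(of_int a * z + of_int b) / j"] y0 nj unfolding im by (intro divide_right_mono) auto
    also have "\<dots> = D * norm j ^ (2 * p) / Im z ^ p / norm j ^ k"
      by (simp add: power_divide power_mult)
    also have "\<dots> = D * norm j ^ (2 * p - k) / Im z ^ p"
      using nj p(2) by (simp add: power_diff)
    also have "\<dots> \<le> D * (E * Im z) ^ (2 * p - k) / Im z ^ p"
      using jE D(1) y0 by (intro divide_right_mono mult_left_mono power_mono) auto
    also have "\<dots> = D * E ^ (2 * p - k) * (Im z ^ (2 * p - k) / Im z ^ p)"
      by (simp add: power_mult_distrib)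
    also have "\<dots> \<le> D * E ^ (2 * p - k) * Im z ^ p"
    proof (intro mult_left_mono)
      have "Im z ^ (2 * p - k) \<le> Im z ^ (p + p)" using y by (intro power_increasing) auto
      then show "Im z ^ (2 * p - k) / Im z ^ p \<le> Im z ^ p" using y0 by (simp add: divide_le_eq power_add)
    qed (use D E0 in auto)
    finally show ?thesis .
  qed
  have growth: "norm (h z) \<le> D * E ^ (2 * p - k) * Im z ^ p" if y: "Im z \<ge> 1" for z
  proof -
    \<comment> \<open>The multiple of N that moves Re z into [0, N).\<close>
    define n where "n = - \<lfloor>Re z / real N\<rfloor>"
    have N0: "real N > 0" using N by simp
    have "real N * of_int \<lfloor>Re z / real N\<rfloor> \<le> real N * (Re z / real N)"
      by (intro mult_left_mono of_int_floor_le) simp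
    moreover have "real N * (Re z / real N) < real N * (of_int \<lfloor>Re z / real N\<rfloor> + 1)"
      by (intro mult_strict_left_mono N0) linarith
    moreover have "real N * (Re z / real N) = Re z" using N0 by simp
    ultimately have "real N * of_int \<lfloor>Re z / real N\<rfloor> \<le> Re z" "Re z < real N * of_int \<lfloor>Re z / real N\<rfloor> + real N"
      by (simp_all only: distrib_left mult_1_right)
    then have "\<bar>Re (z + of_int (int N * n))\<bar> \<le> real N" unfolding n_def by simp
    then have "norm (h (z + of_int (int N * n))) \<le> D * E ^ (2 * p - k) * Im (z + of_int (int N * n)) ^ p"
      by (intro strip) (use y in auto)
    then show ?thesis using per[of z n] y by simp
  qed
  define C where "C = D * E ^ (2 * p - k) + 1"
  have bound: "norm (h z) \<le> C" if "Im z \<ge> 1" for z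
    unfolding C_def by (rule phragmen_lindelof_upper_half_plane[OF h_hol _ growth that]) (use D E0 in auto)
  have "norm (f ((of_int a * z + of_int b) / (of_int c * z + of_int d))) \<le> C * norm (of_int c * z + of_int d) ^ k"
    if y: "Im z \<ge> 1" for z
  proof -
    have y0: "Im z > 0" using y by simp
    have det0: "real_of_int a * of_int d - of_int b * of_int c > 0" using detr by simp
    have j0: "of_int c * z + of_int d \<noteq> 0"
      using denominator_nonzero[OF y0 det0] by simp
    have "Im ((of_int a * z + of_int b) / (of_int c * z + of_int d)) > 0"
      using Im_moebius_pos[OF y0 det0] by simp
    then have "norm (h z) = norm (f ((of_int a * z + of_int b) / (of_int c * z + of_int d))) / norm (of_int c * z + of_int d) ^ k"
      using y0 unfolding h_def G_def F_def by (simp add: norm_divide norm_power)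
    then show ?thesis using bound[OF y] j0 by (simp add: divide_le_eq)
  qed
  then show ?thesis by blast
qed

lemma modular_form_if_Gamma0_subset_K:
  assumes K: "\<And>A. A \<in> Gamma0 N \<Longrightarrow> A \<in> K"
  shows "f \<in> modular_forms k N \<xi>"
  unfolding modular_forms_def mem_Collect_eq
proof (intro conjI allI impI ballI)
  show "f holomorphic_on upper_half_plane" using f_holomorphic unfolding upper_half_plane_def .
next
  fix a b c d :: int and z
  assume *: "a * d - b * c = 1 \<and> int N dvd c" and "z \<in> upper_half_plane"
  then have z: "Im z > 0" unfolding upper_half_plane_def by simp
  have G: "(a, b, c, d) \<in> Gamma0 N" using * by simp
  have detr: "real_of_int a * of_int d - of_int b * of_int c > 0"
    using arg_cong[OF conjunct1[OF *], of real_of_int] by simp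
  have j0: "of_int c * z + of_int d \<noteq> 0" using denominator_nonzero[OF z detr] by simp
  have im: "Im ((of_int a * z + of_int b) / (of_int c * z + of_int d)) > 0" using Im_moebius_pos[OF z detr] by simp
  have "act (a, b, c, d) F z = F z" using K[OF G] unfolding K_def by simp
  then have 1: "\<xi> a * (f ((of_int a * z + of_int b) / (of_int c * z + of_int d)) / (of_int c * z + of_int d) ^ k) = f z"
    using z im by (simp add: act_def F_def)
  \<comment> \<open>\<open>act\<close> carries the character of a, the transformation law that of d;
    as a d = 1 modulo N, the two values are inverse to each other.\<close>
  have "\<xi> d * \<xi> a = \<xi> (a * d)" by (simp add: xi_mult)
  also have "\<dots> = \<xi> 1" by (rule xi_dvd_cong) (use * in \<open>auto simp: algebra_simps\<close>)
  finally have 2: "\<xi> d * \<xi> a = 1" by (simp add: xi_1)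
  have "\<xi> d * (of_int c * z + of_int d) ^ k * f z =
      (\<xi> d * \<xi> a) * f ((of_int a * z + of_int b) / (of_int c * z + of_int d))"
    unfolding 1[symmetric] using j0 by simp
  then show "f ((of_int a * z + of_int b) / (of_int c * z + of_int d)) = \<xi> d * (of_int c * z + of_int d) ^ k * f z"
    unfolding 2 by simp
next
  fix a b c d :: int assume "a * d - b * c = 1"
  from cusp_bounded[OF K this] show "\<exists>C. \<forall>z. 1 \<le> Im z \<longrightarrow>
      norm (f ((of_int a * z + of_int b) / (of_int c * z + of_int d))) \<le> C * norm (of_int c * z + of_int d) ^ k"
    .
qed

end

theorem theorem2p1:
  fixes N k :: nat and \<xi> :: "int \<Rightarrow> complex" and fc gc :: "nat \<Rightarrow> complex" and \<sigma> :: real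
  assumes N: "N \<ge> 1" "N \<le> 9 \<or> N \<in> {11, 15, 17, 23}"
    and chi: "dirichlet_character N \<xi>"
    and k: "k > 0" "\<xi> (-1) = (-1) ^ k"
    and sigma: "\<sigma> > 0"
    and growth_f: "\<exists>C. \<forall>n\<ge>1. norm (fc n) \<le> C * real n powr \<sigma>"
    and growth_g: "\<exists>C. \<forall>n\<ge>1. norm (gc n) \<le> C * real n powr \<sigma>"
    and FE: "\<forall>q::nat. q \<ge> 1 \<and> coprime q N \<longrightarrow>
       (\<exists>F G. entire_finite_order F \<and> entire_finite_order G \<and>
          (\<forall>s. Re s > \<sigma> + 1 - (real k - 1) / 2 \<longrightarrow>
               F s = Lambda_twist k fc q s \<and> G s = Lambda_twist k gc q s) \<and>
          (\<forall>s. F s = \<i> ^ k * \<xi> (int q) * (of_nat (N * q\<^sup>2)) powr (1/2 - s) * G (1 - s)))"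
  shows "(\<lambda>z. \<Sum>m. fc (Suc m) * e (of_nat (Suc m) * z)) \<in> modular_forms k N \<xi>"
proof -
  interpret ramanujan_twists N k \<xi> fc gc \<sigma>
    using assms by unfold_locales auto
  have "int N \<in> {1, 2, 3, 4, 5, 6, 7, 8, 9, 11, 15, 17, 23}" using assms(1,2)
    unfolding insert_iff empty_iff by presburger
  then have "A \<in> K" if "A \<in> Gamma0 N" for A
    using that Gamma0_subset_K_level_1 Gamma0_subset_K_level_2_3_4 Gamma0_subset_K_level_5 Gamma0_subset_K_level_6 Gamma0_subset_K_level_7 Gamma0_subset_K_level_8 Gamma0_subset_K_level_9 Gamma0_subset_K_level_11 Gamma0_subset_K_level_15 Gamma0_subset_K_level_17 Gamma0_subset_K_level_23 by blast
  from modular_form_if_Gamma0_subset_K[OF this] show ?thesis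
    unfolding f_def fser_def .
qed

end
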